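(* Let $Q=\mathrm{diag}(a_1,\dots,a_m)$ with $a_i\in\mathbb Z\setminus\{0\}$ be a diagonal integral quadratic form and let $k\in\mathbb Z$, $k\neq0$. If $m$ is odd, write $k\det(Q)=c^2b$ with $c,b\in\mathbb Z$ and $b$ squarefree, and set $D=(-1)^{\frac{m-1}{2}}b$ if $(-1)^{\frac{m-1}{2}}b\equiv 1\pmod 4$ and $D=4(-1)^{\frac{m-1}{2}}b$ otherwise. Then \[ \delta(Q,k)=\frac{L(\frac{m-1}{2},D)}{\zeta(m-1)}\prod_{p\mid D}\frac{\delta_p(Q,k)}{1-p^{-(m-1)}}\prod_{\substack{p\nmid D\\ p\mid 2k\det(Q)}}\frac{\delta_p(Q,k)}{1+\left(\frac{D}{p}\right)p^{-\frac{m-1}{2}}}. \] If $m$ is even, write $\det(Q)=c^2b$ with $c,b\in\mathbb Z$ and $b$ squarefree, and set $D=(-1)^{\frac m2}b$ if $(-1)^{\frac m2}b\equiv1\pmod4$ and $D=4(-1)^{\frac m2}b$ otherwise. Then \[ \delta(Q,k)=\frac{1}{L(m/2,D)}\prod_{p\mid 2k\det(Q)}\frac{\delta_p(Q,k)}{1-\left(\frac{D}{p}\right)p^{-\frac m2}}. \]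
   Context: $Q[x]=a_1x_1^2+\dots+a_mx_m^2$. For a prime $p$, $\delta_p(Q,k)=\lim_{j\to\infty}\#\{x\in(\mathbb Z/p^j\mathbb Z)^m:Q[x]\equiv k\bmod p^j\}/p^{j(m-1)}$, and the local density is $\delta(Q,k)=\prod_p\delta_p(Q,k)$ over all primes $p$. All products in the claim are over primes. $\zeta$ is the Riemann zeta function, $\left(\frac{D}{\cdot}\right)$ is the Kronecker symbol, and $L(s,D)=\sum_{n\geq1}\left(\frac{D}{n}\right)n^{-s}=\prod_p\left(1-\left(\frac Dp\right)p^{-s}\right)^{-1}$.
   Formalization: Proved for m ≥ 2: for m = 1 the formula fails, as 1−p^{-(m-1)} = 0 and L(0,D) diverges (a_1 = k = 1 makes δ(Q,k) diverge). Products and series are ordered limits; if D = 1 and m is 2 or 3, L(1,1) = ∞ with 1/∞ = 0 and ∞·0 = 0. *)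

theory Defs
  imports
    Complex_Main
    "HOL-Library.Extended_Real"
    "HOL-Library.FuncSet"
    "HOL-Computational_Algebra.Squarefree"
    "HOL-Number_Theory.Number_Theory"
    "Jordan_Normal_Form.Determinant"
begin

text \<open>
  The diagonal form \<open>diag(a\<^sub>1, \<dots>, a\<^sub>m)\<close> is given by \<open>m\<close> and a function \<open>a\<close>, of which only
  the values \<open>a 0, \<dots>, a (m - 1)\<close> matter.
\<close>

definition diag_form :: "nat \<Rightarrow> (nat \<Rightarrow> int) \<Rightarrow> (nat \<Rightarrow> int) \<Rightarrow> int" where
  "diag_form m a x = (\<Sum>i<m. a i * (x i)\<^sup>2)"

definition diag_det :: "nat \<Rightarrow> (nat \<Rightarrow> int) \<Rightarrow> int" where
  "diag_det m a = Determinant.det (mat_diag m a)"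

text \<open>\<open>\<int>/p\<^sup>j\<int>\<close> is represented by the residues \<open>0, \<dots>, p\<^sup>j - 1\<close>.\<close>

definition solutions_mod :: "nat \<Rightarrow> (nat \<Rightarrow> int) \<Rightarrow> int \<Rightarrow> nat \<Rightarrow> (nat \<Rightarrow> int) set" where
  "solutions_mod m a k n =
     {x \<in> {..<m} \<rightarrow>\<^sub>E {0..<int n}. [diag_form m a x = k] (mod int n)}"

definition density_ratio :: "nat \<Rightarrow> (nat \<Rightarrow> int) \<Rightarrow> int \<Rightarrow> nat \<Rightarrow> nat \<Rightarrow> real" where
  "density_ratio m a k p j =
     real (card (solutions_mod m a k (p ^ j))) / real (p ^ (j * (m - 1)))"

definition local_density_at :: "nat \<Rightarrow> (nat \<Rightarrow> int) \<Rightarrow> int \<Rightarrow> nat \<Rightarrow> real" where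
  "local_density_at m a k p = lim (density_ratio m a k p)"

text \<open>
  The product over all primes is taken in increasing order of the primes, because it need not
  converge absolutely for \<open>m \<le> 3\<close>. It lives in the extended reals since it may diverge to
  \<open>\<infinity>\<close>: for \<open>m = 3\<close> this happens when \<open>- k det(Q)\<close> is a square and no factor vanishes.
\<close>

definition partial_density :: "nat \<Rightarrow> (nat \<Rightarrow> int) \<Rightarrow> int \<Rightarrow> nat \<Rightarrow> ereal" where
  "partial_density m a k N = ereal (\<Prod>p | prime p \<and> p \<le> N. local_density_at m a k p)"

definition local_density :: "nat \<Rightarrow> (nat \<Rightarrow> int) \<Rightarrow> int \<Rightarrow> ereal" where
  "local_density m a k = lim (partial_density m a k)"

text \<open>The Kronecker symbol \<open>(D/n)\<close>, meaningful for \<open>n \<ge> 1\<close> only.\<close>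

definition kronecker_prime :: "int \<Rightarrow> nat \<Rightarrow> int" where
  "kronecker_prime D p =
     (if p = 2 then (if even D then 0 else if D mod 8 \<in> {1, 7} then 1 else -1)
      else Legendre D (int p))"

definition kronecker :: "int \<Rightarrow> nat \<Rightarrow> int" where
  "kronecker D n = (\<Prod>p\<in>#prime_factorization n. kronecker_prime D p)"

text \<open>
  The Dirichlet series as the limit of its partial sums. Convergence at \<open>s = 1\<close> is only
  conditional, and \<open>L(1, 1) = \<infinity>\<close>; hence the extended reals.
\<close>

definition L_series :: "real \<Rightarrow> int \<Rightarrow> ereal" where
  "L_series s D =
     lim (\<lambda>N. ereal (\<Sum>n=1..N. real_of_int (kronecker D n) * real n powr (- s)))"

text \<open>The Riemann zeta function on the half-line \<open>s > 1\<close>.\<close>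

definition zeta_real :: "real \<Rightarrow> real" where
  "zeta_real s = (\<Sum>n. real (Suc n) powr (- s))"

text \<open>For squarefree \<open>u\<close>, this is the discriminant of \<open>\<rat>(\<surd>u)\<close> (and \<open>1\<close> if \<open>u = 1\<close>).\<close>

definition quad_disc :: "int \<Rightarrow> int" where
  "quad_disc u = (if [u = 1] (mod 4) then u else 4 * u)"

end

theory Submission
  imports
    Defs
    "HOL-Analysis.Infinite_Sum"
    "HOL-Analysis.Uniform_Limit"
    "HOL-Analysis.Complex_Transcendental"
    "HOL-Analysis.Harmonic_Numbers"
begin

text \<open>
  By Hensel lifting the solution counts modulo \<open>p\<^sup>j\<close> are eventually proportional to \<open>p\<^sup>j\<^sup>(\<^sup>m\<^sup>-\<^sup>1\<^sup>)\<close>, and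
  already from \<open>j = 1\<close> on if \<open>p\<close> does not divide \<open>2 k\<close>. Counting modulo \<open>p\<close>, one variable at a time,
  shows that for \<open>p\<close> not dividing \<open>2 k det(Q)\<close> the density is \<open>1 - (D/p) p\<^sup>-\<^sup>m\<^sup>/\<^sup>2\<close> for even \<open>m\<close> and
  \<open>1 + (D/p) p\<^sup>-\<^sup>(\<^sup>m\<^sup>-\<^sup>1\<^sup>)\<^sup>/\<^sup>2\<close> for odd \<open>m\<close>, so that up to finitely many factors the density is an Euler
  product of \<open>1/L\<close> or of \<open>L/\<zeta>\<close>. These products converge absolutely except at \<open>s = 1\<close>, that is, for
  \<open>m = 2\<close> and \<open>m = 3\<close>. There, quadratic reciprocity makes \<open>(D/\<cdot>)\<close> a nonprincipal character with
  bounded partial sums; a Lambert series argument gives \<open>L(1, D) \<noteq> 0\<close>; then Chebyshev's bound and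
  Mertens' argument show that \<open>\<Sum> (D/p)/p\<close> converges, and Abel's theorem identifies the ordered Euler
  product with \<open>1/L(1, D)\<close>.
\<close>

section \<open>Hensel lifting for diagonal forms\<close>

text \<open>Convergence of \<open>L(1, D)\<close> does not by itself make the Euler product at
  \<open>s = 1\<close>, taken in increasing order of the primes, converge; the limit as
  \<open>s\<close> decreases to 1 only tells what its value must be. Convergence therefore comes
  from the sum of \<open>(D/p)/p\<close>, and bounding that sum means dividing by
  \<open>L(1, D)\<close>, which is why nonvanishing is settled before it. The densities at the
  finitely many bad primes are never computed: they enter as quotients by comparison factors that
  are positive for every prime. The degenerate case is \<open>D = 1\<close> at \<open>s = 1\<close>,
  where \<open>L\<close> is \<open>\<infinity>\<close> and the Euler factors tend to 0 because the
  harmonic series diverges. For \<open>m = 2\<close> both sides are then 0. For \<open>m = 3\<close>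
  both are \<open>\<infinity>\<close>, unless a bad density vanishes; in that case the partial
  products are eventually 0, which agrees with \<open>\<infinity> * 0 = 0\<close> in the extended
  reals.\<close>

lemma sum_residues_translate:
  fixes f :: "int \<Rightarrow> 'b::comm_monoid_add" and n \<alpha> \<beta> :: int
  assumes "n > 0" "coprime \<alpha> n" and f: "\<And>x y. [x = y] (mod n) \<Longrightarrow> f x = f y"
  shows "(\<Sum>x\<in>{0..<n}. f (\<alpha> * x + \<beta>)) = (\<Sum>x\<in>{0..<n}. f x)"
proof -
  let ?h = "\<lambda>x. (\<alpha> * x + \<beta>) mod n"
  have inj: "inj_on ?h {0..<n}"
  proof (rule inj_onI)
    fix x y assume xy: "x \<in> {0..<n}" "y \<in> {0..<n}" "?h x = ?h y"
    then have "[\<alpha> * x + \<beta> = \<alpha> * y + \<beta>] (mod n)" by (simp add: cong_def)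
    then have "[x = y] (mod n)"
      using assms(2) by (simp add: cong_add_rcancel cong_mult_lcancel)
    then show "x = y" using xy by (auto simp: cong_def)
  qed
  have "?h ` {0..<n} = {0..<n}"
    by (rule endo_inj_surj[OF _ _ inj]) (use assms(1) in auto)
  then have "bij_betw ?h {0..<n} {0..<n}" using inj by (simp add: bij_betw_def)
  then have "(\<Sum>x\<in>{0..<n}. f (?h x)) = (\<Sum>x\<in>{0..<n}. f x)"
    by (rule sum.reindex_bij_betw)
  moreover have "f (?h x) = f (\<alpha> * x + \<beta>)" for x by (rule f) (simp add: cong_def)
  ultimately show ?thesis by simp
qed

lemma sum_residues_mult:
  fixes f :: "int \<Rightarrow> nat" and n :: int and q :: nat
  assumes "n > 0" and f: "\<And>x y. [x = y] (mod n) \<Longrightarrow> f x = f y"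
  shows "(\<Sum>x\<in>{0..<n * int q}. f x) = q * (\<Sum>x\<in>{0..<n}. f x)"
proof (induction q)
  case 0 then show ?case by simp
next
  case (Suc q)
  have "{0..<n * int (Suc q)} = {0..<n * int q} \<union> {n * int q..<n * int q + n}"
    using assms(1) by (subst ivl_disj_un_two(3)) (auto simp: algebra_simps)
  also have "sum f \<dots> = sum f {0..<n * int q} + sum f {n * int q..<n * int q + n}"
    by (rule sum.union_disjoint) auto
  also have "sum f {n * int q..<n * int q + n} = (\<Sum>x\<in>{0..<n}. f (x + n * int q))"
    by (rule sum.reindex_bij_witness[of _ "\<lambda>x. x + n * int q" "\<lambda>x. x - n * int q"]) auto
  also have "\<dots> = sum f {0..<n}"
    by (intro sum.cong refl f) (simp add: cong_def)
  finally show ?case using Suc by simp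
qed

lemma sum_PiE_insert:
  assumes "i \<notin> I"
  shows "(\<Sum>x\<in>insert i I \<rightarrow>\<^sub>E S. f x) = (\<Sum>y\<in>I \<rightarrow>\<^sub>E S. \<Sum>v\<in>S. f (y(i := v)))"
proof -
  have "(\<Sum>x\<in>insert i I \<rightarrow>\<^sub>E S. f x) = (\<Sum>(v, y)\<in>S \<times> (I \<rightarrow>\<^sub>E S). f (y(i := v)))"
    unfolding PiE_insert_eq
    by (subst sum.reindex[OF inj_combinator[OF assms]]) (simp add: case_prod_unfold comp_def)
  also have "\<dots> = (\<Sum>v\<in>S. \<Sum>y\<in>I \<rightarrow>\<^sub>E S. f (y(i := v)))" by (rule sum.cartesian_product[symmetric])
  also have "\<dots> = (\<Sum>y\<in>I \<rightarrow>\<^sub>E S. \<Sum>v\<in>S. f (y(i := v)))" by (rule sum.swap)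
  finally show ?thesis .
qed

text \<open>Accounts for the variables that are not lifted: each of them runs \<open>q\<close> times
  through a full period and contributes a factor \<open>q\<close>.\<close>

lemma sum_PiE_residues_mult:
  fixes f :: "('i \<Rightarrow> int) \<Rightarrow> nat" and n :: int and q :: nat
  assumes "finite I" "n > 0"
    and "\<And>x y. (\<And>i. i \<in> I \<Longrightarrow> [x i = y i] (mod n)) \<Longrightarrow> f x = f y"
  shows "(\<Sum>x\<in>I \<rightarrow>\<^sub>E {0..<n * int q}. f x) = q ^ card I * (\<Sum>x\<in>I \<rightarrow>\<^sub>E {0..<n}. f x)"
  using assms(1,3)
proof (induction I arbitrary: f rule: finite_induct)
  case empty then show ?case by simp
next
  case (insert i I)
  have "(\<Sum>x\<in>insert i I \<rightarrow>\<^sub>E {0..<n * int q}. f x)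
      = (\<Sum>y\<in>I \<rightarrow>\<^sub>E {0..<n * int q}. \<Sum>v\<in>{0..<n * int q}. f (y(i := v)))"
    by (rule sum_PiE_insert[OF insert.hyps(2)])
  also have "\<dots> = (\<Sum>y\<in>I \<rightarrow>\<^sub>E {0..<n * int q}. q * (\<Sum>v\<in>{0..<n}. f (y(i := v))))"
    by (intro sum.cong refl sum_residues_mult assms(2) insert.prems) auto
  also have "\<dots> = q ^ card I * (\<Sum>y\<in>I \<rightarrow>\<^sub>E {0..<n}. q * (\<Sum>v\<in>{0..<n}. f (y(i := v))))"
    by (rule insert.IH) (intro arg_cong[of _ _ "(*) q"] sum.cong refl insert.prems, auto)
  also have "\<dots> = q ^ card (insert i I) * (\<Sum>y\<in>I \<rightarrow>\<^sub>E {0..<n}. \<Sum>v\<in>{0..<n}. f (y(i := v)))"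
    using insert.hyps by (simp add: sum_distrib_left mult_ac)
  also have "(\<Sum>y\<in>I \<rightarrow>\<^sub>E {0..<n}. \<Sum>v\<in>{0..<n}. f (y(i := v))) = (\<Sum>x\<in>insert i I \<rightarrow>\<^sub>E {0..<n}. f x)"
    by (rule sum_PiE_insert[OF insert.hyps(2), symmetric])
  finally show ?case .
qed

lemma card_residues_mult:
  fixes n :: int and q :: nat
  assumes "n > 0" and P: "\<And>x y. [x = y] (mod n) \<Longrightarrow> P x \<longleftrightarrow> P y"
  shows "card {x\<in>{0..<n * int q}. P x} = q * card {x\<in>{0..<n}. P x}"
proof -
  have "card {x\<in>{0..<N}. P x} = (\<Sum>x\<in>{0..<N}. if P x then 1 else 0)" for N :: int
    by (simp add: sum.If_cases Int_def)
  then show ?thesis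
    using sum_residues_mult[OF assms(1), of "\<lambda>x. if P x then 1 else 0" q] P by simp
qed

text \<open>One step of Hensel lifting: \<open>a x\<^sup>2 \<equiv> t\<close> modulo \<open>p\<^sup>j\<close> is a condition on \<open>x\<close> modulo
  \<open>p\<^sup>j\<^sup>-\<^sup>d\<close> when \<open>p\<^sup>d\<close> is the exact power of \<open>p\<close> in the derivative \<open>2 a x\<close>.\<close>

lemma card_square_cong_lift_exact:
  fixes p d j :: nat and a t :: int
  assumes p: "prime p" and j: "j \<ge> 2 * d + 1"
  defines "V \<equiv> \<lambda>x. int p ^ d dvd 2 * a * x \<and> \<not> int p ^ Suc d dvd 2 * a * x"
  shows "card {x\<in>{0..<int p ^ Suc j}. V x \<and> [a * x\<^sup>2 = t] (mod int p ^ Suc j)}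
       = card {x\<in>{0..<int p ^ j}. V x \<and> [a * x\<^sup>2 = t] (mod int p ^ j)}"
proof -
  \<comment> \<open>By \<open>key\<close>, a solution modulo \<open>p^l\<close> matters only modulo
    \<open>p^(l-d)\<close>, so both counts are \<open>p^d\<close> times a count over a shorter range
    (\<open>period\<close>), and the levels to compare are \<open>p^i\<close> and
    \<open>p^(i+1)\<close>. The bound \<open>j \<ge> 2 * d + 1\<close> gives
    \<open>i \<ge> d + 1\<close>, which preserves \<open>V\<close>, and
    \<open>2 * i \<ge> j + 1\<close>, which kills the quadratic Taylor term modulo
    \<open>p^(j+1)\<close>.\<close>
  define i where "i = j - d"
  have ij: "j = i + d" "i \<ge> Suc d" "2 * i \<ge> Suc j" using j by (auto simp: i_def)
  have p0: "int p > 0" using p by (simp add: prime_gt_0_nat)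
  have expand: "a * (x + int p ^ l * y)\<^sup>2 = a * x\<^sup>2 + int p ^ l * y * (2 * a * x) + int p ^ (2 * l) * (a * y\<^sup>2)"
    for x y l unfolding power_even_eq by (simp add: power2_eq_square algebra_simps)
  have Vcong: "V (x + int p ^ l * y) = V x" if "l \<ge> Suc d" for x y l
  proof -
    have *: "2 * a * (x + int p ^ l * y) = 2 * a * x + int p ^ l * (2 * a * y)"
      by (simp add: algebra_simps)
    have "int p ^ Suc d dvd int p ^ l" "int p ^ d dvd int p ^ l"
      using that by (simp_all add: le_imp_power_dvd del: power_Suc)
    then show ?thesis unfolding V_def *
      by (metis dvd_add_left_iff dvd_mult2)
  qed
  have key: "[a * (x + int p ^ (l - d) * y)\<^sup>2 = a * x\<^sup>2] (mod int p ^ l)"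
    if "V x" "l \<ge> j" for x y l
  proof -
    have "int p ^ l dvd int p ^ (l - d) * y * (2 * a * x)"
    proof -
      have "int p ^ ((l - d) + d) dvd int p ^ (l - d) * y * (2 * a * x)"
        using that(1) unfolding V_def power_add by (intro mult_dvd_mono dvd_triv_left) auto
      then show ?thesis using that(2) ij by simp
    qed
    moreover have "int p ^ l dvd int p ^ (2 * (l - d)) * (a * y\<^sup>2)"
      by (intro dvd_mult2 le_imp_power_dvd) (use that(2) j in simp)
    ultimately show ?thesis unfolding expand by (simp add: cong_iff_dvd_diff)
  qed
  have period: "card {x\<in>{0..<int p ^ l}. V x \<and> [a * x\<^sup>2 = t] (mod int p ^ l)}
      = p ^ d * card {x\<in>{0..<int p ^ (l - d)}. V x \<and> [a * x\<^sup>2 = t] (mod int p ^ l)}"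
    if l: "l \<ge> j" for l
  proof -
    have "card {x\<in>{0..<int p ^ (l - d) * int (p ^ d)}. V x \<and> [a * x\<^sup>2 = t] (mod int p ^ l)}
      = p ^ d * card {x\<in>{0..<int p ^ (l - d)}. V x \<and> [a * x\<^sup>2 = t] (mod int p ^ l)}"
    proof (rule card_residues_mult)
      fix x y :: int assume "[x = y] (mod int p ^ (l - d))"
      then obtain z where y: "y = x + int p ^ (l - d) * z"
        by (auto simp: cong_iff_lin)
      have V: "V y = V x" unfolding y by (rule Vcong) (use l ij in simp)
      show "(V x \<and> [a * x\<^sup>2 = t] (mod int p ^ l)) = (V y \<and> [a * y\<^sup>2 = t] (mod int p ^ l))"
        using V key[OF _ l, of x z] unfolding y by (auto simp: cong_def)
    qed (use p0 in simp)
    moreover have "int p ^ (l - d) * int (p ^ d) = int p ^ l"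
      using l ij by (simp flip: power_add)
    ultimately show ?thesis by simp
  qed
  let ?S = "{x\<in>{0..<int p ^ Suc i}. V x \<and> [a * x\<^sup>2 = t] (mod int p ^ Suc j)}"
  let ?T = "{x\<in>{0..<int p ^ i}. V x \<and> [a * x\<^sup>2 = t] (mod int p ^ j)}"
  \<comment> \<open>Dividing the Taylor expansion by \<open>p^j\<close> leaves a linear congruence
    modulo \<open>p\<close> whose coefficient \<open>g = 2 * a * x / p^d\<close> is a unit, so
    exactly one residue \<open>y\<close> works.\<close>
  have lift: "\<exists>g w. coprime g (int p) \<and> (\<forall>y. [a * (x + int p ^ i * y)\<^sup>2 = t] (mod int p ^ Suc j)
      \<longleftrightarrow> [g * y = w] (mod int p))" if V: "V x" and x: "[a * x\<^sup>2 = t] (mod int p ^ j)" for x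
  proof -
    obtain g where g: "2 * a * x = int p ^ d * g" using V unfolding V_def by (auto elim: dvdE)
    have "\<not> int p dvd g" using V g unfolding V_def by (auto simp: mult_ac)
    then have cop: "coprime g (int p)"
      using p by (metis coprime_commute prime_imp_coprime prime_nat_int_transfer)
    obtain w where w: "t - a * x\<^sup>2 = int p ^ j * w"
      using x by (metis cong_iff_dvd_diff cong_sym dvdE)
    have "[a * (x + int p ^ i * y)\<^sup>2 = t] (mod int p ^ Suc j) \<longleftrightarrow> [g * y = w] (mod int p)" for y
    proof -
      have "a * (x + int p ^ i * y)\<^sup>2 - t = int p ^ j * (g * y - w) + int p ^ (2 * i) * (a * y\<^sup>2)"
        unfolding expand g using w by (simp add: ij(1) power_add algebra_simps)
      moreover have "int p ^ Suc j dvd int p ^ (2 * i) * (a * y\<^sup>2)"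
        by (intro dvd_mult2 le_imp_power_dvd ij)
      ultimately have "[a * (x + int p ^ i * y)\<^sup>2 = t] (mod int p ^ Suc j) \<longleftrightarrow>
          int p ^ Suc j dvd int p ^ j * (g * y - w)"
        by (simp add: cong_iff_dvd_diff dvd_add_left_iff)
      also have "\<dots> \<longleftrightarrow> [g * y = w] (mod int p)"
        using p0 by (simp add: cong_iff_dvd_diff mult.commute[of "int p"])
      finally show ?thesis .
    qed
    then show ?thesis using cop by blast
  qed
  have "bij_betw (\<lambda>x. x mod int p ^ i) ?S ?T"
  proof (rule bij_betwI')
    fix x y assume x: "x \<in> ?S" and y: "y \<in> ?S"
    show "(x mod int p ^ i = y mod int p ^ i) = (x = y)"
    proof
      assume eq: "x mod int p ^ i = y mod int p ^ i"
      define r where "r = x mod int p ^ i"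
      obtain u where u: "x = r + int p ^ i * u" by (metis r_def add.commute mult_div_mod_eq)
      obtain v where v: "y = r + int p ^ i * v" by (metis r_def eq add.commute mult_div_mod_eq)
      have V: "V r" using x Vcong[of i r u] ij unfolding u by auto
      have "[a * (r + int p ^ i * u)\<^sup>2 = a * r\<^sup>2] (mod int p ^ j)"
        using key[OF V order.refl, of u] ij by simp
      moreover have "[a * (r + int p ^ i * u)\<^sup>2 = t] (mod int p ^ j)"
        using x unfolding u by (auto intro: cong_dvd_modulus simp: le_imp_power_dvd)
      ultimately have "[a * r\<^sup>2 = t] (mod int p ^ j)" by (metis cong_sym cong_trans)
      from lift[OF V this] obtain g w where "coprime g (int p)" "[g * u = w] (mod int p)" "[g * v = w] (mod int p)"
        using x y unfolding u v by auto
      then have "[u = v] (mod int p)"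
        by (metis cong_mult_lcancel cong_sym cong_trans)
      then have "[x = y] (mod int p ^ Suc i)"
        unfolding u v using p0 by (simp add: cong_iff_dvd_diff mult.commute[of "int p"] flip: right_diff_distrib)
      then show "x = y" using x y by (auto simp: cong_def)
    qed simp
  next
    fix x assume x: "x \<in> ?S"
    define r where "r = x mod int p ^ i"
    obtain u where u: "x = r + int p ^ i * u" by (metis r_def add.commute mult_div_mod_eq)
    have V: "V r" using x Vcong[of i r u] ij unfolding u by auto
    have "[a * (r + int p ^ i * u)\<^sup>2 = a * r\<^sup>2] (mod int p ^ j)"
      using key[OF V order.refl, of u] ij by simp
    moreover have "[a * (r + int p ^ i * u)\<^sup>2 = t] (mod int p ^ j)"
      using x unfolding u by (auto intro: cong_dvd_modulus simp: le_imp_power_dvd)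
    ultimately have "[a * r\<^sup>2 = t] (mod int p ^ j)" by (metis cong_sym cong_trans)
    then show "x mod int p ^ i \<in> ?T" using V p0 by (simp add: r_def)
  next
    fix r assume r: "r \<in> ?T"
    then obtain g w where gw: "coprime g (int p)"
      "\<And>y. [a * (r + int p ^ i * y)\<^sup>2 = t] (mod int p ^ Suc j) \<longleftrightarrow> [g * y = w] (mod int p)"
      using lift by blast
    obtain y0 where y0: "[g * y0 = w] (mod int p)" using gw(1)
      by (metis cong_solve_coprime_int cong_scalar_right mult.assoc mult_1)
    define y where "y = y0 mod int p"
    have y: "[g * y = w] (mod int p)" using y0 by (simp add: y_def cong_def mod_mult_right_eq)
    have yr: "0 \<le> y" "y \<le> int p - 1" using p0 by (auto simp: y_def)
    have "int p ^ i * y \<le> int p ^ i * (int p - 1)" using yr p0 by (intro mult_left_mono) auto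
    then have "r + int p ^ i * y \<in> {0..<int p ^ Suc i}" using r yr p0 by (auto simp: algebra_simps)
    moreover have "V (r + int p ^ i * y)" using r Vcong[of i r y] ij by auto
    ultimately have "r + int p ^ i * y \<in> ?S" using gw(2) y by auto
    moreover have "r = (r + int p ^ i * y) mod int p ^ i" using r by auto
    ultimately show "\<exists>x\<in>?S. r = x mod int p ^ i" by blast
  qed
  then have "card ?S = card ?T" by (rule bij_betw_same_card)
  then show ?thesis using period[of j] period[of "Suc j"] ij by (simp add: Suc_diff_le)
qed

text \<open>Splits according to the exact exponent \<open>d \<le> e\<close> of \<open>p\<close> in
  the derivative; the bound on \<open>j\<close> is strong enough for every such
  \<open>d\<close>.\<close>

lemma card_square_cong_lift:
  fixes p e j :: nat and a t :: int
  assumes p: "prime p" and j: "j \<ge> 2 * e + 1"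
  shows "card {x\<in>{0..<int p ^ Suc j}. \<not> int p ^ Suc e dvd 2 * a * x \<and> [a * x\<^sup>2 = t] (mod int p ^ Suc j)}
       = card {x\<in>{0..<int p ^ j}. \<not> int p ^ Suc e dvd 2 * a * x \<and> [a * x\<^sup>2 = t] (mod int p ^ j)}"
proof -
  define V where "V d x \<longleftrightarrow> int p ^ d dvd 2 * a * x \<and> \<not> int p ^ Suc d dvd 2 * a * x" for d x
  have V_iff: "\<not> int p ^ Suc e dvd 2 * a * x \<longleftrightarrow> (\<exists>d\<le>e. V d x)" for x
  proof
    assume *: "\<not> int p ^ Suc e dvd 2 * a * x"
    then have "\<not> int p ^ Suc (LEAST d. \<not> int p ^ Suc d dvd 2 * a * x) dvd 2 * a * x"
      by (rule LeastI)
    moreover have "(LEAST d. \<not> int p ^ Suc d dvd 2 * a * x) \<le> e"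
      using * by (rule Least_le)
    moreover have "int p ^ (LEAST d. \<not> int p ^ Suc d dvd 2 * a * x) dvd 2 * a * x"
    proof (cases "LEAST d. \<not> int p ^ Suc d dvd 2 * a * x")
      case (Suc d) then show ?thesis using not_less_Least[of d "\<lambda>d. \<not> int p ^ Suc d dvd 2 * a * x"] by auto
    qed simp
    ultimately show "\<exists>d\<le>e. V d x" unfolding V_def by blast
  next
    assume "\<exists>d\<le>e. V d x"
    then obtain d where d: "d \<le> e" "\<not> int p ^ Suc d dvd 2 * a * x" unfolding V_def by blast
    have "int p ^ Suc d dvd int p ^ Suc e" using d(1) by (intro le_imp_power_dvd) simp
    then show "\<not> int p ^ Suc e dvd 2 * a * x" using d(2) dvd_trans by blast
  qed
  have disj: "d = d'" if "V d x" "V d' x" for d d' x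
  proof -
    have False if "V d x" "V d' x" "d < d'" for d d'
    proof -
      have "int p ^ Suc d dvd int p ^ d'" using that(3) by (intro le_imp_power_dvd) simp
      then show False using that(1,2) unfolding V_def using dvd_trans by blast
    qed
    then show ?thesis using that by (metis linorder_neqE_nat)
  qed
  have split: "card {x\<in>{0..<n}. \<not> int p ^ Suc e dvd 2 * a * x \<and> [a * x\<^sup>2 = t] (mod n)}
      = (\<Sum>d\<le>e. card {x\<in>{0..<n}. V d x \<and> [a * x\<^sup>2 = t] (mod n)})" for n :: int
  proof -
    have "{x\<in>{0..<n}. \<not> int p ^ Suc e dvd 2 * a * x \<and> [a * x\<^sup>2 = t] (mod n)}
      = (\<Union>d\<le>e. {x\<in>{0..<n}. V d x \<and> [a * x\<^sup>2 = t] (mod n)})" unfolding V_iff by auto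
    also have "card \<dots> = (\<Sum>d\<le>e. card {x\<in>{0..<n}. V d x \<and> [a * x\<^sup>2 = t] (mod n)})"
    proof (rule card_UN_disjoint)
      show "\<forall>d\<in>{..e}. finite {x\<in>{0..<n}. V d x \<and> [a * x\<^sup>2 = t] (mod n)}"
        by (intro ballI finite_subset[OF _ finite_atLeastLessThan_int[of 0 n]]) auto
    qed (auto dest: disj)
    finally show ?thesis .
  qed
  show ?thesis unfolding split
  proof (rule sum.cong[OF refl])
    fix d assume "d \<in> {..e}"
    then have "j \<ge> 2 * d + 1" using j by simp
    from card_square_cong_lift_exact[OF p this, of a t]
    show "card {x\<in>{0..<int p ^ Suc j}. V d x \<and> [a * x\<^sup>2 = t] (mod int p ^ Suc j)}
        = card {x\<in>{0..<int p ^ j}. V d x \<and> [a * x\<^sup>2 = t] (mod int p ^ j)}"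
      unfolding V_def .
  qed
qed

lemma card_filter_eq_sum:
  "finite A \<Longrightarrow> card {x\<in>A. P x} = (\<Sum>x\<in>A. if P x then 1 else 0)"
  by (simp add: sum.If_cases Int_def)

text \<open>The solutions are grouped by the first index \<open>i\<close> with \<open>p\<^sup>e\<^sup>+\<^sup>1\<close> not dividing \<open>2 a\<^sub>i x\<^sub>i\<close> and lifted in
  that variable; if there were no such index, \<open>p\<^sup>e\<^sup>+\<^sup>1\<close> would divide \<open>2 Q[x]\<close> and hence \<open>2 k\<close>.\<close>

lemma card_solutions_mod_lift:
  fixes p e j m :: nat and a :: "nat \<Rightarrow> int" and k :: int
  assumes p: "prime p" and e: "\<not> int p ^ Suc e dvd 2 * k" and j: "j \<ge> 2 * e + 1"
  shows "card (solutions_mod m a k (p ^ Suc j)) = p ^ (m - 1) * card (solutions_mod m a k (p ^ j))"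
proof -
  define P where "P i x \<longleftrightarrow> \<not> int p ^ Suc e dvd 2 * a i * x" for i x
  define S where "S i l = {x\<in>solutions_mod m a k (p ^ l). P i (x i) \<and> (\<forall>i'<i. \<not> P i' (x i'))}" for i l
  have p0: "int p > 0" using p by (simp add: prime_gt_0_nat)
  have ex: "\<exists>i<m. P i (x i)" if x: "x \<in> solutions_mod m a k (p ^ l)" and l: "l \<ge> j" for x l
  proof (rule ccontr)
    assume "\<not> ?thesis"
    then have "int p ^ Suc e dvd 2 * a i * x i" if "i < m" for i
      using that unfolding P_def by blast
    then have "int p ^ Suc e dvd 2 * a i * x i * x i" if "i < m" for i
      using dvd_mult2[of _ "2 * a i * x i" "x i"] that by blast
    then have "int p ^ Suc e dvd (\<Sum>i<m. 2 * a i * x i * x i)" by (intro dvd_sum) blast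
    also have "\<dots> = 2 * diag_form m a x"
      by (simp add: diag_form_def sum_distrib_left power2_eq_square mult_ac)
    finally have 1: "int p ^ Suc e dvd 2 * diag_form m a x" .
    have "[diag_form m a x = k] (mod int p ^ l)" using x by (simp add: solutions_mod_def)
    then have "int p ^ l dvd diag_form m a x - k" by (simp add: cong_iff_dvd_diff)
    moreover have "int p ^ Suc e dvd int p ^ l" using l j by (intro le_imp_power_dvd) simp
    ultimately have "int p ^ Suc e dvd 2 * (diag_form m a x - k)" using dvd_trans dvd_mult by blast
    with 1 have "int p ^ Suc e dvd 2 * diag_form m a x - 2 * (diag_form m a x - k)"
      by (rule dvd_diff)
    then show False using e by (simp add: algebra_simps)
  qed
  have fin: "finite (solutions_mod m a k n)" for n
    unfolding solutions_mod_def by (rule finite_subset[of _ "{..<m} \<rightarrow>\<^sub>E {0..<int n}"]) (auto intro: finite_PiE)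
  have split: "card (solutions_mod m a k (p ^ l)) = (\<Sum>i<m. card (S i l))" if l: "l \<ge> j" for l
  proof -
    have "solutions_mod m a k (p ^ l) \<subseteq> (\<Union>i<m. S i l)"
    proof
      fix x assume x: "x \<in> solutions_mod m a k (p ^ l)"
      define i where "i = (LEAST i. P i (x i))"
      obtain i0 where i0: "i0 < m" "P i0 (x i0)" using ex[OF x l] by blast
      have "P i (x i)" unfolding i_def by (rule LeastI, rule i0(2))
      moreover have "i < m" using Least_le[of "\<lambda>i. P i (x i)", OF i0(2)] i0(1) by (simp add: i_def)
      moreover have "\<forall>i'<i. \<not> P i' (x i')" unfolding i_def by (auto dest: not_less_Least)
      ultimately show "x \<in> (\<Union>i<m. S i l)" using x by (auto simp: S_def)
    qed
    then have "solutions_mod m a k (p ^ l) = (\<Union>i<m. S i l)" by (auto simp: S_def)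
    also have "card \<dots> = (\<Sum>i<m. card (S i l))"
    proof (rule card_UN_disjoint)
      show "\<forall>i\<in>{..<m}. finite (S i l)" using fin by (simp add: S_def)
      show "\<forall>i\<in>{..<m}. \<forall>i'\<in>{..<m}. i \<noteq> i' \<longrightarrow> S i l \<inter> S i' l = {}"
      proof (intro ballI impI)
        fix i i' :: nat assume "i \<noteq> i'"
        then show "S i l \<inter> S i' l = {}" by (cases "i < i'") (auto simp: S_def)
      qed
    qed simp
    finally show ?thesis .
  qed
  have "card (S i (Suc j)) = p ^ (m - 1) * card (S i j)" if i: "i < m" for i
  proof -
    define I where "I = {..<m} - {i}"
    have I: "{..<m} = insert i I" "i \<notin> I" "finite I" "card I = m - 1" using i by (auto simp: I_def)
    define Q where "Q y = (\<Sum>i'\<in>I. a i' * (y i')\<^sup>2)" for y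
    define C where "C y \<longleftrightarrow> (\<forall>i'<i. \<not> P i' (y i'))" for y
    define f where "f l y = (if C y then card {v\<in>{0..<int p ^ l}. P i v \<and>
        [a i * v\<^sup>2 = k - Q y] (mod int p ^ l)} else 0)" for l y
    have form: "diag_form m a (y(i := v)) = a i * v\<^sup>2 + Q y" for y v
    proof -
      have "(\<Sum>i'\<in>I. a i' * ((y(i := v)) i')\<^sup>2) = Q y"
        unfolding Q_def using I(2) by (intro sum.cong refl) auto
      then show ?thesis unfolding diag_form_def I(1) using I(2,3) by simp
    qed
    have S: "card (S i l) = (\<Sum>y\<in>I \<rightarrow>\<^sub>E {0..<int p ^ l}. f l y)" for l
    proof -
      have "card (S i l) = (\<Sum>x\<in>insert i I \<rightarrow>\<^sub>E {0..<int p ^ l}. if [diag_form m a x = k] (mod int p ^ l) \<and> P i (x i) \<and> C x then 1 else 0)"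
      proof -
        have "S i l = {x\<in>insert i I \<rightarrow>\<^sub>E {0..<int p ^ l}. [diag_form m a x = k] (mod int p ^ l) \<and> P i (x i) \<and> C x}"
          unfolding S_def solutions_mod_def I(1) C_def by simp
        moreover have "finite (insert i I \<rightarrow>\<^sub>E {0..<int p ^ l})" using I(3) by (simp add: finite_PiE)
        ultimately show ?thesis by (simp add: card_filter_eq_sum)
      qed
      also have "\<dots> = (\<Sum>y\<in>I \<rightarrow>\<^sub>E {0..<int p ^ l}. \<Sum>v\<in>{0..<int p ^ l}.
          if C y \<and> P i v \<and> [a i * v\<^sup>2 = k - Q y] (mod int p ^ l) then 1 else 0)"
      proof -
        have "C (y(i := v)) = C y" for y v unfolding C_def by simp
        moreover have "[u + Q y = k] (mod n) \<longleftrightarrow> [u = k - Q y] (mod n)" for u n y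
          by (simp add: cong_iff_dvd_diff diff_diff_eq2 add.commute)
        ultimately show ?thesis unfolding sum_PiE_insert[OF I(2)] form
          by (simp add: conj_ac cong: conj_cong)
      qed
      also have "\<dots> = (\<Sum>y\<in>I \<rightarrow>\<^sub>E {0..<int p ^ l}. f l y)"
        unfolding f_def card_filter_eq_sum[OF finite_atLeastLessThan_int]
        by (intro sum.cong refl) simp
      finally show ?thesis .
    qed
    \<comment> \<open>Lifting in the coordinate \<open>i\<close> leaves the fibre count unchanged.
      The other \<open>m - 1\<close> coordinates now range modulo \<open>p^(j+1)\<close>, but
      \<open>f j\<close> depends on them only modulo \<open>p^j\<close>, so each contributes a
      factor \<open>p\<close>.\<close>
    have "f (Suc j) = f j"
      unfolding f_def P_def using card_square_cong_lift[OF p j] by (intro ext) simp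
    then have "card (S i (Suc j)) = (\<Sum>y\<in>I \<rightarrow>\<^sub>E {0..<int p ^ j * int p}. f j y)"
      unfolding S by (simp add: mult.commute)
    also have "\<dots> = p ^ card I * (\<Sum>y\<in>I \<rightarrow>\<^sub>E {0..<int p ^ j}. f j y)"
    proof (rule sum_PiE_residues_mult)
      fix x y :: "nat \<Rightarrow> int" assume xy: "\<And>i'. i' \<in> I \<Longrightarrow> [x i' = y i'] (mod int p ^ j)"
      have P: "P i' (x i') = P i' (y i')" if "i' \<in> I" for i'
      proof -
        have "int p ^ Suc e dvd int p ^ j" using j by (intro le_imp_power_dvd) simp
        then have "[x i' = y i'] (mod int p ^ Suc e)" using xy[OF that] cong_dvd_modulus by blast
        then have "[2 * a i' * x i' = 2 * a i' * y i'] (mod int p ^ Suc e)" by (rule cong_scalar_left)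
        then show ?thesis unfolding P_def using cong_dvd_iff by blast
      qed
      have "C x = C y" unfolding C_def using P i by (auto simp: I_def)
      moreover have "[Q x = Q y] (mod int p ^ j)"
        unfolding Q_def by (intro cong_sum cong_mult cong_refl cong_pow xy)
      then have "[a i * v\<^sup>2 = k - Q x] (mod int p ^ j) \<longleftrightarrow> [a i * v\<^sup>2 = k - Q y] (mod int p ^ j)" for v
        by (metis cong_diff cong_refl cong_sym cong_trans)
      ultimately show "f j x = f j y" unfolding f_def by simp
    qed (use I p0 in auto)
    finally show ?thesis unfolding S using I by simp
  qed
  then show ?thesis using split[of j] split[of "Suc j"] by (simp add: sum_distrib_left)
qed

section \<open>Stabilisation of the density ratios\<close>

lemma density_ratio_lift:
  assumes "prime p" "\<not> int p ^ Suc e dvd 2 * k" "j \<ge> 2 * e + 1"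
  shows "density_ratio m a k p j = density_ratio m a k p (2 * e + 1)"
  using assms(3)
proof (induction j rule: dec_induct)
  case (step j)
  have "density_ratio m a k p (Suc j) = density_ratio m a k p j"
    unfolding density_ratio_def using card_solutions_mod_lift[OF assms(1,2) step(1), of m a] assms(1)
    by (simp add: power_add prime_gt_0_nat)
  then show ?case using step by simp
qed simp

lemma density_ratio_tendsto:
  assumes "prime p" "\<not> int p ^ Suc e dvd 2 * k"
  shows "density_ratio m a k p \<longlonglongrightarrow> density_ratio m a k p (2 * e + 1)"
  by (rule tendsto_eventually, rule eventually_sequentiallyI[of "2 * e + 1"])
     (rule density_ratio_lift[OF assms])

lemma convergent_density_ratio:
  assumes "prime p" "k \<noteq> 0"
  shows "convergent (density_ratio m a k p)"
proof -
  \<comment> \<open>It suffices that \<open>p^(e+1)\<close> exceeds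
    \<open>\<bar>2 * k\<bar>\<close>; since \<open>n < 2^n\<close>, this choice of \<open>e\<close>
    works for every prime at once.\<close>
  define e where "e = nat \<bar>2 * k\<bar>"
  have p: "int p > 1" using prime_gt_1_nat[OF assms(1)] by simp
  have "\<bar>2 * k\<bar> < 2 ^ e" unfolding e_def
    by (metis abs_ge_zero nat_0_le of_nat_less_two_power)
  also have "\<dots> \<le> int p ^ e" using p by (intro power_mono) auto
  also have "\<dots> \<le> int p ^ Suc e" using p by (intro power_increasing) auto
  finally have "\<not> int p ^ Suc e dvd 2 * k"
    using assms(2) zdvd_imp_le[of "int p ^ Suc e" "\<bar>2 * k\<bar>"] by auto
  from density_ratio_tendsto[OF assms(1) this] show ?thesis by (rule convergentI)
qed

text \<open>The case \<open>e = 0\<close> of lifting: the ratio is constant from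
  \<open>j = 1\<close> on.\<close>

lemma local_density_at_eq:
  assumes "prime p" "\<not> int p dvd 2 * k"
  shows "local_density_at m a k p = real (card (solutions_mod m a k p)) / real p ^ (m - 1)"
proof -
  have "density_ratio m a k p \<longlonglongrightarrow> density_ratio m a k p (2 * 0 + 1)"
    by (rule density_ratio_tendsto[OF assms(1)]) (use assms(2) in simp)
  then show ?thesis unfolding local_density_at_def by (simp add: limI density_ratio_def)
qed

lemma local_density_at_nonneg:
  assumes "prime p" "k \<noteq> 0"
  shows "local_density_at m a k p \<ge> 0"
proof -
  have "density_ratio m a k p \<longlonglongrightarrow> local_density_at m a k p"
    using convergent_density_ratio[OF assms] unfolding local_density_at_def
    by (simp add: convergent_LIMSEQ_iff)
  then show ?thesis by (rule LIMSEQ_le_const) (auto simp: density_ratio_def)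
qed

section \<open>Legendre symbols and counting modulo a prime\<close>

lemma Legendre_cong: "[a = b] (mod p) \<Longrightarrow> Legendre a p = Legendre b p"
  unfolding Legendre_def QuadRes_def cong_def by simp

lemma Legendre_values: "Legendre a p \<in> {-1, 0, 1}"
  unfolding Legendre_def by auto

lemma Legendre_eq_0_iff: "Legendre a p = 0 \<longleftrightarrow> p dvd a"
  unfolding Legendre_def by (auto simp: cong_0_iff)

lemma Legendre_1: "prime p \<Longrightarrow> Legendre 1 (int p) = 1"
  unfolding Legendre_def QuadRes_def
  using not_prime_unit[of "int p"] by (auto simp: cong_0_iff intro!: exI[of _ 1])

text \<open>Euler's criterion gives the identity modulo \<open>p\<close>; both sides lie in {-1, 0,
  1}, so they differ by at most 2, which is less than \<open>p\<close>.\<close>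

lemma Legendre_mult:
  assumes p: "prime p" "p > 2"
  shows "Legendre (a * b) (int p) = Legendre a p * Legendre b p"
proof -
  have "[Legendre (a * b) p = (a * b) ^ ((p - 1) div 2)] (mod p)" by (rule euler_criterion[OF p])
  also have "(a * b) ^ ((p - 1) div 2) = a ^ ((p - 1) div 2) * b ^ ((p - 1) div 2)"
    by (rule power_mult_distrib)
  also have "[\<dots> = Legendre a p * Legendre b p] (mod p)"
    by (intro cong_mult; rule cong_sym; rule euler_criterion[OF p])
  finally have "int p dvd Legendre (a * b) p - Legendre a p * Legendre b p"
    by (simp add: cong_iff_dvd_diff)
  moreover have "\<bar>Legendre (a * b) p - Legendre a p * Legendre b p\<bar> < int p"
    using Legendre_values[of "a * b" p] Legendre_values[of a p] Legendre_values[of b p] p(2) by auto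
  ultimately show ?thesis by (metis dvd_imp_le_int eq_iff_diff_eq_0 not_le abs_of_nat)
qed

lemma Legendre_square:
  assumes "prime p" "p > 2" "\<not> int p dvd a"
  shows "Legendre (a\<^sup>2) (int p) = 1"
proof -
  have "Legendre a p \<in> {-1, 1}" using Legendre_values[of a p] assms(3) Legendre_eq_0_iff[of a p] by auto
  then show ?thesis unfolding power2_eq_square Legendre_mult[OF assms(1,2)] by auto
qed

lemma int_card_filter_eq_sum:
  "finite A \<Longrightarrow> int (card {x\<in>A. P x}) = (\<Sum>x\<in>A. if P x then 1 else 0)"
  by (simp add: sum.If_cases Int_def)

lemma card_residues_translate:
  fixes n \<alpha> \<beta> :: int
  assumes "n > 0" "coprime \<alpha> n" and P: "\<And>x y. [x = y] (mod n) \<Longrightarrow> P x \<longleftrightarrow> P y"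
  shows "card {x\<in>{0..<n}. P (\<alpha> * x + \<beta>)} = card {x\<in>{0..<n}. P x}"
  unfolding card_filter_eq_sum[OF finite_atLeastLessThan_int]
  by (rule sum_residues_translate[OF assms(1,2)]) (simp add: P)

text \<open>Multiplying by \<open>a\<close> turns the congruence into \<open>(a x)^2 = a t\<close>,
  and \<open>a x\<close> runs through all residues, so only the square roots of \<open>a t\<close>
  remain to be counted.\<close>

lemma card_square_cong:
  assumes p: "prime p" "p > 2" and a: "\<not> int p dvd a"
  shows "int (card {x\<in>{0..<int p}. [a * x\<^sup>2 = t] (mod int p)}) = 1 + Legendre (a * t) (int p)"
proof -
  have p0: "int p > 0" using p by simp
  have pi: "prime (int p)" using p by simp
  have cop: "coprime a (int p)" using a pi by (metis coprime_commute prime_imp_coprime)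
  define s where "s = a * t"
  have "[a * x\<^sup>2 = t] (mod int p) \<longleftrightarrow> [(a * x + 0)\<^sup>2 = s] (mod int p)" for x
  proof -
    have "[a * x\<^sup>2 = t] (mod int p) \<longleftrightarrow> [a * (a * x\<^sup>2) = a * t] (mod int p)"
      using cop by (simp add: cong_mult_lcancel)
    then show ?thesis by (simp add: s_def power2_eq_square mult_ac)
  qed
  then have "card {x\<in>{0..<int p}. [a * x\<^sup>2 = t] (mod int p)} = card {x\<in>{0..<int p}. [(a * x + 0)\<^sup>2 = s] (mod int p)}"
    by simp
  also have "\<dots> = card {x\<in>{0..<int p}. [x\<^sup>2 = s] (mod int p)}"
    by (rule card_residues_translate[OF p0 cop, where \<beta> = 0 and P = "\<lambda>x. [x\<^sup>2 = s] (mod int p)"])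
       (metis cong_def cong_pow)
  also have "int \<dots> = 1 + Legendre s p"
  proof (cases "int p dvd s")
    case True
    then have "[x\<^sup>2 = s] (mod int p) \<longleftrightarrow> int p dvd x" for x
      using pi by (metis cong_dvd_iff cong_0_iff cong_sym cong_trans prime_dvd_power_iff zero_less_numeral)
    then have "{x\<in>{0..<int p}. [x\<^sup>2 = s] (mod int p)} = {0}"
      using p0 by (auto dest: zdvd_imp_le)
    then show ?thesis using True Legendre_eq_0_iff[of s p] by simp
  next
    case False
    show ?thesis
    proof (cases "QuadRes (int p) s")
      case True
      then obtain y where y: "[y\<^sup>2 = s] (mod int p)" unfolding QuadRes_def by blast
      have ny: "\<not> int p dvd y" using y False
        by (metis cong_dvd_iff dvd_mult power2_eq_square)
      have iff: "[x\<^sup>2 = s] (mod int p) \<longleftrightarrow> [x = y] (mod int p) \<or> [x = - y] (mod int p)" for x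
      proof -
        have "[x\<^sup>2 = s] (mod int p) \<longleftrightarrow> [x\<^sup>2 = y\<^sup>2] (mod int p)" using y by (simp add: cong_def)
        also have "\<dots> \<longleftrightarrow> int p dvd (x - y) * (x + y)"
          by (simp add: cong_iff_dvd_diff power2_eq_square algebra_simps)
        also have "\<dots> \<longleftrightarrow> int p dvd x - y \<or> int p dvd x + y" using pi by (rule prime_dvd_mult_iff)
        finally show ?thesis by (simp add: cong_iff_dvd_diff)
      qed
      have "{x\<in>{0..<int p}. [x\<^sup>2 = s] (mod int p)} = {y mod int p, (- y) mod int p}"
        unfolding iff using p0 by (auto simp: cong_def)
      moreover have "y mod int p \<noteq> (- y) mod int p"
      proof
        assume "y mod int p = (- y) mod int p"
        then have "int p dvd 2 * y" by (simp add: mod_eq_dvd_iff)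
        then have "int p dvd 2" using ny pi by (simp add: prime_dvd_mult_iff)
        then show False using p(2) by (auto dest: zdvd_imp_le)
      qed
      moreover have "Legendre s p = 1" unfolding Legendre_def using True False by (simp add: cong_0_iff)
      ultimately show ?thesis by simp
    next
      case nq: False
      then have "card {x\<in>{0..<int p}. [x\<^sup>2 = s] (mod int p)} = 0" unfolding QuadRes_def by simp
      moreover have "Legendre s p = -1" unfolding Legendre_def using nq False by (simp add: cong_0_iff)
      ultimately show ?thesis by simp
    qed
  qed
  finally show ?thesis by (simp add: s_def)
qed

section \<open>Character sums of quadratic polynomials modulo p\<close>

lemma coprime_prime_int_iff: "prime p \<Longrightarrow> coprime a (int p) \<longleftrightarrow> \<not> int p dvd a"
  by (metis coprime_absorb_right coprime_commute not_prime_unit prime_imp_coprime prime_nat_int_transfer)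

lemma card_linear_cong:
  assumes p: "prime p" and a: "\<not> int p dvd a"
  shows "card {x\<in>{0..<int p}. [a * x + b = c] (mod int p)} = 1"
proof -
  have p0: "int p > 0" using p by (simp add: prime_gt_0_nat)
  have "card {x\<in>{0..<int p}. [a * x + b = c] (mod int p)} = card {x\<in>{0..<int p}. [x = c] (mod int p)}"
    by (rule card_residues_translate[OF p0, where P = "\<lambda>x. [x = c] (mod int p)"])
       (use a p in \<open>auto simp: coprime_prime_int_iff cong_def\<close>)
  also have "{x\<in>{0..<int p}. [x = c] (mod int p)} = {c mod int p}"
    using p0 by (auto simp: cong_def)
  finally show ?thesis by simp
qed

text \<open>\<open>u\<^sup>2 \<equiv> w\<^sup>2 - c\<close> becomes, for fixed \<open>r = w - u\<close>, a linear equation in \<open>u\<close>.\<close>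

lemma sum_Legendre_square_diff:
  assumes p: "prime p" "p > 2"
  shows "(\<Sum>w\<in>{0..<int p}. Legendre (w\<^sup>2 - c) (int p)) = (if int p dvd c then int p else 0) - 1"
proof (cases "int p dvd c")
  case True
  have p0: "int p > 0" using p by simp
  have "Legendre (w\<^sup>2 - c) (int p) = (if w = 0 then 0 else 1)" if "w \<in> {0..<int p}" for w
  proof -
    have "Legendre (w\<^sup>2 - c) (int p) = Legendre (w\<^sup>2) (int p)"
      by (rule Legendre_cong) (use True in \<open>simp add: cong_iff_dvd_diff\<close>)
    moreover have "\<not> int p dvd w" if "w \<noteq> 0" using \<open>w \<in> _\<close> that by (auto dest: zdvd_imp_le)
    ultimately show ?thesis using Legendre_square[OF p] Legendre_eq_0_iff[of 0 p] by auto
  qed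
  then have "(\<Sum>w\<in>{0..<int p}. Legendre (w\<^sup>2 - c) (int p)) = (\<Sum>w\<in>{0..<int p}. if w = 0 then 0 else 1)"
    by (intro sum.cong) auto
  also have "\<dots> = (\<Sum>w\<in>{0..<int p} - {0}. 1)"
    by (rule sum.mono_neutral_cong_right) auto
  also have "\<dots> = int p - 1" using p0 by simp
  finally show ?thesis using True by simp
next
  case False
  let ?R = "{0..<int p}"
  have p0: "int p > 0" using p by simp
  have pi: "prime (int p)" using p by simp
  have n1: "\<not> int p dvd 1" using pi by (metis not_prime_unit)
  \<comment> \<open>The summand is the number of \<open>u\<close> with \<open>u^2 = w^2 - c\<close>,
    so the sum counts points on a hyperbola. In the linear equation obtained below,
    \<open>r = 0\<close> would force \<open>p\<close> to divide \<open>c\<close>, and every other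
    \<open>r\<close> contributes exactly one point.\<close>
  have "(\<Sum>w\<in>?R. 1 + Legendre (w\<^sup>2 - c) (int p)) = (\<Sum>w\<in>?R. int (card {u\<in>?R. [1 * u\<^sup>2 = w\<^sup>2 - c] (mod int p)}))"
    unfolding card_square_cong[OF p n1] by simp
  also have "\<dots> = (\<Sum>w\<in>?R. \<Sum>u\<in>?R. if [u\<^sup>2 = w\<^sup>2 - c] (mod int p) then 1 else 0)"
    unfolding int_card_filter_eq_sum[OF finite_atLeastLessThan_int] by simp
  also have "\<dots> = (\<Sum>u\<in>?R. \<Sum>w\<in>?R. if [u\<^sup>2 = w\<^sup>2 - c] (mod int p) then 1 else 0)"
    by (rule sum.swap)
  also have "\<dots> = (\<Sum>u\<in>?R. \<Sum>r\<in>?R. if [u\<^sup>2 = (1 * r + u)\<^sup>2 - c] (mod int p) then 1 else 0)"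
  proof (rule sum.cong[OF refl], rule sum_residues_translate[symmetric])
    fix u x y :: int assume xy: "[x = y] (mod int p)"
    have "[x\<^sup>2 - c = y\<^sup>2 - c] (mod int p)" by (intro cong_diff cong_pow xy cong_refl)
    then have "[u\<^sup>2 = x\<^sup>2 - c] (mod int p) \<longleftrightarrow> [u\<^sup>2 = y\<^sup>2 - c] (mod int p)"
      by (simp add: cong_def)
    then show "(if [u\<^sup>2 = x\<^sup>2 - c] (mod int p) then 1 else 0) = (if [u\<^sup>2 = y\<^sup>2 - c] (mod int p) then 1 else (0::int))"
      by simp
  qed (use p0 in auto)
  also have "\<dots> = (\<Sum>r\<in>?R. \<Sum>u\<in>?R. if [2 * r * u + r\<^sup>2 = c] (mod int p) then 1 else 0)"
  proof (subst sum.swap, intro sum.cong refl if_cong)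
    fix r u :: int
    have "u\<^sup>2 - ((1 * r + u)\<^sup>2 - c) = - (2 * r * u + r\<^sup>2 - c)"
      by (simp add: power2_eq_square algebra_simps)
    then show "[u\<^sup>2 = (1 * r + u)\<^sup>2 - c] (mod int p) = [2 * r * u + r\<^sup>2 = c] (mod int p)"
      unfolding cong_iff_dvd_diff by (metis dvd_minus_iff)
  qed
  also have "\<dots> = (\<Sum>r\<in>?R. if r = 0 then 0 else 1)"
  proof (rule sum.cong[OF refl])
    fix r assume r: "r \<in> ?R"
    have eq: "(\<Sum>u\<in>?R. if [2 * r * u + r\<^sup>2 = c] (mod int p) then 1 else 0) = int (card {u\<in>?R. [2 * r * u + r\<^sup>2 = c] (mod int p)})"
      unfolding int_card_filter_eq_sum[OF finite_atLeastLessThan_int] ..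
    show "(\<Sum>u\<in>?R. if [2 * r * u + r\<^sup>2 = c] (mod int p) then 1 else 0) = (if r = 0 then 0 else 1 :: int)"
    proof (cases "r = 0")
      case True
      then have "card {u\<in>?R. [2 * r * u + r\<^sup>2 = c] (mod int p)} = 0" using False
        by (auto simp: cong_iff_dvd_diff)
      then show ?thesis unfolding eq using True by simp
    next
      case r0: False
      have "\<not> int p dvd r" using r r0 by (auto dest: zdvd_imp_le)
      moreover have "\<not> int p dvd 2" using p(2) by (auto dest: zdvd_imp_le)
      ultimately have "\<not> int p dvd 2 * r" using pi by (simp add: prime_dvd_mult_iff)
      then show ?thesis unfolding eq using r0 card_linear_cong[OF p(1)] by simp
    qed
  qed
  also have "\<dots> = (\<Sum>r\<in>?R - {0}. 1)"
    by (rule sum.mono_neutral_cong_right) auto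
  also have "\<dots> = int p - 1" using p0 by simp
  finally show ?thesis using False by (simp add: sum.distrib)
qed

text \<open>Reduces to the previous sum through
  \<open>(-a)^2 * (t - a v^2) = (-a) * ((a v)^2 - a t)\<close>, as \<open>a v\<close> runs through
  all residues.\<close>

lemma sum_Legendre_minus_square:
  assumes p: "prime p" "p > 2" and a: "\<not> int p dvd a"
  shows "(\<Sum>v\<in>{0..<int p}. Legendre (t - a * v\<^sup>2) (int p))
       = Legendre (- a) (int p) * ((if int p dvd t then int p else 0) - 1)"
proof -
  have p0: "int p > 0" using p by simp
  have pi: "prime (int p)" using p by simp
  have "Legendre (t - a * v\<^sup>2) (int p) = Legendre (- a) p * Legendre ((a * v + 0)\<^sup>2 - a * t) p" for v
  proof -
    have "Legendre (- a) p * Legendre ((a * v + 0)\<^sup>2 - a * t) p = Legendre ((- a)\<^sup>2 * (t - a * v\<^sup>2)) p"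
      unfolding Legendre_mult[OF p, symmetric] by (simp add: power2_eq_square algebra_simps)
    also have "\<dots> = Legendre (t - a * v\<^sup>2) p"
      unfolding Legendre_mult[OF p] using Legendre_square[OF p, of "- a"] a by simp
    finally show ?thesis by simp
  qed
  then have "(\<Sum>v\<in>{0..<int p}. Legendre (t - a * v\<^sup>2) (int p))
      = Legendre (- a) p * (\<Sum>v\<in>{0..<int p}. Legendre ((a * v + 0)\<^sup>2 - a * t) p)"
    by (simp add: sum_distrib_left)
  also have "(\<Sum>v\<in>{0..<int p}. Legendre ((a * v + 0)\<^sup>2 - a * t) p) = (\<Sum>v\<in>{0..<int p}. Legendre (v\<^sup>2 - a * t) p)"
  proof (rule sum_residues_translate[OF p0, where f = "\<lambda>v. Legendre (v\<^sup>2 - a * t) (int p)"])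
    show "coprime a (int p)" using a p by (simp add: coprime_prime_int_iff)
    show "Legendre (x\<^sup>2 - a * t) (int p) = Legendre (y\<^sup>2 - a * t) (int p)" if "[x = y] (mod int p)" for x y
      by (intro Legendre_cong cong_diff cong_pow that cong_refl)
  qed
  also have "\<dots> = (if int p dvd t then int p else 0) - 1"
    unfolding sum_Legendre_square_diff[OF p] using a pi by (simp add: prime_dvd_mult_iff)
  finally show ?thesis .
qed

section \<open>Solutions modulo an odd prime\<close>

lemma card_solutions_mod_Suc:
  assumes "n > 0"
  shows "card (solutions_mod (Suc m) a t n) = (\<Sum>v\<in>{0..<int n}. card (solutions_mod m a (t - a m * v\<^sup>2) n))"
proof -
  have c: "card (solutions_mod l a s n) = (\<Sum>x\<in>{..<l} \<rightarrow>\<^sub>E {0..<int n}. if [diag_form l a x = s] (mod int n) then 1 else 0)" for l s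
    unfolding solutions_mod_def by (rule card_filter_eq_sum) (simp add: finite_PiE)
  have form: "diag_form (Suc m) a (y(m := v)) = diag_form m a y + a m * v\<^sup>2" for y v
    unfolding diag_form_def by simp
  have iff: "[u + w = t] (mod int n) \<longleftrightarrow> [u = t - w] (mod int n)" for u w
    by (simp add: cong_iff_dvd_diff diff_diff_eq2)
  have "card (solutions_mod (Suc m) a t n) = (\<Sum>y\<in>{..<m} \<rightarrow>\<^sub>E {0..<int n}. \<Sum>v\<in>{0..<int n}.
      if [diag_form (Suc m) a (y(m := v)) = t] (mod int n) then 1 else 0)"
    unfolding c lessThan_Suc by (rule sum_PiE_insert) simp
  then show ?thesis unfolding c form iff by (simp add: sum.swap[of _ "{0..<int n}"])
qed

text \<open>One induction carries both parities because adding a variable swaps them. From even to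
  odd, the sum over the new variable counts the \<open>v\<close> with \<open>p\<close> dividing
  \<open>t - a v^2\<close>, which \<open>card_square_cong\<close> evaluates; from odd to even, it is
  a sum of Legendre symbols, which \<open>sum_Legendre_minus_square\<close> evaluates. The even
  count is multiplied by \<open>p\<close> so that the formula already makes sense for
  \<open>m = 0\<close>.\<close>

lemma card_solutions_mod_prime:
  assumes p: "prime p" "p > 2" and a: "\<And>i. i < m \<Longrightarrow> \<not> int p dvd a i"
  shows "(even m \<longrightarrow> int p * card (solutions_mod m a t p) =
            int p ^ m + Legendre ((-1) ^ (m div 2) * (\<Prod>i<m. a i)) p * int p ^ (m div 2) *
              ((if int p dvd t then int p else 0) - 1)) \<and>
         (odd m \<longrightarrow> int (card (solutions_mod m a t p)) =
            int p ^ (m - 1) + Legendre ((-1) ^ ((m - 1) div 2) * t * (\<Prod>i<m. a i)) p * int p ^ ((m - 1) div 2))"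
  using a
proof (induction m arbitrary: t)
  case 0
  have "solutions_mod 0 a t p = (if int p dvd t then {\<lambda>_. undefined} else {})"
    by (auto simp: solutions_mod_def diag_form_def cong_0_iff cong_sym_eq[of 0])
  then show ?case using Legendre_1[OF p(1)] by simp
next
  case (Suc m)
  have p0: "int p > 0" "p > 0" using p by simp_all
  have am: "\<not> int p dvd a m" using Suc.prems by simp
  let ?R = "{0..<int p}"
  let ?e = "(-1) ^ (m div 2) * (\<Prod>i<m. a i)"
  have rec: "int (card (solutions_mod (Suc m) a t p)) = (\<Sum>v\<in>?R. int (card (solutions_mod m a (t - a m * v\<^sup>2) p)))"
    unfolding card_solutions_mod_Suc[OF p0(2)] by simp
  show ?case
  proof (cases "even m")
    case True
    have "int p * card (solutions_mod (Suc m) a t p) = (\<Sum>v\<in>?R. int p ^ m + Legendre ?e p * int p ^ (m div 2) *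
              ((if int p dvd t - a m * v\<^sup>2 then int p else 0) - 1))"
      unfolding rec sum_distrib_left using Suc True by (intro sum.cong) auto
    also have "\<dots> = (\<Sum>v\<in>?R. int p ^ m + Legendre ?e p * int p ^ (m div 2) *
              (int p * (if int p dvd t - a m * v\<^sup>2 then 1 else 0) - 1))"
      by (intro sum.cong refl) simp
    also have "\<dots> = int p * int p ^ m + Legendre ?e p * int p ^ (m div 2) *
        (int p * (\<Sum>v\<in>?R. if int p dvd t - a m * v\<^sup>2 then 1 else 0) - int p)"
      unfolding sum.distrib sum_distrib_left[symmetric] sum_subtractf by simp
    also have "(\<Sum>v\<in>?R. if int p dvd t - a m * v\<^sup>2 then 1 else 0) = int (card {v\<in>?R. [a m * v\<^sup>2 = t] (mod int p)})"
      unfolding int_card_filter_eq_sum[OF finite_atLeastLessThan_int] cong_iff_dvd_diff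
      by (simp add: dvd_diff_commute)
    also have "\<dots> = 1 + Legendre (a m * t) p" by (rule card_square_cong[OF p am])
    finally have "int p * card (solutions_mod (Suc m) a t p)
        = int p * (int p ^ m + Legendre ?e p * Legendre (a m * t) p * int p ^ (m div 2))"
      by (simp add: algebra_simps)
    then have "int (card (solutions_mod (Suc m) a t p)) = int p ^ m + Legendre ?e p * Legendre (a m * t) p * int p ^ (m div 2)"
      using p0 by simp
    moreover have "Legendre ?e p * Legendre (a m * t) p = Legendre ((-1) ^ (m div 2) * t * (\<Prod>i<Suc m. a i)) p"
      unfolding Legendre_mult[OF p, symmetric] by (simp add: mult_ac)
    ultimately show ?thesis using True by simp
  next
    case False
    then have m: "m \<ge> 1" "Suc m div 2 = Suc ((m - 1) div 2)" "m div 2 = (m - 1) div 2" by presburger+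
    have "int (card (solutions_mod (Suc m) a t p)) =
       (\<Sum>v\<in>?R. int p ^ (m - 1) + Legendre ?e p * int p ^ ((m - 1) div 2) * Legendre (t - a m * v\<^sup>2) p)"
      unfolding rec
    proof (rule sum.cong[OF refl])
      fix v
      have "Legendre ((-1) ^ ((m - 1) div 2) * (t - a m * v\<^sup>2) * (\<Prod>i<m. a i)) p = Legendre ?e p * Legendre (t - a m * v\<^sup>2) p"
        unfolding Legendre_mult[OF p, symmetric] m(3) by (simp add: mult_ac)
      then show "int (card (solutions_mod m a (t - a m * v\<^sup>2) p)) =
          int p ^ (m - 1) + Legendre ?e p * int p ^ ((m - 1) div 2) * Legendre (t - a m * v\<^sup>2) p"
        using Suc False by (simp add: mult_ac)
    qed
    also have "\<dots> = int p ^ m + Legendre ?e p * int p ^ ((m - 1) div 2) *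
        (\<Sum>v\<in>?R. Legendre (t - a m * v\<^sup>2) p)"
      using m(1) p0 by (simp add: sum.distrib sum_distrib_left flip: power_Suc)
    also have "\<dots> = int p ^ m + Legendre ?e p * Legendre (- a m) p * int p ^ ((m - 1) div 2) *
        ((if int p dvd t then int p else 0) - 1)"
      unfolding sum_Legendre_minus_square[OF p am] by (simp add: mult_ac)
    also have "Legendre ?e p * Legendre (- a m) p = Legendre ((-1) ^ (Suc m div 2) * (\<Prod>i<Suc m. a i)) p"
      unfolding Legendre_mult[OF p, symmetric] m by (simp add: mult_ac)
    finally have card: "int (card (solutions_mod (Suc m) a t p)) = int p ^ m +
        Legendre ((-1) ^ (Suc m div 2) * (\<Prod>i<Suc m. a i)) p * int p ^ ((m - 1) div 2) *
        ((if int p dvd t then int p else 0) - 1)" .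
    have "int p * int (card (solutions_mod (Suc m) a t p)) = int p ^ Suc m +
        Legendre ((-1) ^ (Suc m div 2) * (\<Prod>i<Suc m. a i)) p * int p ^ (Suc m div 2) *
        ((if int p dvd t then int p else 0) - 1)"
      unfolding card m(2) power_Suc[of "int p"] by (simp only: distrib_left mult_ac)
    then show ?thesis using False by simp
  qed
qed


lemma local_density_at_odd_prime:
  assumes p: "prime p" "p > 2" and m: "m \<ge> 1" and a: "\<And>i. i < m \<Longrightarrow> \<not> int p dvd a i" and k: "\<not> int p dvd k"
  shows "even m \<Longrightarrow> local_density_at m a k p =
            1 - Legendre ((-1) ^ (m div 2) * (\<Prod>i<m. a i)) p / real p ^ (m div 2)"
    and "odd m \<Longrightarrow> local_density_at m a k p =
            1 + Legendre ((-1) ^ ((m - 1) div 2) * (k * (\<Prod>i<m. a i))) p / real p ^ ((m - 1) div 2)"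
proof -
  have p0: "real p > 0" using p by simp
  have "\<not> int p dvd 2" using p(2) by (auto dest: zdvd_imp_le)
  then have "\<not> int p dvd 2 * k" using k p(1) by (simp add: prime_dvd_mult_iff)
  from local_density_at_eq[OF p(1) this]
  have eq: "local_density_at m a k p = real (card (solutions_mod m a k p)) / real p ^ (m - 1)" .
  have count: "(even m \<longrightarrow> int p * card (solutions_mod m a k p) =
            int p ^ m - Legendre ((-1) ^ (m div 2) * (\<Prod>i<m. a i)) p * int p ^ (m div 2)) \<and>
         (odd m \<longrightarrow> int (card (solutions_mod m a k p)) =
            int p ^ (m - 1) + Legendre ((-1) ^ ((m - 1) div 2) * k * (\<Prod>i<m. a i)) p * int p ^ ((m - 1) div 2))"
    using card_solutions_mod_prime[OF p a, where t = k] k by simp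
  {
    assume "even m"
    then obtain r where r: "m = 2 * Suc r" using m by (metis evenE not0_implies_Suc mult_0_right not_one_le_zero)
    define l where "l = real_of_int (Legendre ((-1) ^ (m div 2) * (\<Prod>i<m. a i)) p)"
    have "real_of_int (int p * card (solutions_mod m a k p)) = real_of_int (int p ^ m - Legendre ((-1) ^ (m div 2) * (\<Prod>i<m. a i)) p * int p ^ (m div 2))"
      using count \<open>even m\<close> by (intro arg_cong[of _ _ real_of_int]) blast
    then have "real p * card (solutions_mod m a k p) = real p ^ m - l * real p ^ (m div 2)"
      by (simp add: l_def)
    also have "\<dots> = real p * (real p ^ (m - 1) * (1 - l / real p ^ (m div 2)))"
      using p0 by (simp add: r field_simps power_add mult_2 mult_2_right)
    finally have "card (solutions_mod m a k p) = real p ^ (m - 1) * (1 - l / real p ^ (m div 2))"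
      using p0 by simp
    then show "local_density_at m a k p = 1 - Legendre ((-1) ^ (m div 2) * (\<Prod>i<m. a i)) p / real p ^ (m div 2)"
      unfolding eq l_def using p0 by simp
  }
  {
    assume "odd m"
    then obtain r where r: "m = 2 * r + 1" by (metis oddE)
    define l where "l = real_of_int (Legendre ((-1) ^ ((m - 1) div 2) * k * (\<Prod>i<m. a i)) p)"
    have "real_of_int (card (solutions_mod m a k p)) = real_of_int (int p ^ (m - 1) + Legendre ((-1) ^ ((m - 1) div 2) * k * (\<Prod>i<m. a i)) p * int p ^ ((m - 1) div 2))"
      using count \<open>odd m\<close> by (intro arg_cong[of _ _ real_of_int]) blast
    then have "card (solutions_mod m a k p) = real p ^ (m - 1) + l * real p ^ ((m - 1) div 2)"
      by (simp add: l_def)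
    also have "\<dots> = real p ^ (m - 1) * (1 + l / real p ^ ((m - 1) div 2))"
      using p0 by (simp add: r field_simps power_add mult_2 mult_2_right)
    finally show "local_density_at m a k p = 1 + Legendre ((-1) ^ ((m - 1) div 2) * (k * (\<Prod>i<m. a i))) p / real p ^ ((m - 1) div 2)"
      unfolding eq l_def using p0 by (simp add: mult.assoc)
  }
qed

section \<open>The Kronecker symbol as a character\<close>

text \<open>Gauss's lemma with multiplier 2. For \<open>0 < x \<le> h = (p - 1) / 2\<close> the
  numbers \<open>2 x\<close> are already reduced modulo \<open>p\<close>, and those exceeding
  \<open>h\<close> come from \<open>x > h / 2\<close>; the parity of their number
  \<open>h - h div 2\<close> is determined by \<open>p\<close> modulo 8.\<close>

lemma Legendre_two:
  assumes p: "prime p" "p > 2"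
  shows "Legendre 2 (int p) = (if int p mod 8 \<in> {1, 7} then 1 else -1)"
proof -
  have n2: "[2 \<noteq> 0] (mod int p)" using p(2) by (auto simp: cong_0_iff dest: zdvd_imp_le)
  interpret GAUSS p 2 using p n2 by unfold_locales auto
  define h where "h = (int p - 1) div 2"
  have ph: "int p = 2 * h + 1" "h \<ge> 0" using p_eq2 p by (auto simp: h_def)
  have "(\<lambda>x. x * 2 mod int p) ` {0<..h} = (\<lambda>x. x * 2) ` {0<..h}"
    using ph by (intro image_cong) auto
  then have C: "C = (\<lambda>x. x * 2) ` {0<..h}" by (simp add: C_def B_def A_def h_def image_image)
  have "E = (\<lambda>x. x * 2) ` {h div 2<..h}" unfolding E_def C h_def[symmetric] using ph(2) by auto
  then have "card E = nat (h - h div 2)" by (simp add: card_image inj_on_def)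
  then have *: "Legendre 2 (int p) = (-1) ^ nat (h - h div 2)" using gauss_lemma by simp
  have "even (nat (h - h div 2)) \<longleftrightarrow> even (h - h div 2)" using ph(2) by (simp add: even_nat_iff)
  also have "\<dots> \<longleftrightarrow> int p mod 8 \<in> {1, 7}" unfolding ph(1) by simp presburger
  finally show ?thesis unfolding * by (auto simp: neg_one_odd_power)
qed

lemma Legendre_minus_one:
  assumes p: "prime p" "p > 2"
  shows "Legendre (-1) (int p) = (-1) ^ ((p - 1) div 2)"
proof -
  have "[Legendre (-1) p = (-1) ^ ((p - 1) div 2)] (mod int p)" by (rule euler_criterion[OF p])
  then have dvd: "int p dvd Legendre (-1) p - (-1) ^ ((p - 1) div 2)" by (simp add: cong_iff_dvd_diff)
  have "\<bar>Legendre (-1) p - (-1) ^ ((p - 1) div 2)\<bar> < int p"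
    using Legendre_values[of "-1" p] p(2) by (cases "even ((p - 1) div 2)") auto
  then show ?thesis using dvd by (metis dvd_imp_le_int eq_iff_diff_eq_0 not_le abs_of_nat)
qed

text \<open>The nonprincipal Dirichlet character modulo 4, belonging to the discriminant -4.\<close>

definition chi4 :: "int \<Rightarrow> int" where
  "chi4 x = (if even x then 0 else if x mod 4 = 1 then 1 else -1)"

text \<open>The even primitive character modulo 8, belonging to the discriminant 8; its product with
  \<open>chi4\<close> belongs to -8. The same function gives the Kronecker symbol
  \<open>(D/2)\<close>, read in \<open>D\<close>.\<close>

definition chi8 :: "int \<Rightarrow> int" where
  "chi8 x = (if even x then 0 else if x mod 8 \<in> {1, 7} then 1 else -1)"

lemma chi4_mult: "chi4 (x * y) = chi4 x * chi4 y"
proof (cases "even x \<or> even y")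
  case False
  then have "x mod 4 = 1 \<or> x mod 4 = 3" "y mod 4 = 1 \<or> y mod 4 = 3" by presburger+
  moreover have "(x * y) mod 4 = ((x mod 4) * (y mod 4)) mod 4" by (simp add: mod_mult_eq)
  ultimately show ?thesis using False unfolding chi4_def by auto
qed (auto simp: chi4_def)

lemma chi8_mult: "chi8 (x * y) = chi8 x * chi8 y"
proof (cases "even x \<or> even y")
  case False
  then have "x mod 8 \<in> {1, 3, 5, 7}" "y mod 8 \<in> {1, 3, 5, 7}" by simp_all presburger+
  moreover have "\<forall>r\<in>{1, 3, 5, 7}. \<forall>s\<in>{1, 3, 5, 7}. (r * s) mod 8 \<in> {1, 7} \<longleftrightarrow> (r \<in> {1, 7} \<longleftrightarrow> s \<in> {1, 7 :: int})"
    by simp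
  ultimately have "(x mod 8 * (y mod 8)) mod 8 \<in> {1, 7} \<longleftrightarrow> (x mod 8 \<in> {1, 7} \<longleftrightarrow> y mod 8 \<in> {1, 7})"
    by blast
  then have "(x * y) mod 8 \<in> {1, 7} \<longleftrightarrow> (x mod 8 \<in> {1, 7} \<longleftrightarrow> y mod 8 \<in> {1, 7})"
    by (simp only: mod_mult_eq)
  then show ?thesis using False unfolding chi8_def by simp
qed (auto simp: chi8_def)

lemma kronecker_prime_2: "kronecker_prime D 2 = chi8 D"
  by (simp add: kronecker_prime_def chi8_def)

lemma kronecker_prime_mult:
  assumes "prime p"
  shows "kronecker_prime (D * D') p = kronecker_prime D p * kronecker_prime D' p"
proof (cases "p = 2")
  case True then show ?thesis by (simp only: kronecker_prime_2 chi8_mult)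
next
  case False
  then have "p > 2" using prime_ge_2_nat[OF assms] by simp
  then show ?thesis using False by (simp add: kronecker_prime_def Legendre_mult[OF assms])
qed

lemma kronecker_prime_values: "kronecker_prime D p \<in> {-1, 0, 1}"
  using Legendre_values[of D p] by (auto simp: kronecker_prime_def)

lemma kronecker_1: "kronecker D (Suc 0) = 1"
  by (simp add: kronecker_def)

lemma kronecker_prime: "prime p \<Longrightarrow> kronecker D p = kronecker_prime D p"
  by (simp add: kronecker_def prime_factorization_prime)

lemma kronecker_mult: "m > 0 \<Longrightarrow> n > 0 \<Longrightarrow> kronecker D (m * n) = kronecker D m * kronecker D n"
  by (simp add: kronecker_def prime_factorization_mult)

lemma kronecker_values: "kronecker D n \<in> {-1, 0, 1}"
proof (cases "n = 0")
  case False
  then have "n > 0" by simp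
  then show ?thesis
  proof (induction n rule: prime_divisors_induct)
    case (factor p x)
    then have "x > 0" "p > 0" by (auto intro: Nat.gr0I)
    then show ?case using factor kronecker_prime_values[of D p] by (auto simp: kronecker_mult kronecker_prime)
  qed (auto simp: kronecker_1)
qed (simp add: kronecker_def)

section \<open>Kronecker symbols as periodic functions of the lower argument\<close>

definition periodic_mult :: "int \<Rightarrow> (int \<Rightarrow> int) \<Rightarrow> bool" where
  "periodic_mult M \<psi> \<longleftrightarrow> M > 0 \<and> \<psi> 1 = 1 \<and> (\<forall>x y. \<psi> (x * y) = \<psi> x * \<psi> y) \<and>
     (\<forall>x y. [x = y] (mod M) \<longrightarrow> \<psi> x = \<psi> y)"

definition takes_minus_one :: "int \<Rightarrow> (int \<Rightarrow> int) \<Rightarrow> bool" where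
  "takes_minus_one M \<psi> \<longleftrightarrow> (\<exists>n. coprime n M \<and> \<psi> n = -1)"

text \<open>Agreement at primes suffices, since both sides are completely multiplicative on positive
  integers.\<close>

definition extends_kronecker :: "int \<Rightarrow> (int \<Rightarrow> int) \<Rightarrow> bool" where
  "extends_kronecker D \<psi> \<longleftrightarrow> (\<forall>p. prime p \<longrightarrow> kronecker_prime D p = \<psi> (int p))"

lemma periodic_mult_mult:
  assumes "periodic_mult M \<psi>" "periodic_mult M' \<psi>'"
  shows "periodic_mult (M * M') (\<lambda>x. \<psi> x * \<psi>' x)"
proof -
  have "\<psi> x * \<psi>' x = \<psi> y * \<psi>' y" if "[x = y] (mod M * M')" for x y
  proof -
    have "[x = y] (mod M)" "[x = y] (mod M')"
      using cong_dvd_modulus[OF that] by simp_all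
    then have "\<psi> x = \<psi> y" "\<psi>' x = \<psi>' y" using assms unfolding periodic_mult_def by blast+
    then show ?thesis by simp
  qed
  then show ?thesis using assms unfolding periodic_mult_def by (simp add: mult_ac)
qed

text \<open>By the Chinese remainder theorem a witness for the first factor can be chosen congruent
  to 1 modulo \<open>M'\<close>, where the second factor takes the value 1.\<close>

lemma takes_minus_one_mult:
  assumes "periodic_mult M \<psi>" "periodic_mult M' \<psi>'" "coprime M M'" "takes_minus_one M \<psi>"
  shows "takes_minus_one (M * M') (\<lambda>x. \<psi> x * \<psi>' x)"
proof -
  obtain n where n: "coprime n M" "\<psi> n = -1" using assms(4) by (auto simp: takes_minus_one_def)
  obtain x where x: "[x = n] (mod M)" "[x = 1] (mod M')"
    using binary_chinese_remainder_int[OF assms(3)] by blast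
  have "coprime x M" using cong_imp_coprime[OF cong_sym[OF x(1)] n(1)] .
  moreover have "coprime x M'" by (rule cong_imp_coprime[OF cong_sym[OF x(2)]]) simp
  moreover have "\<psi> x = \<psi> n" "\<psi>' x = \<psi>' 1" "\<psi>' 1 = 1"
    using x assms(1,2) unfolding periodic_mult_def by blast+
  ultimately show ?thesis unfolding takes_minus_one_def using n(2) by (intro exI[of _ x]) simp
qed

lemma extends_kronecker_mult:
  assumes "extends_kronecker D \<psi>" "extends_kronecker D' \<psi>'"
  shows "extends_kronecker (D * D') (\<lambda>x. \<psi> x * \<psi>' x)"
  using assms unfolding extends_kronecker_def by (simp add: kronecker_prime_mult)

lemma chi4_cong: "[x = y] (mod 4) \<Longrightarrow> chi4 x = chi4 y"
proof -
  assume "[x = y] (mod 4)"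
  then have "x mod 4 = y mod 4" by (simp add: cong_def)
  moreover from this have "even x = even y" by presburger
  ultimately show "chi4 x = chi4 y" by (simp add: chi4_def)
qed

lemma chi8_cong: "[x = y] (mod 8) \<Longrightarrow> chi8 x = chi8 y"
proof -
  assume "[x = y] (mod 8)"
  then have "x mod 8 = y mod 8" by (simp add: cong_def)
  moreover from this have "even x = even y" by presburger
  ultimately show "chi8 x = chi8 y" by (simp add: chi8_def)
qed

lemma periodic_mult_chi4: "periodic_mult 4 chi4"
  unfolding periodic_mult_def by (auto simp: chi4_mult chi4_cong) (simp add: chi4_def)

lemma periodic_mult_chi8: "periodic_mult 8 chi8"
  unfolding periodic_mult_def by (auto simp: chi8_mult chi8_cong) (simp add: chi8_def)

lemma periodic_mult_chi8_chi4: "periodic_mult 8 (\<lambda>x. chi8 x * chi4 x)"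
proof -
  have "chi8 x * chi4 x = chi8 y * chi4 y" if "[x = y] (mod 8)" for x y
    using chi8_cong[OF that] chi4_cong[of x y] cong_dvd_modulus[OF that, of 4] by simp
  then show ?thesis unfolding periodic_mult_def
    by (auto simp: chi8_mult chi4_mult mult_ac) (simp add: chi8_def chi4_def)
qed

lemma extends_kronecker_chi4: "extends_kronecker (-4) chi4"
  unfolding extends_kronecker_def
proof (intro allI impI)
  fix p :: nat assume p: "prime p"
  show "kronecker_prime (-4) p = chi4 (int p)"
  proof (cases "p = 2")
    case False
    then have p2: "p > 2" using prime_ge_2_nat[OF p] by simp
    have "\<not> int p dvd 2" using p2 by (auto dest: zdvd_imp_le)
    then have "Legendre (-4) p = Legendre (-1) p"
      using Legendre_mult[OF p p2, of "-1" "2\<^sup>2"] Legendre_square[OF p p2, of 2] by simp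
    also have "\<dots> = (-1) ^ ((p - 1) div 2)" by (rule Legendre_minus_one[OF p p2])
    also have "\<dots> = chi4 (int p)"
    proof -
      have "odd p" using p p2 prime_odd_nat by blast
      then have "even ((p - 1) div 2) \<longleftrightarrow> int p mod 4 = 1" by presburger
      then show ?thesis using \<open>odd p\<close> by (simp add: chi4_def)
    qed
    finally show ?thesis using False by (simp add: kronecker_prime_def)
  qed (simp add: kronecker_prime_def chi4_def)
qed

lemma extends_kronecker_chi8: "extends_kronecker 8 chi8"
  unfolding extends_kronecker_def
proof (intro allI impI)
  fix p :: nat assume p: "prime p"
  show "kronecker_prime 8 p = chi8 (int p)"
  proof (cases "p = 2")
    case False
    then have p2: "p > 2" using prime_ge_2_nat[OF p] by simp
    have "\<not> int p dvd 2" using p2 by (auto dest: zdvd_imp_le)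
    then have "Legendre 8 p = Legendre 2 p"
      using Legendre_mult[OF p p2, of 2 "2\<^sup>2"] Legendre_square[OF p p2, of 2] by simp
    moreover have "odd p" using p p2 prime_odd_nat by blast
    ultimately show ?thesis using False by (simp add: kronecker_prime_def Legendre_two[OF p p2] chi8_def)
  qed (simp add: kronecker_prime_def chi8_def)
qed

text \<open>The product of the discriminants 8 and -4 is -8 times the square 4, which does not
  change the symbol at odd primes.\<close>

lemma extends_kronecker_chi8_chi4: "extends_kronecker (-8) (\<lambda>x. chi8 x * chi4 x)"
  unfolding extends_kronecker_def
proof (intro allI impI)
  fix p :: nat assume p: "prime p"
  show "kronecker_prime (-8) p = chi8 (int p) * chi4 (int p)"
  proof (cases "p = 2")
    case False
    then have p2: "p > 2" using prime_ge_2_nat[OF p] by simp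
    have "\<not> int p dvd 2" using p2 by (auto dest: zdvd_imp_le)
    then have "Legendre (8 * (-4)) p = Legendre (-8) p"
      using Legendre_mult[OF p p2, of "-8" "2\<^sup>2"] Legendre_square[OF p p2, of 2] by simp
    then have "kronecker_prime (-8) p = kronecker_prime (8 * (-4)) p"
      using False by (simp add: kronecker_prime_def)
    also have "\<dots> = chi8 (int p) * chi4 (int p)"
      using extends_kronecker_mult[OF extends_kronecker_chi8 extends_kronecker_chi4] p
      unfolding extends_kronecker_def by blast
    finally show ?thesis .
  qed (simp add: kronecker_prime_def chi8_def)
qed

lemma takes_minus_one_chi:
  "takes_minus_one 4 chi4" "takes_minus_one 8 chi8" "takes_minus_one 8 (\<lambda>x. chi8 x * chi4 x)"
proof -
  have c: "coprime x 4" "coprime x 8" if "odd x" for x :: int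
    using that coprime_power_right_iff[of x 2 2] coprime_power_right_iff[of x 2 3] by simp_all
  show "takes_minus_one 4 chi4" "takes_minus_one 8 chi8"
    \<comment> \<open>At 3 the two signs cancel; at 5 only \<open>chi8\<close> is negative.\<close>
    unfolding takes_minus_one_def by (intro exI[of _ 3], simp add: c chi4_def chi8_def)+
  show "takes_minus_one 8 (\<lambda>x. chi8 x * chi4 x)"
    unfolding takes_minus_one_def by (intro exI[of _ 5]) (simp add: c chi4_def chi8_def)
qed

text \<open>For odd \<open>q\<close> this is the prime discriminant \<open>q*\<close>, with the sign
  that makes it 1 modulo 4. With it quadratic reciprocity reads \<open>(q*/p) = (p/q)\<close>,
  without a sign.\<close>

definition prime_star :: "nat \<Rightarrow> int" where
  "prime_star q = (if q mod 4 = 1 then int q else - int q)"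

lemma prime_star_mod4: "odd q \<Longrightarrow> prime_star q mod 4 = 1"
  unfolding prime_star_def by simp presburger

lemma periodic_mult_Legendre:
  assumes "prime q" "q > 2"
  shows "periodic_mult (int q) (\<lambda>x. Legendre x (int q))"
  using assms unfolding periodic_mult_def
  by (auto simp: Legendre_1 Legendre_mult intro: Legendre_cong)

text \<open>A nonresidue occurs among the numbers \<open>w^2 - 1\<close>, because their Legendre
  symbols add up to -1.\<close>

lemma takes_minus_one_Legendre:
  assumes q: "prime q" "q > 2"
  shows "takes_minus_one (int q) (\<lambda>x. Legendre x (int q))"
proof -
  have "\<not> int q dvd 1" using q by simp
  then have "(\<Sum>w\<in>{0..<int q}. Legendre (w\<^sup>2 - 1) (int q)) < 0"
    using sum_Legendre_square_diff[OF q, of 1] by simp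
  then obtain w where "Legendre (w\<^sup>2 - 1) (int q) < 0" by (metis sum_nonneg not_less)
  then have "Legendre (w\<^sup>2 - 1) (int q) = -1" using Legendre_values[of "w\<^sup>2 - 1" "int q"] by auto
  moreover from this have "coprime (w\<^sup>2 - 1) (int q)"
    using Legendre_eq_0_iff[of "w\<^sup>2 - 1" "int q"] by (simp add: coprime_prime_int_iff[OF q(1)])
  ultimately show ?thesis unfolding takes_minus_one_def by blast
qed

text \<open>Quadratic reciprocity with the sign absorbed into \<open>prime_star q\<close>. At
  \<open>p = 2\<close> it is the second supplementary law, where the sign is harmless because {1, 7}
  is closed under negation modulo 8; at \<open>p = q\<close> both symbols vanish.\<close>

lemma extends_kronecker_Legendre:
  assumes q: "prime q" "q > 2"
  shows "extends_kronecker (prime_star q) (\<lambda>x. Legendre x (int q))"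
  unfolding extends_kronecker_def
proof (intro allI impI)
  fix p :: nat assume p: "prime p"
  have oq: "odd q" using q prime_odd_nat by blast
  consider "p = 2" | "p = q" | "p > 2" "p \<noteq> q" using prime_ge_2_nat[OF p] by linarith
  then show "kronecker_prime (prime_star q) p = Legendre (int p) (int q)"
  proof cases
    case 1
    have "(- int q) mod 8 \<in> {1, 7} \<longleftrightarrow> int q mod 8 \<in> {1, 7}" by simp presburger
    then have "chi8 (prime_star q) = chi8 (int q)" unfolding chi8_def prime_star_def by simp
    then show ?thesis using 1 oq by (simp add: kronecker_prime_2 Legendre_two[OF q] chi8_def)
  next
    case 2
    then have "Legendre (prime_star q) (int p) = 0" "Legendre (int p) (int q) = 0"
      using Legendre_eq_0_iff by (auto simp: prime_star_def)
    then show ?thesis using 2 q by (simp add: kronecker_prime_def)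
  next
    case 3
    have op: "odd p" using p 3 prime_odd_nat by blast
    have qr: "Legendre p q * Legendre q p = (-1) ^ ((p - 1) div 2 * ((q - 1) div 2))"
      using Quadratic_Reciprocity[OF p 3(1) q] 3(2) .
    have vals: "Legendre p q \<in> {-1, 0, 1}" "Legendre q p \<in> {-1, 0, 1}" by (rule Legendre_values)+
    have "Legendre (prime_star q) p = Legendre p q"
    proof (cases "q mod 4 = 1")
      case True
      then have "even ((q - 1) div 2)" by presburger
      then show ?thesis using qr vals True by (auto simp: prime_star_def)
    next
      case False
      then have "odd ((q - 1) div 2)" using oq by presburger
      then have "Legendre p q * Legendre q p = (-1) ^ ((p - 1) div 2)"
        using qr by (simp add: power_mult uminus_power_if)
      moreover have "Legendre (prime_star q) p = (-1) ^ ((p - 1) div 2) * Legendre q p"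
        using False Legendre_mult[OF p 3(1), of "-1" "int q"] Legendre_minus_one[OF p 3(1)]
        by (simp add: prime_star_def)
      ultimately show ?thesis using vals by (cases "even ((p - 1) div 2)") auto
    qed
    then show ?thesis using 3 by (simp add: kronecker_prime_def)
  qed
qed

text \<open>Peels off one prime: in \<open>v = prime_star q * w\<close> the cofactor
  \<open>w\<close> is again squarefree and 1 modulo 4. Squarefreeness makes \<open>q\<close> coprime
  to \<open>w\<close>, so the value -1 can be taken from the Legendre factor alone, whatever the
  character of \<open>w\<close> is.\<close>

lemma kronecker_character_1_mod_4:
  fixes v :: int
  assumes "squarefree v" "v mod 4 = 1"
  shows "\<exists>\<psi>. periodic_mult \<bar>v\<bar> \<psi> \<and> extends_kronecker v \<psi> \<and> (v \<noteq> 1 \<longrightarrow> takes_minus_one \<bar>v\<bar> \<psi>)"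
  using assms
proof (induction "nat \<bar>v\<bar>" arbitrary: v rule: less_induct)
  case less
  show ?case
  proof (cases "v = 1")
    case True
    have "kronecker_prime 1 p = 1" if "prime p" for p
      using that Legendre_1[of p] by (simp add: kronecker_prime_def)
    then show ?thesis unfolding True
      by (intro exI[of _ "\<lambda>_. 1"]) (auto simp: periodic_mult_def extends_kronecker_def)
  next
    case False
    have "v \<noteq> -1" "v \<noteq> 0" using less.prems(2) by auto
    then have "nat \<bar>v\<bar> \<noteq> 1" using False by auto
    then obtain q where q: "prime q" "q dvd nat \<bar>v\<bar>" using prime_factor_nat by blast
    have qv: "int q dvd v" using q(2) by (simp add: int_dvd_int_iff[symmetric])
    have "odd v" using less.prems(2) by presburger
    then have "q \<noteq> 2" using qv by auto
    then have q2: "q > 2" using prime_ge_2_nat[OF q(1)] by simp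
    then have oq: "odd q" using q prime_odd_nat by blast
    define w where "w = v div prime_star q"
    have vw: "v = prime_star q * w"
      unfolding w_def using qv by (auto simp: prime_star_def)
    have "(prime_star q * w) mod 4 = ((prime_star q mod 4) * w) mod 4" by (simp add: mod_mult_left_eq)
    then have w4: "w mod 4 = 1" using less.prems(2) vw prime_star_mod4[OF oq] by simp
    have wsf: "squarefree w" using less.prems(1) vw by (metis squarefree_mono dvd_triv_right)
    have abs: "\<bar>v\<bar> = int q * \<bar>w\<bar>" unfolding vw abs_mult by (simp add: prime_star_def)
    have "w \<noteq> 0" using \<open>v \<noteq> 0\<close> vw by auto
    then have "nat \<bar>w\<bar> < nat \<bar>v\<bar>" unfolding abs using q2 by auto
    from less.hyps[OF this wsf w4] obtain \<psi> where
      \<psi>: "periodic_mult \<bar>w\<bar> \<psi>" "extends_kronecker w \<psi>" by blast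
    have "\<not> int q dvd w"
    proof
      assume "int q dvd w"
      then have "int q * int q dvd prime_star q * w" by (intro mult_dvd_mono) (auto simp: prime_star_def)
      then have "(int q)\<^sup>2 dvd v" using vw by (simp add: power2_eq_square)
      then have "is_unit (int q)" using less.prems(1) by (auto simp: squarefree_def)
      then show False using q2 by simp
    qed
    then have "coprime w (int q)" using q(1) by (simp add: coprime_prime_int_iff)
    then have cop: "coprime (int q) \<bar>w\<bar>" by (simp add: coprime_commute)
    let ?\<psi> = "\<lambda>x. Legendre x (int q) * \<psi> x"
    have "periodic_mult \<bar>v\<bar> ?\<psi>" unfolding abs
      by (rule periodic_mult_mult[OF periodic_mult_Legendre[OF q(1) q2] \<psi>(1)])
    moreover have "extends_kronecker v ?\<psi>" unfolding vw
      by (rule extends_kronecker_mult[OF extends_kronecker_Legendre[OF q(1) q2] \<psi>(2)])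
    moreover have "takes_minus_one \<bar>v\<bar> ?\<psi>" unfolding abs
      by (rule takes_minus_one_mult[OF periodic_mult_Legendre[OF q(1) q2] \<psi>(1) cop takes_minus_one_Legendre[OF q(1) q2]])
    ultimately show ?thesis by blast
  qed
qed

text \<open>The discriminant factors as 1, -4, 8 or -8 times a squarefree number that is 1 modulo 4.
  In the last three cases the value -1 comes from the 2-part, so the odd part may be 1.\<close>

lemma kronecker_character:
  fixes u :: int
  assumes "squarefree u" "u \<noteq> 1"
  shows "\<exists>M \<psi>. periodic_mult M \<psi> \<and> extends_kronecker (quad_disc u) \<psi> \<and> takes_minus_one M \<psi>"
proof -
  have twist: "\<exists>M \<psi>. periodic_mult M \<psi> \<and> extends_kronecker (d * v) \<psi> \<and> takes_minus_one M \<psi>"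
    if \<phi>: "periodic_mult (2 ^ i) \<phi>" "extends_kronecker d \<phi>" "takes_minus_one (2 ^ i) \<phi>"
      and v: "squarefree v" "v mod 4 = 1" for i \<phi> d v
  proof -
    obtain \<psi> where \<psi>: "periodic_mult \<bar>v\<bar> \<psi>" "extends_kronecker v \<psi>"
      using kronecker_character_1_mod_4[OF v] by blast
    have "odd v" using v(2) by presburger
    then have "coprime (2 ^ i) \<bar>v\<bar>" by simp
    then show ?thesis
      using periodic_mult_mult[OF \<phi>(1) \<psi>(1)] extends_kronecker_mult[OF \<phi>(2) \<psi>(2)]
        takes_minus_one_mult[OF \<phi>(1) \<psi>(1) _ \<phi>(3)] by blast
  qed
  have "u mod 4 \<noteq> 0"
  proof
    assume "u mod 4 = 0"
    then have "2\<^sup>2 dvd u" by auto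
    then have "is_unit (2::int)" using assms(1) unfolding squarefree_def by blast
    then show False by simp
  qed
  then consider "u mod 4 = 1" | "u mod 4 = 3" | v where "u = 2 * v" "v mod 4 = 1" | v where "u = 2 * v" "v mod 4 = 3"
    by (atomize_elim, presburger)
  then show ?thesis
  proof cases
    case 1
    then have "quad_disc u = u" by (simp add: quad_disc_def cong_def)
    then show ?thesis using kronecker_character_1_mod_4[OF assms(1) 1] assms(2) by auto
  next
    case 2
    have "quad_disc u = (-4) * (- u)" using 2 by (simp add: quad_disc_def cong_def)
    moreover have "squarefree (- u)" "(- u) mod 4 = 1" using assms(1) 2 by (simp, presburger)
    ultimately show ?thesis
      using twist[of 2 chi4 "-4" "- u"] periodic_mult_chi4 extends_kronecker_chi4 takes_minus_one_chi(1) by simp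
  next
    case (3 v)
    have "u mod 4 \<noteq> 1" using 3 by presburger
    then have "quad_disc u = 8 * v" using 3 by (simp add: quad_disc_def cong_def)
    moreover have "squarefree v" using assms(1) 3 by (metis squarefree_mono dvd_triv_right)
    ultimately show ?thesis
      using twist[of 3 chi8 8 v] 3 periodic_mult_chi8 extends_kronecker_chi8 takes_minus_one_chi(2) by simp
  next
    case (4 v)
    have "u mod 4 \<noteq> 1" using 4 by presburger
    then have "quad_disc u = (-8) * (- v)" using 4 by (simp add: quad_disc_def cong_def)
    moreover have "squarefree (- v)" using assms(1) 4 by (metis squarefree_mono dvd_triv_right squarefree_minus)
    moreover have "(- v) mod 4 = 1" using 4 by presburger
    ultimately show ?thesis
      using twist[of 3 "\<lambda>x. chi8 x * chi4 x" "-8" "- v"] periodic_mult_chi8_chi4 extends_kronecker_chi8_chi4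
        takes_minus_one_chi(3) by simp
  qed
qed

text \<open>Multiplication by a unit \<open>n\<close> with \<open>\<psi> n = -1\<close> permutes a
  full period and negates its sum, which is therefore 0. Hence the partial sum up to
  \<open>N\<close> depends only on \<open>N mod M\<close>.\<close>

lemma bounded_sum_periodic_mult:
  assumes "periodic_mult M \<psi>" "takes_minus_one M \<psi>"
  shows "\<exists>C. \<forall>N. \<bar>\<Sum>n<N. \<psi> (int n)\<bar> \<le> C"
proof -
  obtain n where n: "coprime n M" "\<psi> n = -1" using assms(2) by (auto simp: takes_minus_one_def)
  have M: "M > 0" and per: "\<And>x y. [x = y] (mod M) \<Longrightarrow> \<psi> x = \<psi> y"
    and mult: "\<And>x y. \<psi> (x * y) = \<psi> x * \<psi> y" using assms(1) by (auto simp: periodic_mult_def)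
  have "(\<Sum>x\<in>{0..<M}. \<psi> (n * x + 0)) = (\<Sum>x\<in>{0..<M}. \<psi> x)"
    by (rule sum_residues_translate[OF M n(1) per])
  then have "- (\<Sum>x\<in>{0..<M}. \<psi> x) = (\<Sum>x\<in>{0..<M}. \<psi> x)"
    by (simp add: mult n(2) sum_negf)
  then have zero: "(\<Sum>x\<in>{0..<M}. \<psi> x) = 0" by simp
  define m where "m = nat M"
  have m: "M = int m" "m > 0" using M by (auto simp: m_def)
  define S where "S N = (\<Sum>n<N. \<psi> (int n))" for N
  have "(\<Sum>x\<in>{0..<M}. \<psi> x) = S m" unfolding S_def m(1)
    by (rule sum.reindex_bij_witness[of _ int nat]) auto
  then have Sm: "S m = 0" using zero by simp
  have step: "S (N + m) = S N" for N
  proof (induction N)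
    case (Suc N)
    have "\<psi> (int (N + m)) = \<psi> (int N)" by (rule per) (simp add: m(1) cong_def)
    then show ?case using Suc by (simp add: S_def)
  qed (simp add: Sm, simp add: S_def)
  have "S (r + m * q) = S r" for r q
  proof (induction q)
    case (Suc q) then show ?case using step[of "r + m * q"] by (simp add: algebra_simps)
  qed simp
  then have red: "S N = S (N mod m)" for N by (metis mod_mult_div_eq)
  have "\<bar>S N\<bar> \<le> (\<Sum>n<m. \<bar>\<psi> (int n)\<bar>)" for N
  proof -
    have "\<bar>S (N mod m)\<bar> \<le> (\<Sum>n<N mod m. \<bar>\<psi> (int n)\<bar>)" unfolding S_def by (rule sum_abs)
    also have "\<dots> \<le> (\<Sum>n<m. \<bar>\<psi> (int n)\<bar>)" using m(2) by (intro sum_mono2) (auto intro: less_trans)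
    finally show ?thesis using red[of N] by simp
  qed
  then show ?thesis unfolding S_def by blast
qed

lemma bounded_sum_kronecker:
  fixes u :: int
  assumes "squarefree u" "u \<noteq> 1"
  shows "\<exists>C. \<forall>N. \<bar>\<Sum>n=1..N. kronecker (quad_disc u) n\<bar> \<le> C"
proof -
  obtain M \<psi> where \<psi>: "periodic_mult M \<psi>" "extends_kronecker (quad_disc u) \<psi>" "takes_minus_one M \<psi>"
    using kronecker_character[OF assms] by blast
  have mult: "\<And>x y. \<psi> (x * y) = \<psi> x * \<psi> y" and one: "\<psi> 1 = 1" using \<psi>(1) by (auto simp: periodic_mult_def)
  have eq: "kronecker (quad_disc u) n = \<psi> (int n)" if "n > 0" for n
    using that
  proof (induction n rule: prime_divisors_induct)
    case (factor p x)
    then have "x > 0" "p > 0" by (auto intro: Nat.gr0I)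
    then show ?case using factor \<psi>(2) by (auto simp: kronecker_mult kronecker_prime mult extends_kronecker_def)
  qed (auto simp: kronecker_1 one)
  obtain C where C: "\<And>N. \<bar>\<Sum>n<N. \<psi> (int n)\<bar> \<le> C" using bounded_sum_periodic_mult[OF \<psi>(1,3)] by blast
  \<comment> \<open>The extra term pays for the index 0, which the sum of \<open>\<psi>\<close>
    includes and this one does not.\<close>
  have "\<bar>\<Sum>n=1..N. kronecker (quad_disc u) n\<bar> \<le> C + \<bar>\<psi> 0\<bar>" for N
  proof -
    have "(\<Sum>n=1..N. kronecker (quad_disc u) n) = (\<Sum>n=1..N. \<psi> (int n))"
      by (intro sum.cong) (auto simp: eq)
    also have "{..<Suc N} = insert 0 {1..N}" by auto
    then have "(\<Sum>n=1..N. \<psi> (int n)) = (\<Sum>n<Suc N. \<psi> (int n)) - \<psi> 0"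
      by (simp del: sum.lessThan_Suc)
    finally show ?thesis using C[of "Suc N"] by linarith
  qed
  then show ?thesis by blast
qed

section \<open>Dirichlet series and Euler products\<close>

text \<open>Abel summation: the differences of the decreasing weights are nonnegative and telescope,
  so that only the first weight survives in the bound.\<close>

lemma abs_sum_mult_antimono_le:
  fixes c w :: "nat \<Rightarrow> real"
  assumes "m \<le> n" "\<And>k. k \<in> {m..<n} \<Longrightarrow> w (Suc k) \<le> w k" "0 \<le> w n"
    and B: "\<And>j. j \<in> {m..n} \<Longrightarrow> \<bar>\<Sum>k=m..j. c k\<bar> \<le> B"
  shows "\<bar>\<Sum>k=m..n. c k * w k\<bar> \<le> B * w m"
proof -
  define S where "S j = (\<Sum>k=m..j. c k)" for j
  have B0: "B \<ge> 0" using B[of m] assms(1) by force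
  have parts: "(\<Sum>k=m..n. c k * w k) = S n * w n + (\<Sum>k=m..<n. S k * (w k - w (Suc k)))"
    using assms(1)
  proof (induction n rule: dec_induct)
    case (step n)
    then have "S (Suc n) = S n + c (Suc n)" by (simp add: S_def)
    then show ?case using step by (simp add: algebra_simps)
  qed (simp add: S_def)
  have "\<bar>\<Sum>k=m..n. c k * w k\<bar> \<le> \<bar>S n * w n\<bar> + (\<Sum>k=m..<n. \<bar>S k * (w k - w (Suc k))\<bar>)"
    unfolding parts by (rule order_trans[OF abs_triangle_ineq]) (intro add_left_mono sum_abs)
  also have "\<dots> \<le> B * w n + (\<Sum>k=m..<n. B * (w k - w (Suc k)))"
    unfolding abs_mult using assms B B0 by (intro add_mono sum_mono mult_mono) (auto simp: S_def)
  also have "(\<Sum>k=m..<n. B * (w k - w (Suc k))) = B * (w m - w n)"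
    using sum_Suc_diff'[OF assms(1), of "\<lambda>k. - w k"] by (simp flip: sum_distrib_left)
  finally show ?thesis by (simp add: algebra_simps)
qed

text \<open>Dirichlet's test with an explicit tail. The tail is what gives the error terms in
  Mertens' argument and the uniform bound on the Lambert series.\<close>

lemma
  fixes c w :: "nat \<Rightarrow> real"
  assumes dec: "\<And>k. k \<ge> K \<Longrightarrow> w (Suc k) \<le> w k" and lim: "w \<longlonglongrightarrow> 0"
    and B: "\<And>m n. m \<ge> K \<Longrightarrow> \<bar>\<Sum>k=m..n. c k\<bar> \<le> B"
  shows summable_mult_antimono: "summable (\<lambda>n. c n * w n)"
    and abs_suminf_mult_antimono_le: "m \<ge> K \<Longrightarrow> \<bar>(\<Sum>n. c n * w n) - (\<Sum>n<m. c n * w n)\<bar> \<le> B * w m"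
proof -
  have nonneg: "w n \<ge> 0" if "n \<ge> K" for n
  proof (rule LIMSEQ_le_const2[OF lim])
    show "\<exists>N. \<forall>k\<ge>N. w k \<le> w n"
    proof (intro exI[of _ n] allI impI)
      fix k assume "k \<ge> n"
      then show "w k \<le> w n"
      proof (induction k rule: dec_induct)
        case (step k) then show ?case using dec[of k] that by linarith
      qed simp
    qed
  qed
  have B0: "B \<ge> 0" using B[of K K] abs_ge_zero order_trans by blast
  have bound: "\<bar>\<Sum>k=m..<n. c k * w k\<bar> \<le> B * w m" if "m \<ge> K" for m n
  proof (cases "m < n")
    case True
    then obtain n' where n': "n = Suc n'" "m \<le> n'" by (cases n) auto
    have "\<bar>\<Sum>k=m..n'. c k * w k\<bar> \<le> B * w m"
      by (rule abs_sum_mult_antimono_le[OF n'(2)]) (use dec B nonneg that n' in auto)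
    then show ?thesis using n' by (simp add: atLeastLessThanSuc_atLeastAtMost)
  qed (use nonneg that B0 in auto)
  show summable: "summable (\<lambda>n. c n * w n)"
    unfolding summable_Cauchy
  proof (intro allI impI)
    fix e :: real assume "e > 0"
    have "(\<lambda>n. B * w n) \<longlonglongrightarrow> B * 0" by (intro tendsto_mult_left lim)
    then have "eventually (\<lambda>n. B * w n < e) sequentially" using \<open>e > 0\<close> by (simp add: order_tendsto_iff)
    then obtain N where N: "\<And>n. n \<ge> N \<Longrightarrow> B * w n < e" unfolding eventually_sequentially by blast
    show "\<exists>N. \<forall>m\<ge>N. \<forall>n. norm (\<Sum>k=m..<n. c k * w k) < e"
    proof (intro exI[of _ "max N K"] allI impI)
      fix m n assume "m \<ge> max N K"
      then show "norm (\<Sum>k=m..<n. c k * w k) < e"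
        using bound[of m n] N[of m] by simp
    qed
  qed
  show "\<bar>(\<Sum>n. c n * w n) - (\<Sum>n<m. c n * w n)\<bar> \<le> B * w m" if m: "m \<ge> K"
  proof (rule LIMSEQ_le_const2)
    show "(\<lambda>n. \<bar>(\<Sum>k<n. c k * w k) - (\<Sum>n<m. c n * w n)\<bar>) \<longlonglongrightarrow> \<bar>(\<Sum>n. c n * w n) - (\<Sum>n<m. c n * w n)\<bar>"
      by (intro tendsto_rabs tendsto_diff tendsto_const summable_LIMSEQ summable)
    have "(\<Sum>k<n. c k * w k) - (\<Sum>k<m. c k * w k) = (\<Sum>k=m..<n. c k * w k)" if "n \<ge> m" for n
      using sum_diff_nat_ivl[of 0 m n "\<lambda>k. c k * w k"] that by (simp add: atLeast0LessThan)
    then show "\<exists>N. \<forall>n\<ge>N. \<bar>(\<Sum>k<n. c k * w k) - (\<Sum>n<m. c n * w n)\<bar> \<le> B * w m"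
      using bound[OF m] by (intro exI[of _ m]) auto
  qed
qed

text \<open>The integers surviving the sieve by the primes up to \<open>N\<close>: always 1, and
  otherwise only numbers above \<open>N\<close>, so the contribution other than that of 1 is
  dominated by a tail of the series.\<close>

definition sieved :: "nat \<Rightarrow> nat set" where
  "sieved N = {n. n \<ge> 1 \<and> (\<forall>p. prime p \<longrightarrow> p dvd n \<longrightarrow> p > N)}"

lemma sieved_0: "sieved 0 = {1..}"
  by (auto simp: sieved_def prime_gt_0_nat)

lemma sieved_Suc_not_prime: "\<not> prime (Suc N) \<Longrightarrow> sieved (Suc N) = sieved N"
  unfolding sieved_def by (auto intro: Suc_lessI)

lemma sieved_Suc_prime:
  assumes "prime (Suc N)"
  shows "sieved N = sieved (Suc N) \<union> (\<lambda>n. Suc N * n) ` sieved N"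
    and "sieved (Suc N) \<inter> (\<lambda>n. Suc N * n) ` sieved N = {}"
proof -
  show "sieved N = sieved (Suc N) \<union> (\<lambda>n. Suc N * n) ` sieved N"
  proof (intro equalityI subsetI)
    fix n assume n: "n \<in> sieved N"
    show "n \<in> sieved (Suc N) \<union> (\<lambda>n. Suc N * n) ` sieved N"
    proof (cases "Suc N dvd n")
      case True
      then obtain k where k: "n = Suc N * k" by blast
      have "k \<noteq> 0" using n k by (intro notI) (simp add: sieved_def)
      moreover have "p > N" if "prime p" "p dvd k" for p
        using n that dvd_mult[OF that(2), of "Suc N"] by (simp add: sieved_def k del: mult_Suc)
      ultimately have "k \<in> sieved N" by (simp add: sieved_def)
      then show ?thesis unfolding k by (intro UnI2 imageI)
    next
      case False
      have "p > Suc N" if "prime p" "p dvd n" for p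
      proof -
        have "p > N" using n that by (simp add: sieved_def)
        moreover have "p \<noteq> Suc N" using False that(2) by blast
        ultimately show ?thesis by simp
      qed
      then have "n \<in> sieved (Suc N)" using n by (simp add: sieved_def)
      then show ?thesis by blast
    qed
  next
    fix n assume "n \<in> sieved (Suc N) \<union> (\<lambda>n. Suc N * n) ` sieved N"
    then show "n \<in> sieved N"
    proof
      assume "n \<in> (\<lambda>n. Suc N * n) ` sieved N"
      then obtain k where k: "n = Suc N * k" "k \<in> sieved N" by blast
      have "p > N" if p: "prime p" "p dvd Suc N * k" for p
      proof -
        have "p dvd Suc N \<or> p dvd k" using p prime_dvd_mult_iff by blast
        then show ?thesis
        proof
          assume "p dvd Suc N"
          then have "p = Suc N" by (rule primes_dvd_imp_eq[OF p(1) assms])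
          then show ?thesis by simp
        qed (use k(2) p(1) in \<open>simp add: sieved_def\<close>)
      qed
      moreover have "Suc N * k \<ge> 1" using k(2) by (simp add: sieved_def)
      ultimately show ?thesis unfolding k(1) sieved_def by blast
    next
      assume n: "n \<in> sieved (Suc N)"
      then show ?thesis unfolding sieved_def mem_Collect_eq using Suc_lessD by blast
    qed
  qed
  show "sieved (Suc N) \<inter> (\<lambda>n. Suc N * n) ` sieved N = {}"
  proof -
    have "Suc N * k \<notin> sieved (Suc N)" for k
      using assms dvd_triv_left[of "Suc N" k] unfolding sieved_def by blast
    then show ?thesis by blast
  qed
qed

lemma primes_le_Suc: "{p. prime p \<and> p \<le> Suc N} = (if prime (Suc N) then insert (Suc N) {p. prime p \<and> p \<le> N} else {p. prime p \<and> p \<le> N})"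
  by (auto simp: le_Suc_eq)

lemma finite_primes_le: "finite {p::nat. prime p \<and> p \<le> N}"
  by (rule finite_subset[of _ "{..N}"]) auto

lemma prod_primes_le_0: "(\<Prod>p | prime p \<and> p \<le> (0::nat). g p) = 1"
  by (rule prod.neutral) auto

text \<open>The multiples of a prime \<open>q = N + 1\<close> in \<open>sieved N\<close> are \<open>q\<close> times \<open>sieved N\<close>, so removing them
  multiplies the sum by \<open>1 - f q\<close>.\<close>

lemma euler_product_sieve:
  fixes f :: "nat \<Rightarrow> real"
  assumes mult: "\<And>m n. m > 0 \<Longrightarrow> n > 0 \<Longrightarrow> f (m * n) = f m * f n"
    and summable: "f abs_summable_on {1..}"
  shows "(\<Prod>p | prime p \<and> p \<le> N. 1 - f p) * infsum f {1..} = infsum f (sieved N)"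
proof (induction N)
  case 0
  show ?case unfolding prod_primes_le_0 by (simp add: sieved_0)
next
  case (Suc N)
  have s: "f summable_on A" if "A \<subseteq> {1..}" for A
    using summable_on_subset_banach[OF abs_summable_summable[OF summable] that] .
  have sub: "sieved N \<subseteq> {1..}" for N by (auto simp: sieved_def)
  show ?case
  proof (cases "prime (Suc N)")
    case True
    have "infsum f (sieved N) = infsum f (sieved (Suc N)) + infsum f ((\<lambda>n. Suc N * n) ` sieved N)"
      by (subst sieved_Suc_prime(1)[OF True], rule infsum_Un_disjoint)
         (use sieved_Suc_prime[OF True] sub[of N] sub[of "Suc N"] in \<open>auto intro!: s\<close>)
    also have "infsum f ((\<lambda>n. Suc N * n) ` sieved N) = infsum (\<lambda>n. f (Suc N * n)) (sieved N)"
      by (subst infsum_reindex) (simp_all add: inj_on_def comp_def del: mult_Suc)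
    also have "\<dots> = infsum (\<lambda>n. f (Suc N) * f n) (sieved N)"
      by (rule infsum_cong) (auto simp: sieved_def mult simp del: mult_Suc)
    also have "\<dots> = f (Suc N) * infsum f (sieved N)" by (rule infsum_cmult_right')
    finally have "(1 - f (Suc N)) * infsum f (sieved N) = infsum f (sieved (Suc N))"
      unfolding left_diff_distrib by linarith
    moreover have "(\<Prod>p | prime p \<and> p \<le> Suc N. 1 - f p) = (1 - f (Suc N)) * (\<Prod>p | prime p \<and> p \<le> N. 1 - f p)"
      using True by (simp add: primes_le_Suc finite_primes_le)
    ultimately show ?thesis using Suc by (simp add: mult.assoc)
  next
    case False
    then show ?thesis using Suc by (simp add: primes_le_Suc sieved_Suc_not_prime)
  qed
qed

lemma infsum_UNIV_nat_eq_suminf: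
  fixes f :: "nat \<Rightarrow> real"
  shows "f summable_on UNIV \<Longrightarrow> infsum f UNIV = (\<Sum>n. f n)"
  by (intro sums_unique has_sum_imp_sums has_sum_infsum)

text \<open>After sieving, only the term at 1 and a part of the tail beyond \<open>N\<close> are
  left. Stating the limit for the product of Euler factors and series makes nonvanishing of the
  series a consequence.\<close>

lemma euler_product_tendsto:
  fixes f :: "nat \<Rightarrow> real"
  assumes mult: "\<And>m n. m > 0 \<Longrightarrow> n > 0 \<Longrightarrow> f (m * n) = f m * f n" and one: "f 1 = 1"
    and summable: "summable (\<lambda>n. \<bar>f (Suc n)\<bar>)"
  shows "(\<lambda>N. (\<Prod>p | prime p \<and> p \<le> N. 1 - f p) * (\<Sum>n. f (Suc n))) \<longlonglongrightarrow> 1"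
proof -
  have img: "{1..} = Suc ` UNIV" by (auto simp: image_iff) (metis Suc_pred less_eq_Suc_le)
  have sU: "(\<lambda>n. f (Suc n)) abs_summable_on UNIV"
    using summable by (simp add: norm_summable_imp_summable_on summable_on_UNIV_nonneg_real_iff)
  then have abs: "f abs_summable_on {1..}"
    unfolding img by (subst summable_on_reindex) (auto simp: comp_def)
  have total: "infsum f {1..} = (\<Sum>n. f (Suc n))"
    unfolding img infsum_reindex[OF inj_Suc] comp_def
    by (rule infsum_UNIV_nat_eq_suminf[OF abs_summable_summable[OF sU]])
  have "infsum f (sieved N) - 1 = infsum f (sieved N - {1})" for N
  proof -
    have "1 \<in> sieved N" by (auto simp: sieved_def)
    then have "infsum f (sieved N) = infsum f ({1} \<union> (sieved N - {1}))" by (simp add: insert_absorb)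
    also have "\<dots> = infsum f {1} + infsum f (sieved N - {1})"
      by (rule infsum_Un_disjoint)
         (auto intro!: summable_on_subset_banach[OF abs_summable_summable[OF abs]] simp: sieved_def)
    finally show ?thesis using one by simp
  qed
  moreover have "\<bar>infsum f (sieved N - {1})\<bar> \<le> (\<Sum>n. \<bar>f (Suc (n + N))\<bar>)" for N
  proof -
    have sub: "sieved N - {1} \<subseteq> {Suc N..}"
    proof
      fix n assume n: "n \<in> sieved N - {1}"
      then obtain p where p: "prime p" "p dvd n" using prime_factor_nat[of n] by auto
      then have "p > N" "p \<le> n" using n by (auto simp: sieved_def dest: dvd_imp_le)
      then show "n \<in> {Suc N..}" by auto
    qed
    have abs': "f abs_summable_on A" if "A \<subseteq> {1..}" for A
      using summable_on_subset_banach[OF abs that] .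
    have abs1: "f abs_summable_on sieved N - {1}" by (rule abs') (auto simp: sieved_def)
    then have "\<bar>infsum f (sieved N - {1})\<bar> \<le> infsum (\<lambda>n. \<bar>f n\<bar>) (sieved N - {1})"
      using norm_infsum_bound by fastforce
    also have "\<dots> \<le> infsum (\<lambda>n. \<bar>f n\<bar>) {Suc N..}"
      by (rule infsum_mono_neutral) (use abs1 abs'[of "{Suc N..}"] sub in auto)
    also have "{Suc N..} = (\<lambda>n. Suc (n + N)) ` UNIV"
    proof (intro equalityI subsetI)
      fix x assume "x \<in> {Suc N..}"
      then have "x = Suc ((x - Suc N) + N)" by simp
      then show "x \<in> (\<lambda>n. Suc (n + N)) ` UNIV" by blast
    qed auto
    also have "infsum (\<lambda>n. \<bar>f n\<bar>) \<dots> = infsum (\<lambda>n. \<bar>f (Suc (n + N))\<bar>) UNIV"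
      by (subst infsum_reindex) (auto simp: inj_on_def comp_def)
    also have "\<dots> = (\<Sum>n. \<bar>f (Suc (n + N))\<bar>)"
      using summable_ignore_initial_segment[OF summable, of N]
      by (intro infsum_UNIV_nat_eq_suminf) (simp add: summable_on_UNIV_nonneg_real_iff)
    finally show ?thesis .
  qed
  ultimately have le: "norm (infsum f (sieved N) - 1) \<le> (\<Sum>n. \<bar>f (Suc (n + N))\<bar>)" for N
    by simp
  have "(\<lambda>N. (\<Sum>n. \<bar>f (Suc n)\<bar>) - (\<Sum>n<N. \<bar>f (Suc n)\<bar>)) \<longlonglongrightarrow> (\<Sum>n. \<bar>f (Suc n)\<bar>) - (\<Sum>n. \<bar>f (Suc n)\<bar>)"
    by (intro tendsto_diff tendsto_const summable_LIMSEQ summable)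
  then have "(\<lambda>N. \<Sum>n. \<bar>f (Suc (n + N))\<bar>) \<longlonglongrightarrow> 0"
    using suminf_minus_initial_segment[OF summable] by simp
  from Lim_null_comparison[OF always_eventually[OF allI[OF le]] this]
  have "(\<lambda>N. infsum f (sieved N) - 1) \<longlonglongrightarrow> 0" .
  then have "(\<lambda>N. infsum f (sieved N)) \<longlonglongrightarrow> 1" by (rule LIM_zero_cancel)
  then show ?thesis unfolding total[symmetric] using euler_product_sieve[OF mult abs] by simp
qed

text \<open>A truncated sieve, as the harmonic series has no sum. A multiple
  \<open>q * n \<le> x\<close> has \<open>n \<le> x\<close>, so the removed multiples are covered by
  \<open>q\<close> times the truncated set; the covering may overshoot \<open>x\<close>, hence only
  an inequality.\<close>

lemma prod_one_minus_inverse_primes_le: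
  "(\<Prod>p | prime p \<and> p \<le> N. 1 - 1 / real p) * (\<Sum>n=1..x. 1 / real n) \<le> (\<Sum>n\<in>sieved N \<inter> {..x}. 1 / real n)"
proof (induction N)
  case 0
  have "sieved 0 \<inter> {..x} = {1..x}" by (auto simp: sieved_0)
  then show ?case unfolding prod_primes_le_0 by simp
next
  case (Suc N)
  show ?case
  proof (cases "prime (Suc N)")
    case True
    let ?q = "Suc N"
    have q: "real ?q > 1" using prime_gt_1_nat[OF True] by simp
    have "sieved N \<inter> {..x} \<subseteq> (sieved ?q \<inter> {..x}) \<union> (\<lambda>n. ?q * n) ` (sieved N \<inter> {..x})"
    proof
      fix n assume n: "n \<in> sieved N \<inter> {..x}"
      then consider "n \<in> sieved ?q" | k where "n = ?q * k" "k \<in> sieved N"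
        using sieved_Suc_prime(1)[OF True] by blast
      then show "n \<in> (sieved ?q \<inter> {..x}) \<union> (\<lambda>n. ?q * n) ` (sieved N \<inter> {..x})"
        using n by cases auto
    qed
    then have "(\<Sum>n\<in>sieved N \<inter> {..x}. 1 / real n)
        \<le> (\<Sum>n\<in>(sieved ?q \<inter> {..x}) \<union> (\<lambda>n. ?q * n) ` (sieved N \<inter> {..x}). 1 / real n)"
      by (intro sum_mono2) auto
    also have "\<dots> = (\<Sum>n\<in>sieved ?q \<inter> {..x}. 1 / real n) + (\<Sum>n\<in>(\<lambda>n. ?q * n) ` (sieved N \<inter> {..x}). 1 / real n)"
      by (rule sum.union_disjoint) (use sieved_Suc_prime(2)[OF True] in auto)
    also have "(\<Sum>n\<in>(\<lambda>n. ?q * n) ` (sieved N \<inter> {..x}). 1 / real n) = 1 / real ?q * (\<Sum>n\<in>sieved N \<inter> {..x}. 1 / real n)"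
      by (subst sum.reindex) (auto simp: inj_on_def sum_distrib_left simp del: mult_Suc of_nat_Suc)
    finally have "(1 - 1 / real ?q) * (\<Sum>n\<in>sieved N \<inter> {..x}. 1 / real n) \<le> (\<Sum>n\<in>sieved ?q \<inter> {..x}. 1 / real n)"
      by (simp add: algebra_simps)
    moreover have "(1 - 1 / real ?q) * ((\<Prod>p | prime p \<and> p \<le> N. 1 - 1 / real p) * (\<Sum>n=1..x. 1 / real n))
        \<le> (1 - 1 / real ?q) * (\<Sum>n\<in>sieved N \<inter> {..x}. 1 / real n)"
      using Suc q by (intro mult_left_mono) auto
    moreover have "(\<Prod>p | prime p \<and> p \<le> ?q. 1 - 1 / real p) = (1 - 1 / real ?q) * (\<Prod>p | prime p \<and> p \<le> N. 1 - 1 / real p)"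
      using True by (simp add: primes_le_Suc finite_primes_le)
    ultimately show ?thesis by (simp add: mult.assoc)
  next
    case False
    then show ?thesis using Suc by (simp add: primes_le_Suc sieved_Suc_not_prime)
  qed
qed

section \<open>Chebyshev's bound\<close>

text \<open>Regroups the pairs with \<open>d * e \<le> N\<close>. The Chebyshev, Mertens and Lambert
  arguments all rest on this exchange.\<close>

lemma sum_divisors_swap:
  fixes g :: "nat \<Rightarrow> nat \<Rightarrow> 'a::comm_monoid_add"
  shows "(\<Sum>n=1..N. \<Sum>d | d dvd n. g d (n div d)) = (\<Sum>d=1..N. \<Sum>e=1..N div d. g d e)"
proof -
  have "(\<Sum>n=1..N. \<Sum>d | d dvd n. g d (n div d)) = (\<Sum>(n, d)\<in>(SIGMA n:{1..N}. {d. d dvd n}). g d (n div d))"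
    by (rule sum.Sigma) auto
  also have "\<dots> = (\<Sum>(d, e)\<in>(SIGMA d:{1..N}. {1..N div d}). g d e)"
  proof (rule sum.reindex_bij_witness[of _ "\<lambda>(d, e). (d * e, d)" "\<lambda>(n, d). (d, n div d)"])
    fix x assume "x \<in> (SIGMA n:{1..N}. {d. d dvd n})"
    then obtain n d where x: "x = (n, d)" "1 \<le> n" "n \<le> N" "d dvd n" by auto
    then have d: "1 \<le> d" "d \<le> n" by (auto intro: dvd_imp_le Suc_leI dvd_pos_nat)
    have "1 \<le> n div d" using d x by (simp add: div_greater_zero_iff Suc_le_eq)
    then show "(case x of (n, d) \<Rightarrow> (d, n div d)) \<in> (SIGMA d:{1..N}. {1..N div d})"
      using x d by (auto intro: div_le_mono)
    show "(\<lambda>(d, e). (d * e, d)) ((\<lambda>(n, d). (d, n div d)) x) = x" using x by simp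
    show "(case (case x of (n, d) \<Rightarrow> (d, n div d)) of (d, e) \<Rightarrow> g d e) = (case x of (n, d) \<Rightarrow> g d (n div d))"
      using x by simp
  next
    fix x assume "x \<in> (SIGMA d:{1..N}. {1..N div d})"
    then obtain d e where x: "x = (d, e)" "1 \<le> d" "1 \<le> e" "e \<le> N div d" by auto
    then have "d * e \<le> N" by (metis div_times_less_eq_dividend le_trans mult.commute mult_le_mono1)
    moreover have "1 \<le> d * e" using x by simp
    ultimately show "(case x of (d, e) \<Rightarrow> (d * e, d)) \<in> (SIGMA n:{1..N}. {d. d dvd n})" using x by simp
    show "(case (case x of (d, e) \<Rightarrow> (d * e, d)) of (n, d) \<Rightarrow> (d, n div d)) = x" using x by simp
  qed
  also have "\<dots> = (\<Sum>d=1..N. \<Sum>e=1..N div d. g d e)"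
    by (rule sum.Sigma[symmetric]) auto
  finally show ?thesis .
qed

lemma ln_fact_eq_sum_mangoldt: "ln (fact N) = (\<Sum>d=1..N. mangoldt d * real (N div d))"
proof -
  have "ln (fact N) = (\<Sum>n=1..N. ln (real n))"
    by (induction N) (auto simp: ln_mult)
  also have "\<dots> = (\<Sum>n=1..N. \<Sum>d | d dvd n. mangoldt d)"
  proof (rule sum.cong[OF refl])
    fix n assume "n \<in> {1..N}"
    then have "n \<noteq> 0" by auto
    then show "ln (real n) = (\<Sum>d | d dvd n. mangoldt d)" using mangoldt_sum[of n, where 'a = real] by simp
  qed
  also have "\<dots> = (\<Sum>d=1..N. \<Sum>e=1..N div d. mangoldt d)"
    by (rule sum_divisors_swap[of "\<lambda>d e. mangoldt d"])
  finally show ?thesis by (simp add: mult.commute)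
qed

text \<open>Chebyshev's argument: the logarithm of the central binomial coefficient is the sum of
  \<open>mangoldt d\<close> with weights \<open>2 * n div d - 2 * (n div d)\<close>. These are
  nonnegative and equal 1 for \<open>n < d \<le> 2 * n\<close>, while the coefficient is at most
  \<open>2^(2 n)\<close>.\<close>

lemma sum_mangoldt_double_le:
  "(\<Sum>d=1..2 * n. mangoldt d :: real) \<le> (\<Sum>d=1..n. mangoldt d) + real (2 * n) * ln 2"
proof -
  have ext: "(\<Sum>d=1..n. mangoldt d * real (n div d)) = (\<Sum>d=1..2 * n. mangoldt d * real (n div d))"
    by (rule sum.mono_neutral_left) auto
  have "(\<Sum>d=1..2 * n. mangoldt d :: real) - (\<Sum>d=1..n. mangoldt d) = (\<Sum>d\<in>{1..2 * n} - {1..n}. mangoldt d)"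
    by (rule sum_diff[symmetric]) auto
  also have "{1..2 * n} - {1..n} = {n<..2 * n}" by auto
  also have "(\<Sum>d\<in>{n<..2 * n}. mangoldt d :: real) \<le> (\<Sum>d\<in>{n<..2 * n}. mangoldt d * (real (2 * n div d) - 2 * real (n div d)))"
  proof (rule sum_mono)
    fix d assume d: "d \<in> {n<..2 * n}"
    then have "2 * n div d \<ge> 1" by (simp add: div_greater_zero_iff Suc_le_eq)
    then have "mangoldt d * 1 \<le> (mangoldt d :: real) * (real (2 * n div d) - 2 * real (n div d))"
      using d by (intro mult_left_mono mangoldt_nonneg) auto
    then show "mangoldt d \<le> (mangoldt d :: real) * (real (2 * n div d) - 2 * real (n div d))" by simp
  qed
  also have "\<dots> \<le> (\<Sum>d=1..2 * n. mangoldt d * (real (2 * n div d) - 2 * real (n div d)))"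
  proof (rule sum_mono2)
    fix d :: nat
    have "2 * (n div d) \<le> 2 * n div d" by (cases "d = 0") (auto simp: less_eq_div_iff_mult_less_eq)
    then have "2 * real (n div d) \<le> real (2 * n div d)" by linarith
    then show "0 \<le> mangoldt d * (real (2 * n div d) - 2 * real (n div d))"
      by (intro mult_nonneg_nonneg mangoldt_nonneg) auto
  qed auto
  also have "\<dots> = ln (fact (2 * n)) - 2 * ln (fact n)"
    unfolding ln_fact_eq_sum_mangoldt ext by (simp add: algebra_simps sum_subtractf sum_distrib_left)
  also have "\<dots> \<le> real (2 * n) * ln 2"
  proof -
    have "fact (2 * n) = fact n * fact (2 * n - n) * (2 * n choose n)"
      by (rule binomial_fact_lemma[symmetric]) simp
    then have eq: "(fact (2 * n) :: real) = fact n * fact n * real (2 * n choose n)"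
      by (metis (no_types, lifting) add_diff_cancel_left' mult_2 of_nat_fact of_nat_mult)
    have pos: "real (2 * n choose n) > 0" by simp
    have "ln (fact (2 * n) :: real) = ln (fact n) + ln (fact n) + ln (real (2 * n choose n))"
      unfolding eq using pos by (simp add: ln_mult)
    moreover have "ln (real (2 * n choose n)) \<le> ln (2 ^ (2 * n))"
    proof -
      have "2 * n choose n \<le> 2 ^ (2 * n)" by (rule binomial_le_pow2)
      then have "real (2 * n choose n) \<le> 2 ^ (2 * n)" by (metis of_nat_le_iff of_nat_numeral of_nat_power)
      then show ?thesis using pos by (simp del: power_mult)
    qed
    ultimately show ?thesis by (simp add: ln_realpow)
  qed
  finally show ?thesis by simp
qed

lemma ln_two_le: "ln (2::real) \<le> 1"
  using ln_le_minus_one[of 2] by simp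

text \<open>Halving the argument costs at most \<open>2 n\<close>, and an odd argument at most
  another \<open>2 n\<close> for its last term, since \<open>ln (2 n + 1) \<le> 2 n\<close>. The
  constant 4 absorbs this: \<open>4 n + 2 n + 2 n = 8 n\<close>.\<close>

lemma sum_mangoldt_le: "(\<Sum>d=1..N. mangoldt d :: real) \<le> 4 * real N"
proof (induction N rule: less_induct)
  case (less N)
  consider "N = 0" | n where "N = 2 * n" "n > 0" | n where "N = Suc (2 * n)"
    by (metis bot_nat_0.not_eq_extremum oddE evenE Suc_eq_plus1 mult_0_right)
  then show ?case
  proof cases
    case (2 n)
    have "real (2 * n) * ln 2 \<le> real (2 * n) * 1" by (intro mult_left_mono ln_two_le) auto
    then have "(\<Sum>d=1..2 * n. mangoldt d :: real) \<le> (\<Sum>d=1..n. mangoldt d) + real (2 * n)"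
      using sum_mangoldt_double_le[of n] by linarith
    moreover have "(\<Sum>d=1..n. mangoldt d :: real) \<le> 4 * real n" using less[of n] 2 by simp
    ultimately show ?thesis unfolding 2(1) by simp
  next
    case (3 n)
    have *: "real (2 * n) * ln 2 \<le> real (2 * n) * 1" by (intro mult_left_mono ln_two_le) auto
    have "ln (real (Suc (2 * n))) \<le> real (Suc (2 * n)) - 1" by (intro ln_le_minus_one) simp
    then have m: "mangoldt (Suc (2 * n)) \<le> real (2 * n)" using mangoldt_le[of "Suc (2 * n)"] by simp
    have "(\<Sum>d=1..n. mangoldt d :: real) \<le> 4 * real n" using less[of n] 3 by simp
    moreover have "(\<Sum>d=1..2 * n. mangoldt d :: real) \<le> (\<Sum>d=1..n. mangoldt d) + real (2 * n)"
      using sum_mangoldt_double_le[of n] * by linarith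
    ultimately show ?thesis unfolding 3 using m by simp
  qed simp
qed

lemma sum_power_from_2_le:
  fixes x :: real
  assumes "0 \<le> x" "x \<le> 1 / 2"
  shows "(\<Sum>k=2..N. x ^ k) \<le> 2 * x\<^sup>2"
proof -
  \<comment> \<open>The subtracted term is what makes the induction close, using
    \<open>2 * x \<le> 1\<close>.\<close>
  have "(\<Sum>k=2..Suc N. x ^ k) \<le> 2 * x\<^sup>2 - 2 * x ^ Suc (Suc N)" for N
  proof (induction N)
    case (Suc N)
    have "x ^ Suc (Suc N) * (2 * x) \<le> x ^ Suc (Suc N) * 1" using assms by (intro mult_left_mono) auto
    then show ?case using Suc by (simp add: algebra_simps)
  qed (simp add: power2_eq_square)
  then have "(\<Sum>k=2..Suc N. x ^ k) \<le> 2 * x\<^sup>2" for N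
    using assms(1) by (smt (verit) zero_le_power)
  moreover have "(\<Sum>k=2..N. x ^ k) \<le> (\<Sum>k=2..Suc N. x ^ k)"
    using assms(1) by (intro sum_mono2) auto
  ultimately show ?thesis using order_trans by blast
qed

lemma ln_le_two_sqrt:
  fixes x :: real
  assumes "x \<ge> 1"
  shows "ln x \<le> 2 * x powr (1/2)"
proof -
  have "ln (x powr (1/2)) \<le> x powr (1/2) - 1" using assms by (intro ln_le_minus_one) auto
  then show ?thesis using assms by (simp add: ln_powr)
qed

text \<open>Only powers \<open>p^k\<close> with \<open>k \<ge> 2\<close> contribute. A geometric
  series and \<open>ln p \<le> 2 p^(1/2)\<close> bound the share of \<open>p\<close> by
  \<open>4 p^(-3/2)\<close>, which is summable.\<close>

lemma sum_mangoldt_not_prime_bounded: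
  "\<exists>C. \<forall>N. (\<Sum>d | d \<in> {1..N} \<and> \<not> prime d. mangoldt d / real d) \<le> C"
proof -
  have summ: "summable (\<lambda>n. 4 * real n powr (-3/2))" by (intro summable_mult) (simp add: summable_real_powr_iff)
  have "(\<Sum>d | d \<in> {1..N} \<and> \<not> prime d. mangoldt d / real d) \<le> (\<Sum>n. 4 * real n powr (-3/2))" for N
  proof -
    let ?A = "{d\<in>{1..N}. \<not> prime d \<and> primepow d}"
    let ?P = "{p\<in>{1..N}. prime p}"
    have "(\<Sum>d | d \<in> {1..N} \<and> \<not> prime d. mangoldt d / real d) = (\<Sum>d\<in>?A. mangoldt d / real d)"
      by (rule sum.mono_neutral_right) (auto simp: mangoldt_def)
    also have "\<dots> \<le> (\<Sum>d\<in>(\<lambda>(p, k). p ^ k) ` (?P \<times> {2..N}). mangoldt d / real d)"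
    proof (rule sum_mono2)
      show "?A \<subseteq> (\<lambda>(p, k). p ^ k) ` (?P \<times> {2..N})"
      proof
        fix d assume d: "d \<in> ?A"
        then obtain p k where pk: "prime p" "k > 0" "d = p ^ k" by (auto simp: primepow_def)
        have "k \<noteq> 1" using d pk by auto
        then have "k \<ge> 2" using pk by simp
        have "k < p ^ k" using prime_gt_1_nat[OF pk(1)] by (simp add: power_gt_expt)
        then have "k \<le> N" using d pk by simp
        have "p \<le> p ^ k" using prime_gt_0_nat[OF pk(1)] pk(2) by (simp add: self_le_power)
        then have "p \<le> N" using d pk by simp
        have "p \<ge> 1" using prime_gt_0_nat[OF pk(1)] by simp
        then have "(p, k) \<in> ?P \<times> {2..N}" using pk \<open>k \<ge> 2\<close> \<open>k \<le> N\<close> \<open>p \<le> N\<close> by simp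
        then show "d \<in> (\<lambda>(p, k). p ^ k) ` (?P \<times> {2..N})" using pk(3) by force
      qed
    qed (auto intro: divide_nonneg_nonneg mangoldt_nonneg)
    also have "\<dots> \<le> (\<Sum>x\<in>?P \<times> {2..N}. mangoldt (case x of (p, k) \<Rightarrow> p ^ k) / real (case x of (p, k) \<Rightarrow> p ^ k))"
    proof -
      have "finite (?P \<times> {2..N})" by simp
      from sum_image_le[OF this, of "\<lambda>d. mangoldt d / real d" "\<lambda>(p, k). p ^ k"]
      show ?thesis by (simp add: comp_def divide_nonneg_nonneg mangoldt_nonneg)
    qed
    also have "\<dots> = (\<Sum>p\<in>?P. \<Sum>k=2..N. mangoldt (p ^ k) / real (p ^ k))"
      by (simp only: sum.cartesian_product case_prod_unfold)
    also have "\<dots> \<le> (\<Sum>p\<in>?P. 4 * real p powr (-3/2))"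
    proof (rule sum_mono)
      fix p assume "p \<in> ?P"
      then have p: "prime p" "real p \<ge> 2" using prime_ge_2_nat by auto
      have "(\<Sum>k=2..N. mangoldt (p ^ k) / real (p ^ k)) = (\<Sum>k=2..N. ln (real p) * (1 / real p) ^ k)"
        by (intro sum.cong) (use p in \<open>auto simp: power_one_over\<close>)
      also have "\<dots> = ln (real p) * (\<Sum>k=2..N. (1 / real p) ^ k)" by (simp add: sum_distrib_left)
      also have "\<dots> \<le> (2 * real p powr (1/2)) * (2 * (1 / real p)\<^sup>2)"
        using p by (intro mult_mono ln_le_two_sqrt sum_power_from_2_le) (auto simp: field_simps intro: sum_nonneg)
      also have "(1 / real p)\<^sup>2 = real p powr (-2)" using p by (simp add: powr_minus power_one_over field_simps)
      also have "(2 * real p powr (1/2)) * (2 * real p powr (-2)) = 4 * real p powr (-3/2)"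
        using p by (simp flip: powr_add)
      finally show "(\<Sum>k=2..N. mangoldt (p ^ k) / real (p ^ k)) \<le> 4 * real p powr (-3/2)" .
    qed
    also have "\<dots> \<le> (\<Sum>n. 4 * real n powr (-3/2))"
      by (rule sum_le_suminf[OF summ]) auto
    finally show ?thesis .
  qed
  then show ?thesis by (intro exI allI)
qed

section \<open>Real characters and the series at 1\<close>

text \<open>Covers the Kronecker symbols and, as the constant 1, the zeta function. Boundedness of
  partial sums, added in the next locale, singles out the nonprincipal case.\<close>

locale sign_character =
  fixes \<phi> :: "nat \<Rightarrow> real"
  assumes one: "\<phi> (Suc 0) = 1"
    and mult: "\<And>m n. m > 0 \<Longrightarrow> n > 0 \<Longrightarrow> \<phi> (m * n) = \<phi> m * \<phi> n"
    and range: "\<And>n. \<phi> n \<in> {-1, 0, 1}"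
begin

lemma abs_le_1: "\<bar>\<phi> n\<bar> \<le> 1"
  using range[of n] by auto

lemma pow: "n > 0 \<Longrightarrow> \<phi> (n ^ k) = \<phi> n ^ k"
  by (induction k) (simp_all add: one mult)

end

locale bounded_character = sign_character +
  fixes B :: real
  assumes bounded: "\<And>m n. m \<ge> 1 \<Longrightarrow> \<bar>\<Sum>k=m..n. \<phi> k\<bar> \<le> B"
begin

lemma B_ge_0: "B \<ge> 0"
  using bounded[of 1 1] by linarith

text \<open>The junk term at \<open>n = 0\<close> vanishes because \<open>1 / 0 = 0\<close>.\<close>

definition L1 :: real where "L1 = (\<Sum>n. \<phi> n * (1 / real n))"

lemma inverse_antimono: "k \<ge> 1 \<Longrightarrow> 1 / real (Suc k) \<le> 1 / real k"
  by (simp add: frac_le)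

lemma summable_L1: "summable (\<lambda>n. \<phi> n * (1 / real n))"
  by (rule summable_mult_antimono[where K = 1, OF inverse_antimono lim_1_over_n bounded])

lemma L1_tail: "\<bar>L1 - (\<Sum>n=1..N. \<phi> n / real n)\<bar> \<le> B / real (Suc N)"
proof -
  have "\<bar>L1 - (\<Sum>n<Suc N. \<phi> n * (1 / real n))\<bar> \<le> B * (1 / real (Suc N))"
    unfolding L1_def
    by (rule abs_suminf_mult_antimono_le[where K = 1, OF inverse_antimono lim_1_over_n bounded]) auto
  moreover have "(\<Sum>n<Suc N. \<phi> n * (1 / real n)) = (\<Sum>n=1..N. \<phi> n / real n)"
    by (rule sum.mono_neutral_cong_right) auto
  ultimately show ?thesis by simp
qed

text \<open>Mertens' argument. Expanding \<open>ln n\<close> as a divisor sum of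
  \<open>mangoldt\<close> turns the bounded sum of \<open>\<phi> n * ln n / n\<close> into the sum
  in question, with each term multiplied by a partial sum of \<open>L1\<close> of length
  \<open>N div d\<close>. Replacing that partial sum by \<open>L1\<close> costs at most
  \<open>mangoldt d * B / N\<close> for each \<open>d\<close>, hence \<open>4 * B\<close> in total
  by Chebyshev's bound; then one divides by \<open>L1\<close>.\<close>

lemma sum_chi_mangoldt_bounded:
  assumes "L1 \<noteq> 0"
  shows "\<exists>C. \<forall>N. \<bar>\<Sum>d=1..N. \<phi> d * mangoldt d / real d\<bar> \<le> C"
proof -
  \<comment> \<open>The weight \<open>ln n / n\<close> decreases only beyond \<open>exp 1\<close>,
    hence the start at 3.\<close>
  have "summable (\<lambda>n. \<phi> n * (ln (real n) / real n))"
  proof (rule summable_mult_antimono[where K = 3 and B = B])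
    fix k :: nat assume "k \<ge> 3"
    then show "ln (real (Suc k)) / real (Suc k) \<le> ln (real k) / real k"
      by (intro ln_x_over_x_mono) (use exp_le in linarith, simp)
  next
    show "\<bar>\<Sum>k=m..n. \<phi> k\<bar> \<le> B" if "m \<ge> 3" for m n by (rule bounded) (use that in simp)
  qed (rule lim_ln_over_n)
  then have "Bseq (\<lambda>N. \<Sum>n<N. \<phi> n * (ln (real n) / real n))"
    by (intro convergent_imp_Bseq) (simp add: summable_iff_convergent)
  then obtain C where C: "\<And>N. \<bar>\<Sum>n<N. \<phi> n * (ln (real n) / real n)\<bar> \<le> C"
    by (auto simp: Bseq_def)
  have "\<bar>L1 * (\<Sum>d=1..N. \<phi> d * mangoldt d / real d)\<bar> \<le> C + 4 * B" for N
  proof -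
    let ?T = "\<lambda>N. \<Sum>e=1..N. \<phi> e / real e"
    have "(\<Sum>n<Suc N. \<phi> n * (ln (real n) / real n)) = (\<Sum>n=1..N. \<phi> n * (ln (real n) / real n))"
      by (rule sum.mono_neutral_cong_right) auto
    also have "\<dots> = (\<Sum>n=1..N. \<Sum>d | d dvd n. \<phi> d * mangoldt d / real d * (\<phi> (n div d) / real (n div d)))"
    proof (rule sum.cong[OF refl])
      fix n assume "n \<in> {1..N}"
      then have n: "n > 0" by simp
      have "\<phi> n * (ln (real n) / real n) = (\<Sum>d | d dvd n. \<phi> n / real n * mangoldt d)"
        unfolding sum_distrib_left[symmetric] using mangoldt_sum[of n, where 'a = real] n by simp
      also have "\<dots> = (\<Sum>d | d dvd n. \<phi> d * mangoldt d / real d * (\<phi> (n div d) / real (n div d)))"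
      proof (rule sum.cong[OF refl])
        fix d assume "d \<in> {d. d dvd n}"
        then obtain e where e: "n = d * e" by blast
        then have "d > 0" "e > 0" using n by auto
        then show "\<phi> n / real n * mangoldt d = \<phi> d * mangoldt d / real d * (\<phi> (n div d) / real (n div d))"
          by (simp add: e mult)
      qed
      finally show "\<phi> n * (ln (real n) / real n) = (\<Sum>d | d dvd n. \<phi> d * mangoldt d / real d * (\<phi> (n div d) / real (n div d)))" .
    qed
    also have "\<dots> = (\<Sum>d=1..N. \<Sum>e=1..N div d. \<phi> d * mangoldt d / real d * (\<phi> e / real e))"
      by (rule sum_divisors_swap)
    also have "\<dots> = (\<Sum>d=1..N. \<phi> d * mangoldt d / real d * ?T (N div d))"
      by (simp add: sum_distrib_left)
    finally have 1: "(\<Sum>n<Suc N. \<phi> n * (ln (real n) / real n)) = (\<Sum>d=1..N. \<phi> d * mangoldt d / real d * ?T (N div d))" .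
    have "L1 * (\<Sum>d=1..N. \<phi> d * mangoldt d / real d) - (\<Sum>d=1..N. \<phi> d * mangoldt d / real d * ?T (N div d))
        = (\<Sum>d=1..N. \<phi> d * mangoldt d / real d * (L1 - ?T (N div d)))"
      by (simp add: sum_distrib_left sum_subtractf algebra_simps)
    also have "\<bar>\<dots>\<bar> \<le> (\<Sum>d=1..N. \<bar>\<phi> d * mangoldt d / real d * (L1 - ?T (N div d))\<bar>)" by (rule sum_abs)
    also have "\<dots> \<le> (\<Sum>d=1..N. mangoldt d * (B / real N))"
    proof (rule sum_mono)
      fix d assume d: "d \<in> {1..N}"
      have "N < d * Suc (N div d)" using d dividend_less_times_div[of d N] by simp
      then have "real N \<le> real d * real (Suc (N div d))" unfolding of_nat_mult[symmetric] by linarith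
      then have *: "B * real N \<le> B * (real d * real (Suc (N div d)))" by (rule mult_left_mono[OF _ B_ge_0])
      have "real N > 0" "real (Suc (N div d)) > 0" using d by auto
      then have "B / real (Suc (N div d)) \<le> B * real d / real N"
        using * by (simp add: divide_le_eq pos_le_divide_eq mult_ac del: of_nat_Suc)
      then have "\<bar>L1 - ?T (N div d)\<bar> \<le> B * real d / real N" using L1_tail[of "N div d"] by linarith
      then have "\<bar>\<phi> d\<bar> * mangoldt d / real d * \<bar>L1 - ?T (N div d)\<bar> \<le> 1 * mangoldt d / real d * (B * real d / real N)"
        by (intro mult_mono divide_right_mono mangoldt_nonneg abs_le_1) (auto intro!: mult_nonneg_nonneg divide_nonneg_nonneg mangoldt_nonneg)
      then show "\<bar>\<phi> d * mangoldt d / real d * (L1 - ?T (N div d))\<bar> \<le> mangoldt d * (B / real N)"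
        using d by (simp add: abs_mult mult.commute)
    qed
    also have "\<dots> = (\<Sum>d=1..N. mangoldt d) * (B / real N)" by (rule sum_distrib_right[symmetric])
    also have "\<dots> \<le> 4 * real N * (B / real N)"
      by (intro mult_right_mono sum_mangoldt_le divide_nonneg_nonneg B_ge_0) auto
    also have "\<dots> \<le> 4 * B" using B_ge_0 by (cases "N = 0") auto
    finally show ?thesis using C[of "Suc N"] unfolding 1 by linarith
  qed
  then have "\<bar>\<Sum>d=1..N. \<phi> d * mangoldt d / real d\<bar> \<le> (C + 4 * B) / \<bar>L1\<bar>" for N
    using assms by (simp add: abs_mult field_simps)
  then show ?thesis by blast
qed

text \<open>Discarding the higher prime powers keeps the sums of \<open>\<phi> p * ln p / p\<close>
  bounded. The logarithm is then removed by Dirichlet's test with the weight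
  \<open>1 / ln n\<close>.\<close>

lemma summable_chi_primes:
  assumes "L1 \<noteq> 0"
  shows "summable (\<lambda>n. if prime n then \<phi> n / real n else 0)"
proof -
  obtain C1 where C1: "\<And>N. \<bar>\<Sum>d=1..N. \<phi> d * mangoldt d / real d\<bar> \<le> C1"
    using sum_chi_mangoldt_bounded[OF assms] by blast
  obtain C2 where C2: "\<And>N. (\<Sum>d | d \<in> {1..N} \<and> \<not> prime d. mangoldt d / real d) \<le> C2"
    using sum_mangoldt_not_prime_bounded by blast
  define c where "c n = (if prime n then \<phi> n * mangoldt n / real n else 0)" for n
  have c: "\<bar>\<Sum>n=1..N. c n\<bar> \<le> C1 + C2" for N
  proof -
    have "(\<Sum>n=1..N. \<phi> n * mangoldt n / real n) - (\<Sum>n=1..N. c n) = (\<Sum>n=1..N. if prime n then 0 else \<phi> n * mangoldt n / real n)"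
      unfolding c_def sum_subtractf[symmetric] by (intro sum.cong) auto
    also have "\<dots> = (\<Sum>d | d \<in> {1..N} \<and> \<not> prime d. \<phi> d * mangoldt d / real d)"
      by (rule sum.mono_neutral_cong_right) auto
    also have "\<bar>\<dots>\<bar> \<le> (\<Sum>d | d \<in> {1..N} \<and> \<not> prime d. mangoldt d / real d)"
    proof (rule order_trans[OF sum_abs sum_mono])
      fix d :: nat
      have "\<bar>\<phi> d\<bar> * (mangoldt d / real d) \<le> 1 * (mangoldt d / real d)"
        by (intro mult_right_mono abs_le_1 divide_nonneg_nonneg mangoldt_nonneg) auto
      then show "\<bar>\<phi> d * mangoldt d / real d\<bar> \<le> mangoldt d / real d" by (simp add: abs_mult)
    qed
    finally show ?thesis using C1[of N] C2[of N] by linarith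
  qed
  have c': "\<bar>\<Sum>n=m..N. c n\<bar> \<le> 2 * (C1 + C2)" if "m \<ge> 2" for m N
  proof (cases "m \<le> N")
    case True
    then have "(\<Sum>n=1..N. c n) = (\<Sum>n=1..m-1. c n) + (\<Sum>n=m..N. c n)"
      using that sum.ub_add_nat[of 1 "m - 1" c "N - (m - 1)"] by simp
    then have "(\<Sum>n=m..N. c n) = (\<Sum>n=1..N. c n) - (\<Sum>n=1..m-1. c n)" by simp
    then have "\<bar>\<Sum>n=m..N. c n\<bar> \<le> \<bar>\<Sum>n=1..N. c n\<bar> + \<bar>\<Sum>n=1..m-1. c n\<bar>"
      by (simp only: abs_triangle_ineq4)
    also have "\<dots> \<le> (C1 + C2) + (C1 + C2)" by (intro add_mono c)
    finally show ?thesis by simp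
  next
    case False
    then show ?thesis using c[of 0] by simp
  qed
  \<comment> \<open>The weights start at 2 because \<open>ln 1 = 0\<close>.\<close>
  have "summable (\<lambda>n. c n * (1 / ln (real n)))"
  proof (rule summable_mult_antimono[where K = 2, OF _ _ c'])
    show "1 / ln (real (Suc k)) \<le> 1 / ln (real k)" if "k \<ge> 2" for k :: nat
      using that by (intro divide_left_mono) (auto intro!: mult_pos_pos)
    show "(\<lambda>k. 1 / ln (real k)) \<longlonglongrightarrow> 0"
      by (intro tendsto_divide_0[OF tendsto_const] filterlim_at_top_imp_at_infinity
          filterlim_compose[OF ln_at_top filterlim_real_sequentially])
  qed
  moreover have "c n * (1 / ln (real n)) = (if prime n then \<phi> n / real n else 0)" for n
    using prime_gt_1_nat[of n] by (auto simp: c_def)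
  ultimately show ?thesis by simp
qed

end

text \<open>Abel's theorem for the Dirichlet series \<open>\<Sum> c n / n\<^sup>s\<^sup>-\<^sup>1\<close>, which need not converge absolutely
  at \<open>s = 1\<close>.\<close>

lemma
  fixes c :: "nat \<Rightarrow> real"
  assumes c: "summable c" and c0: "c 0 = 0"
  shows summable_dirichlet: "s \<in> {1..2} \<Longrightarrow> summable (\<lambda>n. c n * real n powr (1 - s))"
    and continuous_on_dirichlet: "continuous_on {1..2} (\<lambda>s. \<Sum>n. c n * real n powr (1 - s))"
proof -
  let ?f = "\<lambda>N s. \<Sum>n<N. c n * real n powr (1 - s)"
  have "uniformly_Cauchy_on {1..2} ?f"
  proof (rule uniformly_Cauchy_onI')
    fix e :: real assume e: "e > 0"
    then obtain N where N: "\<And>m n. m \<ge> N \<Longrightarrow> \<bar>\<Sum>k=m..<n. c k\<bar> < e / 2"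
      using c unfolding summable_Cauchy by (metis half_gt_zero real_norm_def)
    show "\<exists>M. \<forall>s\<in>{1..2}. \<forall>m\<ge>M. \<forall>n>m. dist (?f m s) (?f n s) < e"
    proof (intro exI[of _ "max N 1"] ballI allI impI)
      fix s :: real and m n :: nat
      assume s: "s \<in> {1..2}" and mn: "m \<ge> max N 1" "n > m"
      then obtain n' where n': "n = Suc n'" "m \<le> n'" by (cases n) auto
      \<comment> \<open>For \<open>s \<ge> 1\<close> the weights decrease and are at most 1, so the
        tails of \<open>c\<close> control all \<open>s\<close> simultaneously.\<close>
      have "\<bar>\<Sum>k=m..n'. c k * real k powr (1 - s)\<bar> \<le> e / 2 * real m powr (1 - s)"
      proof (rule abs_sum_mult_antimono_le[OF n'(2)])
        show "real (Suc k) powr (1 - s) \<le> real k powr (1 - s)" if "k \<in> {m..<n'}" for k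
          using s mn that by (intro powr_mono2') auto
        show "\<bar>\<Sum>k=m..j. c k\<bar> \<le> e / 2" if "j \<in> {m..n'}" for j
          using N[of m "Suc j"] mn by (simp add: atLeastLessThanSuc_atLeastAtMost)
      qed simp
      also have "\<dots> \<le> e / 2 * 1"
        using s mn e powr_mono2'[of "s - 1" 1 "real m"] powr_mono[of "1 - s" 0 "real m"]
        by (intro mult_left_mono) auto
      also have "\<dots> < e" using e by simp
      finally have "\<bar>\<Sum>k=m..<n. c k * real k powr (1 - s)\<bar> < e"
        using n' by (simp add: atLeastLessThanSuc_atLeastAtMost)
      moreover have "?f n s - ?f m s = (\<Sum>k=m..<n. c k * real k powr (1 - s))"
        using sum_diff_nat_ivl[of 0 m n "\<lambda>k. c k * real k powr (1 - s)"] mn by (simp add: atLeast0LessThan)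
      ultimately show "dist (?f m s) (?f n s) < e" by (simp add: dist_real_def abs_minus_commute)
    qed
  qed
  then have conv: "uniformly_convergent_on {1..2} ?f" by (rule Cauchy_uniformly_convergent)
  then have ul: "uniform_limit {1..2} ?f (\<lambda>s. lim (\<lambda>N. ?f N s)) sequentially"
    by (simp add: uniformly_convergent_uniform_limit_iff)
  show "summable (\<lambda>n. c n * real n powr (1 - s))" if "s \<in> {1..2}"
    using tendsto_uniform_limitI[OF ul that] unfolding summable_iff_convergent by (rule convergentI)
  have "continuous_on {1..2} (?f N)" for N
  proof (intro continuous_on_sum)
    fix n
    show "continuous_on {1..2} (\<lambda>s. c n * real n powr (1 - s))"
    proof (cases "n = 0")
      case False
      then show ?thesis by (intro continuous_intros) auto
    qed (simp add: c0)
  qed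
  then have "continuous_on {1..2} (\<lambda>s. lim (\<lambda>N. ?f N s))"
    by (intro uniform_limit_theorem[OF _ ul]) auto
  then show "continuous_on {1..2} (\<lambda>s. \<Sum>n. c n * real n powr (1 - s))"
    by (simp add: suminf_eq_lim)
qed

text \<open>Pairing exponent \<open>i\<close> with \<open>n - 1 - i\<close>, each pair sums to at
  least \<open>2 * x ^ (n - 1)\<close> because a square is nonnegative.\<close>

lemma geometric_sum_ge:
  fixes x :: real
  assumes "0 \<le> x"
  shows "real n * x ^ (n - 1) \<le> (\<Sum>i<n. (x\<^sup>2) ^ i)"
proof -
  have "2 * (\<Sum>i<n. (x\<^sup>2) ^ i) = (\<Sum>i<n. (x\<^sup>2) ^ i) + (\<Sum>i<n. (x\<^sup>2) ^ (n - Suc i))"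
    by (simp add: sum.nat_diff_reindex)
  also have "\<dots> = (\<Sum>i<n. (x\<^sup>2) ^ i + (x\<^sup>2) ^ (n - Suc i))" by (simp add: sum.distrib)
  also have "\<dots> \<ge> (\<Sum>i<n. 2 * x ^ (n - 1))"
  proof (rule sum_mono)
    fix i assume "i \<in> {..<n}"
    then have "x ^ (n - 1) = x ^ i * x ^ (n - Suc i)" by (simp flip: power_add)
    moreover have "0 \<le> (x ^ i - x ^ (n - Suc i))\<^sup>2" by simp
    ultimately show "2 * x ^ (n - 1) \<le> (x\<^sup>2) ^ i + (x\<^sup>2) ^ (n - Suc i)"
      by (simp add: power2_diff power_mult[symmetric] power_even_eq[symmetric] mult.commute[of 2])
  qed
  finally show ?thesis by simp
qed

text \<open>With \<open>G n = 1 + t + ... + t^(n-1)\<close> the claim becomes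
  \<open>t^n / (G n * G (n+1)) \<le> 1 / (n * (n+1))\<close>. Taking \<open>t = x^2\<close> keeps
  the exponents integral: \<open>G n \<ge> n * x^(n-1)\<close> and
  \<open>G (n+1) \<ge> (n+1) * x^n\<close>, and \<open>x^(n-1) * x^n \<ge> t^n\<close>.\<close>

lemma lambert_weight_antimono:
  fixes x :: real
  assumes x: "0 < x" "x < 1" and n: "n \<ge> 1"
  defines "t \<equiv> x\<^sup>2"
  shows "1 / (real (Suc n) * (1 - t)) - t ^ Suc n / (1 - t ^ Suc n) \<le> 1 / (real n * (1 - t)) - t ^ n / (1 - t ^ n)"
proof -
  have t: "0 < t" "t < 1" using x by (auto simp: t_def power_less_one_iff)
  define G where "G n = (\<Sum>i<n. t ^ i)" for n
  have G: "1 - t ^ n = (1 - t) * G n" for n using one_diff_power_eq[of t n] by (simp add: G_def)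
  have "G m > 0" if "m \<ge> 1" for m
    unfolding G_def using t that by (intro sum_pos) (auto simp: lessThan_empty_iff)
  then have Gpos: "G n > 0" "G (Suc n) > 0" using n by simp_all
  have "real n * real (Suc n) * t ^ n = real n * real (Suc n) * (x ^ n * x ^ n)"
    by (simp add: t_def power_mult_distrib power2_eq_square)
  also have "\<dots> \<le> real n * real (Suc n) * (x ^ (n - 1) * x ^ n)"
    using x by (intro mult_left_mono mult_right_mono power_decreasing) auto
  also have "\<dots> = (real n * x ^ (n - 1)) * (real (Suc n) * x ^ (Suc n - 1))" by simp
  also have "\<dots> \<le> G n * G (Suc n)"
    unfolding G_def t_def using x by (intro mult_mono geometric_sum_ge) (auto intro!: sum_nonneg)
  finally have "t ^ n / (G n * G (Suc n)) \<le> 1 / (real n * real (Suc n))"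
    using Gpos n by (simp add: divide_simps mult_ac del: of_nat_Suc)
  then have "t ^ n / (G n * G (Suc n)) / (1 - t) \<le> 1 / (real n * real (Suc n)) / (1 - t)"
    using t by (intro divide_right_mono) auto
  moreover have "t ^ n / (1 - t ^ n) - t ^ Suc n / (1 - t ^ Suc n) = t ^ n / (G n * G (Suc n)) / (1 - t)"
  proof -
    have GS: "G (Suc n) = G n + t ^ n" by (simp add: G_def)
    have "t ^ n = 1 - (1 - t) * G n" using G[of n] by simp
    then have "G (Suc n) - t * G n = 1" unfolding GS by (simp add: algebra_simps)
    moreover have "t ^ n * G (Suc n) - t ^ Suc n * G n = t ^ n * (G (Suc n) - t * G n)"
      by (simp add: algebra_simps)
    ultimately have "t ^ n * G (Suc n) - t ^ Suc n * G n = t ^ n" by simp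
    moreover have "t ^ n / (1 - t ^ n) - t ^ Suc n / (1 - t ^ Suc n) = (t ^ n * G (Suc n) - t ^ Suc n * G n) / (G n * G (Suc n)) / (1 - t)"
    proof -
      have "a / (c * g) - b / (c * h) = (a * h - b * g) / (g * h) / c"
        if "c \<noteq> 0" "g \<noteq> 0" "h \<noteq> 0" for a b c g h :: real using that by (simp add: field_simps)
      then show ?thesis unfolding G using Gpos t by simp
    qed
    ultimately show ?thesis by simp
  qed
  moreover have "1 / (real n * (1 - t)) - 1 / (real (Suc n) * (1 - t)) = 1 / (real n * real (Suc n)) / (1 - t)"
  proof -
    have "1 / (y * c) - 1 / ((1 + y) * c) = 1 / (y * (1 + y)) / c" if "c \<noteq> 0" "y > 0" for c y :: real
      using that by (simp add: divide_simps)
    then show ?thesis using n t unfolding of_nat_Suc by simp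
  qed
  ultimately show ?thesis by linarith
qed

context bounded_character
begin

text \<open>The convolution of \<open>\<phi>\<close> with 1: the coefficients of the product of the
  zeta function with the L-function of \<open>\<phi>\<close>.\<close>

definition rep :: "nat \<Rightarrow> real" where "rep n = (\<Sum>d | d dvd n. \<phi> d)"

lemma rep_prime_power_mult:
  assumes p: "prime p" and m: "\<not> p dvd m" "m > 0"
  shows "rep (p ^ k * m) = (\<Sum>i\<le>k. \<phi> p ^ i) * rep m"
proof -
  have p0: "p > 0" using p by (simp add: prime_gt_0_nat)
  have inj: "inj_on (\<lambda>(i, d). p ^ i * d) ({..k} \<times> {d. d dvd m})"
  proof (rule inj_onI, clarify)
    fix i j d d' assume d: "d dvd m" "d' dvd m" and eq: "p ^ i * d = p ^ j * d'"
    have nd: "\<not> p dvd d" "\<not> p dvd d'" using d m(1) dvd_trans by blast+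
    have "i = j" using prime_power_cancel[OF p _ nd] eq by (simp add: mult.commute)
    then show "i = j \<and> d = d'" using eq p0 by simp
  qed
  have img: "{d. d dvd p ^ k * m} = (\<lambda>(i, d). p ^ i * d) ` ({..k} \<times> {d. d dvd m})"
  proof (intro equalityI subsetI)
    fix d assume "d \<in> {d. d dvd p ^ k * m}"
    then obtain b c where bc: "d = b * c" "b dvd p ^ k" "c dvd m" using division_decomp[of d "p ^ k" m] by blast
    then obtain i where "i \<le> k" "b = p ^ i" using divides_primepow_nat[OF p] by blast
    then show "d \<in> (\<lambda>(i, d). p ^ i * d) ` ({..k} \<times> {d. d dvd m})" using bc by force
  next
    fix d assume "d \<in> (\<lambda>(i, d). p ^ i * d) ` ({..k} \<times> {d. d dvd m})"
    then show "d \<in> {d. d dvd p ^ k * m}" by (auto intro!: mult_dvd_mono le_imp_power_dvd)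
  qed
  have "rep (p ^ k * m) = (\<Sum>(i, d)\<in>{..k} \<times> {d. d dvd m}. \<phi> (p ^ i * d))"
    unfolding rep_def img sum.reindex[OF inj] by (simp add: case_prod_unfold comp_def)
  also have "\<dots> = (\<Sum>(i, d)\<in>{..k} \<times> {d. d dvd m}. \<phi> p ^ i * \<phi> d)"
  proof (rule sum.cong[OF refl], clarify)
    fix i d assume "d dvd m"
    then have "d > 0" using m(2) dvd_pos_nat by blast
    then show "\<phi> (p ^ i * d) = \<phi> p ^ i * \<phi> d" using p0 by (simp add: mult pow)
  qed
  also have "\<dots> = (\<Sum>i\<le>k. \<phi> p ^ i) * rep m"
    unfolding rep_def sum_product by (rule sum.cartesian_product[symmetric])
  finally show ?thesis .
qed

lemma sum_powers: "0 \<le> (\<Sum>i\<le>k. \<phi> n ^ i)" "even k \<Longrightarrow> 1 \<le> (\<Sum>i\<le>k. \<phi> n ^ i)"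
proof -
  have m1: "(\<Sum>i\<le>k. (-1) ^ i) = (if even k then 1 else (0 :: real))" by (induction k) auto
  have z: "(\<Sum>i\<le>k. 0 ^ i) = (1 :: real)" by (induction k) auto
  show "0 \<le> (\<Sum>i\<le>k. \<phi> n ^ i)" "even k \<Longrightarrow> 1 \<le> (\<Sum>i\<le>k. \<phi> n ^ i)"
    using range[of n] m1 z by auto
qed

lemma rep_1: "rep (Suc 0) = 1"
  by (simp add: rep_def one)

lemma prime_power_decomp:
  assumes "n > (1::nat)"
  obtains p k m where "prime p" "k > 0" "\<not> p dvd m" "m > 0" "m < n" "n = p ^ k * m"
proof -
  obtain p where p: "prime p" "p dvd n" using prime_factor_nat[of n] assms by auto
  have "n \<noteq> 0" "\<not> is_unit p" using assms p by auto
  then obtain m where m: "n = p ^ multiplicity p n * m" "\<not> p dvd m" using multiplicity_decompose'[of n p] by blast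
  define k where "k = multiplicity p n"
  have k: "n = p ^ k * m" using m(1) by (simp add: k_def)
  have "k > 0"
  proof (rule ccontr)
    assume "\<not> k > 0" then have "n = m" using k by simp
    then show False using m(2) p by simp
  qed
  have "m > 0" using k assms by (cases m) auto
  have "p ^ k > 1" by (rule one_less_power[OF prime_gt_1_nat[OF p(1)] \<open>k > 0\<close>])
  then have "1 * m < p ^ k * m" using \<open>m > 0\<close> by (intro mult_strict_right_mono) auto
  then have "m < n" using k by simp
  then show ?thesis using that[OF p(1) \<open>k > 0\<close> m(2) \<open>m > 0\<close> _ k] by simp
qed

lemma rep_nonneg: "n > 0 \<Longrightarrow> rep n \<ge> 0"
proof (induction n rule: less_induct)
  case (less n)
  show ?case
  proof (cases "n = 1")
    case False
    then have "n > 1" using less.prems by simp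
    then obtain p k m where pk: "prime p" "k > 0" "\<not> p dvd m" "m > 0" "m < n" "n = p ^ k * m"
      by (rule prime_power_decomp)
    then show ?thesis
      unfolding pk(6) rep_prime_power_mult[OF pk(1,3,4)] using less.IH[OF pk(5,4)] sum_powers(1) by simp
  qed (simp add: rep_1)
qed

text \<open>In a square every prime has an even exponent, and
  \<open>\<Sum>i\<le>2*k. \<phi> p ^ i\<close> is at least 1 even when \<open>\<phi> p = -1\<close>,
  because the alternating sum ends on a positive term.\<close>

lemma rep_square: "n > 0 \<Longrightarrow> rep (n\<^sup>2) \<ge> 1"
proof (induction n rule: less_induct)
  case (less n)
  show ?case
  proof (cases "n = 1")
    case False
    then have "n > 1" using less.prems by simp
    then obtain p k m where pk: "prime p" "k > 0" "\<not> p dvd m" "m > 0" "m < n" "n = p ^ k * m"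
      by (rule prime_power_decomp)
    have eq: "n\<^sup>2 = p ^ (2 * k) * m\<^sup>2" by (simp add: pk(6) power_mult_distrib power_even_eq)
    have "\<not> p dvd m\<^sup>2" using pk(3) prime_dvd_power[OF pk(1), of m 2] by blast
    moreover have "m\<^sup>2 > 0" using pk(4) by simp
    ultimately have "rep (n\<^sup>2) = (\<Sum>i\<le>2 * k. \<phi> p ^ i) * rep (m\<^sup>2)"
      unfolding eq by (rule rep_prime_power_mult[OF pk(1)])
    moreover have "1 * 1 \<le> (\<Sum>i\<le>2 * k. \<phi> p ^ i) * rep (m\<^sup>2)"
      using less.IH[OF pk(5,4)] sum_powers(2)[of "2 * k" p] by (intro mult_mono) auto
    ultimately show ?thesis by simp
  qed (simp add: rep_1)
qed

text \<open>Truncating the double series at \<open>d * e \<le> N\<close> drops, for each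
  \<open>d\<close>, a geometric tail of size at most \<open>t^N / (1 - t)\<close>. There are
  \<open>N\<close> such tails, and the total still tends to 0.\<close>

lemma lambert_partial_sum:
  fixes t :: real
  assumes t: "0 < t" "t < 1"
  shows "\<bar>(\<Sum>n=1..N. rep n * t ^ n) - (\<Sum>d=1..N. \<phi> d * (t ^ d / (1 - t ^ d)))\<bar> \<le> real N * t ^ N / (1 - t)"
proof -
  have td: "1 - t \<le> 1 - t ^ d" if "d \<ge> 1" for d
    using power_decreasing[of 1 d t] t that by simp
  have "(\<Sum>n=1..N. rep n * t ^ n) = (\<Sum>n=1..N. \<Sum>d | d dvd n. \<phi> d * t ^ (d * (n div d)))"
    unfolding rep_def by (intro sum.cong) (auto simp: sum_distrib_right)
  also have "\<dots> = (\<Sum>d=1..N. \<Sum>e=1..N div d. \<phi> d * t ^ (d * e))" by (rule sum_divisors_swap)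
  also have "\<dots> = (\<Sum>d=1..N. \<phi> d * ((t ^ d - t ^ (d * Suc (N div d))) / (1 - t ^ d)))"
  proof (rule sum.cong[OF refl])
    fix d assume "d \<in> {1..N}"
    then have d: "1 - t ^ d > 0" using td[of d] t by simp
    have "(\<Sum>e=1..M. t ^ (d * e)) = (t ^ d - t ^ (d * Suc M)) / (1 - t ^ d)" for M
    proof -
      have "(1 - x) * (\<Sum>e=1..M. x ^ e) = x - x ^ Suc M" for x :: real
      proof (induction M)
        case (Suc M)
        have "(1 - x) * (\<Sum>e=1..Suc M. x ^ e) = (1 - x) * (\<Sum>e=1..M. x ^ e) + (1 - x) * x ^ Suc M"
          by (simp add: distrib_left)
        also have "\<dots> = x - x ^ Suc (Suc M)" unfolding Suc by (simp add: algebra_simps)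
        finally show ?case .
      qed simp
      from this[of "t ^ d"] show ?thesis
        unfolding power_mult using d by (simp add: eq_divide_eq mult.commute)
    qed
    then show "(\<Sum>e=1..N div d. \<phi> d * t ^ (d * e)) = \<phi> d * ((t ^ d - t ^ (d * Suc (N div d))) / (1 - t ^ d))"
      by (simp flip: sum_distrib_left)
  qed
  finally have eq: "(\<Sum>n=1..N. rep n * t ^ n) = (\<Sum>d=1..N. \<phi> d * ((t ^ d - t ^ (d * Suc (N div d))) / (1 - t ^ d)))" .
  have "(\<Sum>n=1..N. rep n * t ^ n) - (\<Sum>d=1..N. \<phi> d * (t ^ d / (1 - t ^ d)))
      = (\<Sum>d=1..N. - (\<phi> d * (t ^ (d * Suc (N div d)) / (1 - t ^ d))))"
    unfolding eq sum_subtractf[symmetric] by (intro sum.cong refl) (simp add: diff_divide_distrib right_diff_distrib)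
  also have "\<bar>\<dots>\<bar> \<le> (\<Sum>d=1..N. \<bar>- (\<phi> d * (t ^ (d * Suc (N div d)) / (1 - t ^ d)))\<bar>)" by (rule sum_abs)
  also have "\<dots> \<le> (\<Sum>d=1..N. t ^ N / (1 - t))"
  proof (rule sum_mono)
    fix d assume d: "d \<in> {1..N}"
    have "N \<le> d * Suc (N div d)" using d dividend_less_times_div[of d N] by simp
    then have "t ^ (d * Suc (N div d)) \<le> t ^ N" using t by (intro power_decreasing) auto
    then have "\<bar>\<phi> d\<bar> * (t ^ (d * Suc (N div d)) / (1 - t ^ d)) \<le> 1 * (t ^ N / (1 - t))"
      using t td[of d] d by (intro mult_mono frac_le abs_le_1) (auto intro!: divide_nonneg_nonneg)
    moreover have "1 - t ^ d > 0" using td[of d] t d by simp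
    ultimately show "\<bar>- (\<phi> d * (t ^ (d * Suc (N div d)) / (1 - t ^ d)))\<bar> \<le> t ^ N / (1 - t)"
      using t by (simp add: abs_mult)
  qed
  also have "\<dots> = real N * t ^ N / (1 - t)" by simp
  finally show ?thesis .
qed

text \<open>If \<open>L1\<close> vanished, the Lambert series \<open>\<Sum> \<phi> n t\<^sup>n / (1 - t\<^sup>n) = \<Sum> rep n t\<^sup>n\<close> would stay bounded
  as \<open>t\<close> tends to \<open>1\<close>, although \<open>rep\<close> is at least \<open>1\<close> at the squares.\<close>

lemma L1_nonzero: "L1 \<noteq> 0"
proof
  assume L0: "L1 = 0"
  have upper: "(\<Sum>k=1..K. (x\<^sup>2) ^ (k\<^sup>2)) \<le> B" if x: "0 < x" "x < 1" for x :: real and K :: nat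
  proof -
    define t where "t = x\<^sup>2"
    have t: "0 < t" "t < 1" using x by (auto simp: t_def power_less_one_iff)
    \<comment> \<open>The weight \<open>t^n / (1 - t^n)\<close> is replaced by its difference from
      \<open>1 / (n * (1 - t))\<close>, which decreases to 0; the subtracted part sums to a multiple
      of \<open>L1\<close>, assumed zero. As \<open>b 1 = 1\<close>, the resulting bound
      \<open>B\<close> is independent of \<open>t\<close>.\<close>
    define b where "b n = 1 / (real n * (1 - t)) - t ^ n / (1 - t ^ n)" for n
    have tn: "(\<lambda>n. t ^ n) \<longlonglongrightarrow> 0" using t by (intro LIMSEQ_realpow_zero) auto
    have "b \<longlonglongrightarrow> 0 * (1 / (1 - t)) - 0 / (1 - 0)"
    proof -
      have "b = (\<lambda>n. 1 / real n * (1 / (1 - t)) - t ^ n / (1 - t ^ n))" by (simp add: b_def fun_eq_iff)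
      moreover have "(\<lambda>n. 1 / real n * (1 / (1 - t)) - t ^ n / (1 - t ^ n)) \<longlonglongrightarrow> 0 * (1 / (1 - t)) - 0 / (1 - 0)"
        by (intro tendsto_intros tn lim_1_over_n) auto
      ultimately show ?thesis by simp
    qed
    then have blim: "b \<longlonglongrightarrow> 0" by simp
    have bdec: "b (Suc n) \<le> b n" if "n \<ge> 1" for n
      unfolding b_def t_def by (rule lambert_weight_antimono[OF x that])
    have sb: "summable (\<lambda>n. \<phi> n * b n)" by (rule summable_mult_antimono[where K = 1, OF bdec blim bounded])
    have "\<bar>(\<Sum>n. \<phi> n * b n) - (\<Sum>n<1. \<phi> n * b n)\<bar> \<le> B * b 1"
      by (rule abs_suminf_mult_antimono_le[where K = 1, OF bdec blim bounded]) auto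
    moreover have "b 1 = 1" using t by (simp add: b_def diff_divide_distrib[symmetric])
    \<comment> \<open>Both summands are 0 here through division by zero.\<close>
    moreover have "b 0 = 0" by (simp add: b_def)
    ultimately have b: "\<bar>\<Sum>n. \<phi> n * b n\<bar> \<le> B" by simp
    define F where "F n = \<phi> n * (t ^ n / (1 - t ^ n))" for n
    have Feq: "F n = \<phi> n * (1 / real n) * (1 / (1 - t)) - \<phi> n * b n" for n
      by (simp add: F_def b_def algebra_simps)
    have "(\<lambda>n. \<phi> n * (1 / real n) * (1 / (1 - t))) sums (L1 * (1 / (1 - t)))"
      unfolding L1_def by (intro sums_mult2 summable_sums summable_L1)
    from sums_diff[OF this summable_sums[OF sb]]
    have F: "F sums (L1 * (1 / (1 - t)) - (\<Sum>n. \<phi> n * b n))" unfolding Feq[symmetric] .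
    then have sF: "summable F" by (rule sums_summable)
    have "suminf F = L1 * (1 / (1 - t)) - (\<Sum>n. \<phi> n * b n)"
      using sums_unique[OF F] by simp
    then have "suminf F \<le> B" using L0 b by (simp add: abs_le_iff)
    moreover have "(\<Sum>k=1..K. t ^ (k\<^sup>2)) \<le> suminf F"
    proof (rule LIMSEQ_le_const)
      have "(\<lambda>N. \<Sum>n<Suc N. F n) \<longlonglongrightarrow> suminf F" using summable_LIMSEQ[OF sF] by (rule LIMSEQ_Suc)
      moreover have "(\<lambda>N. real N * t ^ N / (1 - t)) \<longlonglongrightarrow> 0 / (1 - t)"
        using t by (intro tendsto_divide tendsto_const powser_times_n_limit_0) auto
      ultimately show "(\<lambda>N. (\<Sum>n<Suc N. F n) + real N * t ^ N / (1 - t)) \<longlonglongrightarrow> suminf F"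
        using tendsto_add by fastforce
      have "(\<Sum>k=1..K. t ^ (k\<^sup>2)) \<le> (\<Sum>n<Suc N. F n) + real N * t ^ N / (1 - t)" if N: "N \<ge> K\<^sup>2" for N
      proof -
        have "(\<Sum>k=1..K. t ^ (k\<^sup>2)) \<le> (\<Sum>k=1..K. rep (k\<^sup>2) * t ^ (k\<^sup>2))"
        proof (rule sum_mono)
          fix k assume "k \<in> {1..K}"
          then have "1 * t ^ (k\<^sup>2) \<le> rep (k\<^sup>2) * t ^ (k\<^sup>2)" using t by (intro mult_right_mono rep_square) auto
          then show "t ^ (k\<^sup>2) \<le> rep (k\<^sup>2) * t ^ (k\<^sup>2)" by simp
        qed
        also have "\<dots> = (\<Sum>n\<in>(\<lambda>k. k\<^sup>2) ` {1..K}. rep n * t ^ n)"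
          by (subst sum.reindex) (auto simp: inj_on_def power2_eq_iff)
        also have "\<dots> \<le> (\<Sum>n=1..N. rep n * t ^ n)"
        proof (rule sum_mono2)
          show "(\<lambda>k. k\<^sup>2) ` {1..K} \<subseteq> {1..N}"
            using N by (auto intro: order_trans[OF power_mono])
        qed (use t in \<open>auto intro!: mult_nonneg_nonneg rep_nonneg\<close>)
        also have "\<dots> \<le> (\<Sum>d=1..N. F d) + real N * t ^ N / (1 - t)"
          using lambert_partial_sum[OF t, of N] unfolding F_def by linarith
        also have "(\<Sum>d=1..N. F d) = (\<Sum>n<Suc N. F n)"
          by (rule sum.mono_neutral_cong_left) (auto simp: F_def Suc_le_eq)
        finally show ?thesis .
      qed
      then show "\<exists>M. \<forall>N\<ge>M. (\<Sum>k=1..K. t ^ (k\<^sup>2)) \<le> (\<Sum>n<Suc N. F n) + real N * t ^ N / (1 - t)" by blast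
    qed
    ultimately show ?thesis unfolding t_def by linarith
  qed
  obtain K :: nat where K: "real K > B" using reals_Archimedean2[of B] by auto
  \<comment> \<open>Now \<open>x\<close> tends to 1 with \<open>K\<close> fixed, and each of the
    \<open>K\<close> terms tends to 1. The shift by 2 keeps \<open>x\<close> strictly between 0 and
    1.\<close>
  have "(\<lambda>j. 1 / real (j + 2)) \<longlonglongrightarrow> 0"
    by (rule LIMSEQ_ignore_initial_segment[where f = "\<lambda>n. 1 / real n" and k = 2, OF lim_1_over_n])
  then have "(\<lambda>j. 1 - 1 / real (j + 2)) \<longlonglongrightarrow> 1 - 0"
    by (rule tendsto_diff[OF tendsto_const])
  from tendsto_sum[OF tendsto_power[OF tendsto_power[OF this]]]
  have "(\<lambda>j. \<Sum>k=1..K. ((1 - 1 / real (j + 2))\<^sup>2) ^ (k\<^sup>2)) \<longlonglongrightarrow> (\<Sum>k=1..K. ((1 - 0)\<^sup>2) ^ (k\<^sup>2))" .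
  then have lim: "(\<lambda>j. \<Sum>k=1..K. ((1 - 1 / real (j + 2))\<^sup>2) ^ (k\<^sup>2)) \<longlonglongrightarrow> real K" by simp
  have "real K \<le> B"
  proof (rule LIMSEQ_le_const2[OF lim], intro exI[of _ 0] allI impI)
    fix j :: nat
    show "(\<Sum>k=1..K. ((1 - 1 / real (j + 2))\<^sup>2) ^ (k\<^sup>2)) \<le> B" by (rule upper) auto
  qed
  then show False using K by simp
qed

end

section \<open>Euler products for s > 1 and at s = 1\<close>

context sign_character
begin

lemma summable_powr:
  assumes "s > 1"
  shows "summable (\<lambda>n. \<phi> (Suc n) * real (Suc n) powr (-s))"
    and "summable (\<lambda>n. \<bar>\<phi> (Suc n) * real (Suc n) powr (-s)\<bar>)"
proof -
  have "summable (\<lambda>n. real n powr (-s))" using assms by (simp add: summable_real_powr_iff)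
  then have "summable (\<lambda>n. real (Suc n) powr (-s))" by (subst summable_Suc_iff)
  then show abs: "summable (\<lambda>n. \<bar>\<phi> (Suc n) * real (Suc n) powr (-s)\<bar>)"
  proof (rule summable_comparison_test'[where N = 0])
    fix n
    have "\<bar>\<phi> (Suc n)\<bar> * real (Suc n) powr (-s) \<le> 1 * real (Suc n) powr (-s)"
      by (intro mult_right_mono abs_le_1) auto
    then show "norm \<bar>\<phi> (Suc n) * real (Suc n) powr (-s)\<bar> \<le> real (Suc n) powr (-s)"
      by (simp add: abs_mult)
  qed
  then show "summable (\<lambda>n. \<phi> (Suc n) * real (Suc n) powr (-s))" by (rule summable_rabs_cancel)
qed

lemma euler_product_powr:
  assumes "s > 1"
  shows "(\<lambda>N. (\<Prod>p | prime p \<and> p \<le> N. 1 - \<phi> p * real p powr (-s)) * (\<Sum>n. \<phi> (Suc n) * real (Suc n) powr (-s))) \<longlonglongrightarrow> 1"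
  by (rule euler_product_tendsto[of "\<lambda>n. \<phi> n * real n powr (-s)"])
     (use summable_powr(2)[OF assms] in \<open>simp_all add: mult one powr_mult mult_ac\<close>)

text \<open>The bound 1/2 keeps every Euler factor positive and lies in the range of the quadratic
  estimate for \<open>ln (1 + x) - x\<close>.\<close>

lemma abs_chi_powr_le:
  assumes "s \<ge> 1" "n \<ge> 2"
  shows "\<bar>\<phi> n * real n powr (-s)\<bar> \<le> 1 / 2"
proof -
  have "real n powr (-s) \<le> real n powr (-1)" using assms by (intro powr_mono) auto
  also have "\<dots> \<le> 1 / 2" using assms by (simp add: powr_minus field_simps)
  finally have "\<bar>\<phi> n\<bar> * real n powr (-s) \<le> 1 * (1 / 2)" by (intro mult_mono abs_le_1) auto
  then show ?thesis by (simp add: abs_mult)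
qed

end

context bounded_character
begin

text \<open>The logarithm of the Euler product is continuous on \<open>[1, 2]\<close>: its main part is a Dirichlet
  series converging at \<open>1\<close>, and the rest converges uniformly.\<close>

lemma euler_product_at_1: "\<exists>l>0. (\<lambda>N. \<Prod>p | prime p \<and> p \<le> N. 1 - \<phi> p * real p powr (-1)) \<longlonglongrightarrow> l \<and> l * L1 = 1"
proof -
  define c where "c n = (if prime n then \<phi> n / real n else 0)" for n
  define R where "R n s = (if prime n then ln (1 - \<phi> n * real n powr (-s)) + \<phi> n * real n powr (-s) else 0)"
    for n and s :: real
  have sc: "summable c" unfolding c_def by (rule summable_chi_primes[OF L1_nonzero])
  have c0: "c 0 = 0" by (simp add: c_def)
  have cpow: "c n * real n powr (1 - s) = (if prime n then \<phi> n * real n powr (-s) else 0)" for n s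
    using prime_gt_0_nat[of n] by (auto simp: c_def powr_diff powr_minus field_simps)
  have sM: "summable (\<lambda>n. 2 * real n powr (-2))" by (intro summable_mult) (simp add: summable_real_powr_iff)
  have R_le: "norm (R n s) \<le> 2 * real n powr (-2)" if "s \<in> {1..2}" for n s
  proof (cases "prime n")
    case True
    then have n: "n \<ge> 2" by (rule prime_ge_2_nat)
    let ?x = "- (\<phi> n * real n powr (-s))"
    have "\<bar>ln (1 + ?x) - ?x\<bar> \<le> 2 * ?x\<^sup>2"
      by (rule abs_ln_one_plus_x_minus_x_bound) (use abs_chi_powr_le[of s n] n that in simp)
    also have "?x\<^sup>2 = \<bar>\<phi> n\<bar>\<^sup>2 * (real n powr (-s))\<^sup>2" by (simp add: power_mult_distrib)
    also have "\<dots> \<le> 1\<^sup>2 * (real n powr (-1))\<^sup>2"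
      using that n by (intro mult_mono power_mono abs_le_1 powr_mono) auto
    also have "(real n powr (-1))\<^sup>2 = real n powr (-2)" using n by (simp add: powr_minus power2_eq_square field_simps)
    finally show ?thesis using True by (simp add: R_def)
  qed (simp add: R_def)
  have ulR: "uniform_limit {1..2} (\<lambda>N s. \<Sum>n<N. R n s) (\<lambda>s. \<Sum>n. R n s) sequentially"
    by (rule Weierstrass_m_test[OF _ sM]) (rule R_le)
  have Rcont: "continuous_on {1..2} (R n)" for n
  proof (cases "prime n")
    case True
    then have n: "n \<ge> 2" by (rule prime_ge_2_nat)
    have "1 - \<phi> n * real n powr (-s) \<noteq> 0" if "s \<in> {1..2}" for s
      using abs_chi_powr_le[of s n] n that by auto
    then show ?thesis unfolding R_def using True n by (auto intro!: continuous_intros)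
  qed (simp add: R_def)
  have contR: "continuous_on {1..2} (\<lambda>s. \<Sum>n. R n s)"
    by (rule uniform_limit_theorem[OF _ ulR]) (auto intro!: continuous_on_sum Rcont always_eventually)
  \<comment> \<open>This is the sum of \<open>ln (1 - \<phi> p * p powr (-s))\<close> over the
    primes: \<open>R\<close> is the second-order remainder, the subtracted series the linear
    part.\<close>
  define G where "G s = (\<Sum>n. R n s) - (\<Sum>n. c n * real n powr (1 - s))" for s
  have contG: "continuous_on {1..2} G"
    unfolding G_def by (intro continuous_on_diff contR continuous_on_dirichlet sc c0)
  have prodG: "(\<lambda>N. \<Prod>p | prime p \<and> p \<le> N. 1 - \<phi> p * real p powr (-s)) \<longlonglongrightarrow> exp (G s)" if s: "s \<in> {1..2}" for s
  proof -
    have "(\<lambda>N. (\<Sum>n<N. R n s) - (\<Sum>n<N. c n * real n powr (1 - s))) \<longlonglongrightarrow> G s"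
      unfolding G_def
      by (intro tendsto_diff tendsto_uniform_limitI[OF ulR s] summable_LIMSEQ summable_dirichlet[OF sc c0 s])
    then have "(\<lambda>N. exp (\<Sum>n<Suc N. R n s - c n * real n powr (1 - s))) \<longlonglongrightarrow> exp (G s)"
      by (intro tendsto_exp LIMSEQ_Suc) (simp add: sum_subtractf)
    moreover have "exp (\<Sum>n<Suc N. R n s - c n * real n powr (1 - s)) = (\<Prod>p | prime p \<and> p \<le> N. 1 - \<phi> p * real p powr (-s))" for N
    proof -
      have pos: "1 - \<phi> n * real n powr (-s) > 0" if "prime n" for n
        using abs_chi_powr_le[of s n] prime_ge_2_nat[OF that] s by auto
      have "exp (R n s - c n * real n powr (1 - s)) = (if prime n then 1 - \<phi> n * real n powr (-s) else 1)" for n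
        unfolding cpow R_def using pos[of n] by simp
      then have "exp (\<Sum>n<Suc N. R n s - c n * real n powr (1 - s)) = (\<Prod>n<Suc N. if prime n then 1 - \<phi> n * real n powr (-s) else 1)"
        by (subst exp_sum) (simp_all del: prod.lessThan_Suc)
      also have "\<dots> = (\<Prod>p | prime p \<and> p \<le> N. 1 - \<phi> p * real p powr (-s))"
        by (rule prod.mono_neutral_cong_right) auto
      finally show ?thesis .
    qed
    ultimately show ?thesis by simp
  qed
  define Ls where "Ls s = (\<Sum>n. \<phi> n * (1 / real n) * real n powr (1 - s))" for s
  have contL: "continuous_on {1..2} Ls"
    unfolding Ls_def by (rule continuous_on_dirichlet[OF summable_L1]) simp
  have Ls1: "Ls 1 = L1" unfolding Ls_def L1_def by (intro suminf_cong) auto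
  have gt1: "exp (G s) * Ls s = 1" if s: "s \<in> {1<..2}" for s
  proof -
    have "Ls s = (\<Sum>n. \<phi> n * real n powr (-s))"
      unfolding Ls_def
    proof (rule suminf_cong)
      fix n show "\<phi> n * (1 / real n) * real n powr (1 - s) = \<phi> n * real n powr (-s)"
        by (cases "n = 0") (auto simp: powr_diff powr_minus field_simps)
    qed
    also have "\<dots> = (\<Sum>n. \<phi> (Suc n) * real (Suc n) powr (-s))"
    proof -
      have "summable (\<lambda>n. \<phi> n * (1 / real n) * real n powr (1 - s))"
        using summable_dirichlet[OF summable_L1, of s] s by simp
      moreover have "\<phi> n * (1 / real n) * real n powr (1 - s) = \<phi> n * real n powr (-s)" for n
        by (cases "n = 0") (auto simp: powr_diff powr_minus field_simps)
      ultimately have "summable (\<lambda>n. \<phi> n * real n powr (-s))" by simp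
      from suminf_split_head[OF this] show ?thesis by simp
    qed
    finally have Ls: "Ls s = (\<Sum>n. \<phi> (Suc n) * real (Suc n) powr (-s))" .
    have "(\<lambda>N. (\<Prod>p | prime p \<and> p \<le> N. 1 - \<phi> p * real p powr (-s)) * Ls s) \<longlonglongrightarrow> exp (G s) * Ls s"
      using s by (intro tendsto_mult_right prodG) auto
    moreover have "(\<lambda>N. (\<Prod>p | prime p \<and> p \<le> N. 1 - \<phi> p * real p powr (-s)) * Ls s) \<longlonglongrightarrow> 1"
      unfolding Ls using s by (intro euler_product_powr) auto
    ultimately show ?thesis by (rule LIMSEQ_unique)
  qed
  \<comment> \<open>The identity \<open>exp (G s) * Ls s = 1\<close> is known for
    \<open>s > 1\<close> by absolute convergence and passes to \<open>s = 1\<close> by continuity of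
    both factors.\<close>
  have "(\<lambda>j. 1 + 1 / real (Suc j)) \<longlonglongrightarrow> 1 + 0"
    by (rule tendsto_add[OF tendsto_const LIMSEQ_Suc[OF lim_1_over_n]])
  then have lim: "(\<lambda>j. 1 + 1 / real (Suc j)) \<longlonglongrightarrow> 1" by simp
  have "(\<lambda>j. exp (G (1 + 1 / real (Suc j))) * Ls (1 + 1 / real (Suc j))) \<longlonglongrightarrow> exp (G 1) * Ls 1"
    by (rule continuous_on_tendsto_compose[OF continuous_on_mult[OF continuous_on_exp[OF contG] contL] lim])
       (auto intro!: always_eventually simp: divide_le_eq)
  moreover have "exp (G (1 + 1 / real (Suc j))) * Ls (1 + 1 / real (Suc j)) = 1" for j
    by (rule gt1) (auto simp: divide_le_eq)
  ultimately have "exp (G 1) * Ls 1 = 1" by (simp add: LIMSEQ_const_iff)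
  then show ?thesis using prodG[of 1] Ls1 by (intro exI[of _ "exp (G 1)"]) simp
qed

end

text \<open>Truncating the sieve at \<open>x = N\<close> leaves only the number 1, so the product is
  at most the reciprocal of a harmonic number.\<close>

lemma prod_one_minus_inverse_primes_tendsto_0:
  "(\<lambda>N. \<Prod>p | prime p \<and> p \<le> N. 1 - 1 / real p) \<longlonglongrightarrow> 0"
proof (rule tendsto_sandwich[OF _ _ tendsto_const])
  let ?P = "\<lambda>N. \<Prod>p | prime p \<and> p \<le> N. 1 - 1 / real p"
  show "eventually (\<lambda>N. 0 \<le> ?P N) sequentially"
  proof (intro always_eventually allI prod_nonneg)
    fix N p :: nat assume "p \<in> {p. prime p \<and> p \<le> N}"
    then show "0 \<le> 1 - 1 / real p" using prime_ge_1_nat[of p] by simp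
  qed
  have "?P N \<le> 1 / harm N" if "N \<ge> 1" for N
  proof -
    have "?P N * (\<Sum>n=1..N. 1 / real n) \<le> (\<Sum>n\<in>sieved N \<inter> {..N}. 1 / real n)"
      by (rule prod_one_minus_inverse_primes_le)
    also have "sieved N \<inter> {..N} \<subseteq> {1}"
    proof
      fix n assume n: "n \<in> sieved N \<inter> {..N}"
      show "n \<in> {1}"
      proof (rule ccontr)
        assume "n \<notin> {1}"
        then obtain p where p: "prime p" "p dvd n" using prime_factor_nat[of n] by auto
        then have "p > N" "p \<le> n" using n by (auto simp: sieved_def dest: dvd_imp_le)
        then show False using n by simp
      qed
    qed
    then have "(\<Sum>n\<in>sieved N \<inter> {..N}. 1 / real n) \<le> (\<Sum>n\<in>{1}. 1 / real n)" by (intro sum_mono2) auto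
    finally have "?P N * harm N \<le> 1" by (simp add: harm_def inverse_eq_divide)
    moreover have "harm N > (0::real)" using that by (intro harm_pos) simp
    ultimately show ?thesis by (simp add: pos_le_divide_eq)
  qed
  then show "eventually (\<lambda>N. ?P N \<le> 1 / harm N) sequentially"
    by (rule eventually_sequentiallyI)
  show "(\<lambda>N. 1 / harm N :: real) \<longlonglongrightarrow> 0"
    by (intro tendsto_divide_0[OF tendsto_const] filterlim_at_top_imp_at_infinity harm_at_top)
qed

section \<open>The local density as an Euler product\<close>

lemma diag_det_eq_prod: "diag_det m a = (\<Prod>i<m. a i)"
proof -
  have "upper_triangular (mat_diag m a)" by (auto simp: mat_diag_def)
  then have "Determinant.det (mat_diag m a) = prod_list (diag_mat (mat_diag m a))"
    by (rule det_upper_triangular) (rule mat_diag_dim)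
  also have "\<dots> = (\<Prod>i = 0..<m. a i)"
    unfolding prod_list_diag_prod by (simp add: mat_diag_def)
  finally show ?thesis by (simp add: diag_det_def atLeast0LessThan)
qed

lemma kronecker_prime_eq_0_iff:
  assumes "prime p"
  shows "kronecker D p = 0 \<longleftrightarrow> int p dvd D"
  using Legendre_eq_0_iff[of D "int p"] by (auto simp: kronecker_prime[OF assms] kronecker_prime_def)

lemma kronecker_1_left: "n > 0 \<Longrightarrow> kronecker 1 n = 1"
proof (induction n rule: prime_divisors_induct)
  case (factor p x)
  then have "x > 0" "p > 0" by (auto intro: Nat.gr0I)
  then show ?case using factor Legendre_1[of p]
    by (simp add: kronecker_mult kronecker_prime kronecker_prime_def)
qed (auto simp: kronecker_1)

text \<open>At an odd prime not dividing \<open>c\<close>, neither \<open>c^2\<close> nor the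
  possible factor 4 of the discriminant changes the symbol.\<close>

lemma Legendre_square_mult_eq_kronecker:
  assumes p: "prime p" "p > 2" and "\<not> int p dvd c"
  shows "Legendre (c\<^sup>2 * u) (int p) = kronecker (quad_disc u) p"
proof -
  have "\<not> int p dvd 2" using p(2) by (auto dest: zdvd_imp_le)
  then have "Legendre (2\<^sup>2) (int p) = 1" by (rule Legendre_square[OF p])
  then have "Legendre (quad_disc u) (int p) = Legendre u (int p)"
    unfolding quad_disc_def using Legendre_mult[OF p, of "2\<^sup>2" u] by simp
  then show ?thesis
    using Legendre_mult[OF p, of "c\<^sup>2" u] Legendre_square[OF p assms(3)] p
    by (simp add: kronecker_prime kronecker_prime_def)
qed

lemma sign_character_kronecker: "sign_character (\<lambda>n. real_of_int (kronecker D n))"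
proof
  fix n show "real_of_int (kronecker D n) \<in> {-1, 0, 1}" using kronecker_values[of D n] by auto
qed (simp_all add: kronecker_1 kronecker_mult)

lemma bounded_character_kronecker:
  assumes "squarefree u" "u \<noteq> 1"
  shows "\<exists>B. bounded_character (\<lambda>n. real_of_int (kronecker (quad_disc u) n)) B"
proof -
  let ?k = "kronecker (quad_disc u)"
  obtain C where C: "\<And>N. \<bar>\<Sum>n=1..N. ?k n\<bar> \<le> C" using bounded_sum_kronecker[OF assms] by blast
  have "\<bar>\<Sum>n=m..N. ?k n\<bar> \<le> 2 * C" if "m \<ge> 1" for m N
  proof (cases "m \<le> N")
    case True
    then have "(\<Sum>n=1..N. ?k n) = (\<Sum>n=1..m-1. ?k n) + (\<Sum>n=m..N. ?k n)"
      using that sum.ub_add_nat[of 1 "m - 1" ?k "N - (m - 1)"] by simp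
    then show ?thesis using C[of N] C[of "m - 1"] by linarith
  next
    case False
    then show ?thesis using C[of 0] by simp
  qed
  then have "\<bar>\<Sum>n=m..N. real_of_int (?k n)\<bar> \<le> real_of_int (2 * C)" if "m \<ge> 1" for m N
    using that unfolding of_int_sum[symmetric] of_int_abs[symmetric] of_int_le_iff by blast
  then have "bounded_character (\<lambda>n. real_of_int (?k n)) (real_of_int (2 * C))"
    using sign_character_kronecker[of "quad_disc u"]
    by (simp add: bounded_character_def bounded_character_axioms_def)
  then show ?thesis by blast
qed

text \<open>The reciprocal partial Euler products; their limit is \<open>1 / L\<close>, which stays
  finite even at the pole.\<close>

abbreviation euler_factors :: "real \<Rightarrow> int \<Rightarrow> nat \<Rightarrow> real" where
  "euler_factors s D N \<equiv> \<Prod>p | prime p \<and> p \<le> N. 1 - real_of_int (kronecker D p) * real p powr (-s)"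

lemma kronecker_powr_le_half:
  assumes "prime p" "s \<ge> 1"
  shows "\<bar>real_of_int (kronecker D p) * real p powr (-s)\<bar> \<le> 1 / 2"
  using sign_character.abs_chi_powr_le[OF sign_character_kronecker assms(2) prime_ge_2_nat[OF assms(1)]] .

lemma euler_factors_pos: "s \<ge> 1 \<Longrightarrow> euler_factors s D N > 0"
proof (rule prod_pos)
  fix p assume "s \<ge> 1" "p \<in> {p. prime p \<and> p \<le> N}"
  then show "0 < 1 - real_of_int (kronecker D p) * real p powr (-s)"
    using kronecker_powr_le_half[of p s D] by (simp add: abs_le_iff)
qed

section \<open>Values of the L-series in the extended reals\<close>

lemma lim_ereal_sums:
  assumes "f sums l"
  shows "lim (\<lambda>N. ereal (\<Sum>n=1..N. f (n - 1))) = ereal l"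
proof (rule limI)
  have "(\<Sum>n=1..N. f (n - 1)) = (\<Sum>n<N. f n)" for N
    by (rule sum.reindex_bij_witness[of _ Suc "\<lambda>n. n - 1"]) auto
  then show "(\<lambda>N. ereal (\<Sum>n=1..N. f (n - 1))) \<longlonglongrightarrow> ereal l"
    using assms by (simp add: sums_def)
qed

lemma euler_product_imp_pos:
  fixes L :: real
  assumes "(\<lambda>N. P N * L) \<longlonglongrightarrow> 1" and "\<And>N. P N \<ge> 0"
  shows "L > 0" and "P \<longlonglongrightarrow> 1 / L"
proof -
  have "L \<noteq> 0" using assms(1) LIMSEQ_unique[OF tendsto_const] by fastforce
  from tendsto_divide[OF assms(1) tendsto_const this]
  show P: "P \<longlonglongrightarrow> 1 / L" using \<open>L \<noteq> 0\<close> by simp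
  have "1 / L \<ge> 0" using LIMSEQ_le_const[OF P] assms(2) by blast
  then show "L > 0" using \<open>L \<noteq> 0\<close> by simp
qed

lemma L_series_gt_1:
  assumes "s > 1"
  shows "\<exists>l>0. L_series s D = ereal (1 / l) \<and> euler_factors s D \<longlonglongrightarrow> l"
proof -
  interpret sign_character "\<lambda>n. real_of_int (kronecker D n)" by (rule sign_character_kronecker)
  let ?f = "\<lambda>n. real_of_int (kronecker D n) * real n powr (-s)"
  let ?L = "\<Sum>n. ?f (Suc n)"
  have "L_series s D = ereal ?L"
  proof -
    have "L_series s D = lim (\<lambda>N. ereal (\<Sum>n=1..N. ?f (Suc (n - 1))))"
      unfolding L_series_def by (intro arg_cong[of _ _ lim] ext arg_cong[of _ _ ereal] sum.cong) auto
    moreover have "(\<lambda>n. ?f (Suc n)) sums ?L" by (rule summable_sums[OF summable_powr(1)[OF assms]])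
    ultimately show ?thesis using lim_ereal_sums[of "\<lambda>n. ?f (Suc n)" ?L] by simp
  qed
  moreover have "?L > 0" "euler_factors s D \<longlonglongrightarrow> 1 / ?L"
    using euler_product_imp_pos[OF euler_product_powr[OF assms]] euler_factors_pos[of s D] assms
    by (simp_all add: less_imp_le)
  ultimately show ?thesis by (intro exI[of _ "1 / ?L"]) simp
qed

lemma zeta_real_euler_product:
  assumes "s > 1"
  shows "zeta_real s > 0" and "(\<lambda>N. \<Prod>p | prime p \<and> p \<le> N. 1 - real p powr (-s)) \<longlonglongrightarrow> 1 / zeta_real s"
proof -
  interpret sign_character "\<lambda>_. 1" by unfold_locales auto
  have "(\<Prod>p | prime p \<and> p \<le> N. 1 - real p powr (-s)) \<ge> 0" for N
  proof (rule prod_nonneg)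
    fix p :: nat assume "p \<in> {p. prime p \<and> p \<le> N}"
    then show "0 \<le> 1 - real p powr (-s)" using abs_chi_powr_le[of s p] prime_ge_2_nat[of p] assms by simp
  qed
  from euler_product_imp_pos[OF _ this, where L = "zeta_real s"]
  show "zeta_real s > 0" "(\<lambda>N. \<Prod>p | prime p \<and> p \<le> N. 1 - real p powr (-s)) \<longlonglongrightarrow> 1 / zeta_real s"
    using euler_product_powr[OF assms] by (simp_all add: zeta_real_def)
qed

lemma L_series_1:
  assumes "squarefree u" "u \<noteq> 1"
  shows "\<exists>l>0. L_series 1 (quad_disc u) = ereal (1 / l) \<and> euler_factors 1 (quad_disc u) \<longlonglongrightarrow> l"
proof -
  obtain B where "bounded_character (\<lambda>n. real_of_int (kronecker (quad_disc u) n)) B"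
    using bounded_character_kronecker[OF assms] by blast
  then interpret bounded_character "\<lambda>n. real_of_int (kronecker (quad_disc u) n)" B .
  let ?f = "\<lambda>n. real_of_int (kronecker (quad_disc u) n) * (1 / real n)"
  obtain l where l: "l > 0" "euler_factors 1 (quad_disc u) \<longlonglongrightarrow> l" "l * L1 = 1"
    using euler_product_at_1 by blast
  have "?f sums L1" unfolding L1_def by (rule summable_sums[OF summable_L1])
  then have "(\<lambda>n. ?f (Suc n)) sums L1" by (subst sums_Suc_iff) simp
  from lim_ereal_sums[OF this]
  have "lim (\<lambda>N. ereal (\<Sum>n=1..N. ?f (Suc (n - 1)))) = ereal L1" .
  moreover have "L_series 1 (quad_disc u) = lim (\<lambda>N. ereal (\<Sum>n=1..N. ?f (Suc (n - 1))))"
    unfolding L_series_def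
    by (intro arg_cong[of _ _ lim] ext arg_cong[of _ _ ereal] sum.cong) (auto simp: powr_minus inverse_eq_divide)
  moreover have "L1 = 1 / l" using l by (simp add: field_simps)
  ultimately show ?thesis using l by auto
qed

lemma L_series_1_1: "L_series 1 1 = \<infinity>" and euler_factors_1_1: "euler_factors 1 1 \<longlonglongrightarrow> 0"
proof -
  have "(\<Sum>n=1..N. real_of_int (kronecker 1 n) * real n powr (-1)) = harm N" for N
    unfolding harm_def by (intro sum.cong refl) (auto simp: kronecker_1_left powr_minus)
  moreover have "(\<lambda>N. ereal (harm N)) \<longlonglongrightarrow> \<infinity>" unfolding tendsto_PInfty_eq_at_top by (rule harm_at_top)
  ultimately show "L_series 1 1 = \<infinity>" unfolding L_series_def by (intro limI) simp
  have "euler_factors 1 1 N = (\<Prod>p | prime p \<and> p \<le> N. 1 - 1 / real p)" for N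
    by (intro prod.cong refl) (auto simp: kronecker_1_left prime_gt_0_nat powr_minus inverse_eq_divide)
  then show "euler_factors 1 1 \<longlonglongrightarrow> 0" using prod_one_minus_inverse_primes_tendsto_0 by simp
qed

text \<open>The pole at \<open>s = 1\<close>, \<open>u = 1\<close> is the only exception. There the
  infinite value alone does not give the limit of the density; one also needs that the Euler factors
  tend to 0.\<close>

lemma L_series_cases:
  assumes "squarefree u" "s \<ge> 1"
  obtains l where "l > 0" "L_series s (quad_disc u) = ereal (1 / l)" "euler_factors s (quad_disc u) \<longlonglongrightarrow> l"
    | "s = 1" "quad_disc u = 1" "L_series s (quad_disc u) = \<infinity>" "euler_factors s (quad_disc u) \<longlonglongrightarrow> 0"
proof (cases "s = 1 \<and> u = 1")
  case True
  then have "quad_disc u = 1" by (simp add: quad_disc_def)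
  then show ?thesis using that(2) True L_series_1_1 euler_factors_1_1 by simp
next
  case False
  then have "\<exists>l>0. L_series s (quad_disc u) = ereal (1 / l) \<and> euler_factors s (quad_disc u) \<longlonglongrightarrow> l"
    using L_series_gt_1[of s "quad_disc u"] L_series_1[OF assms(1)] assms(2) by (cases "s = 1") auto
  then show ?thesis using that(1) by blast
qed

section \<open>Comparison of the density with Euler products\<close>

lemma prod_primes_split:
  fixes f g :: "nat \<Rightarrow> real"
  assumes "finite S" "\<And>p. p \<in> S \<Longrightarrow> prime p" "\<And>p. p \<in> S \<Longrightarrow> g p \<noteq> 0"
    and "\<And>p. prime p \<Longrightarrow> p \<notin> S \<Longrightarrow> f p = g p"
  shows "eventually (\<lambda>N. (\<Prod>p | prime p \<and> p \<le> N. f p) = (\<Prod>p\<in>S. f p / g p) * (\<Prod>p | prime p \<and> p \<le> N. g p)) sequentially"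
proof -
  obtain M where M: "\<And>p. p \<in> S \<Longrightarrow> p \<le> M" using assms(1) unfolding finite_nat_set_iff_bounded_le by blast
  show ?thesis
  proof (rule eventually_sequentiallyI[of M])
    fix N assume N: "M \<le> N"
    let ?P = "{p. prime p \<and> p \<le> N}"
    have sub: "S \<subseteq> ?P" by (auto intro: assms(2) order_trans[OF M N])
    have split: "prod h ?P = prod h (?P - S) * prod h S" for h :: "nat \<Rightarrow> real"
      by (rule prod.subset_diff[OF sub finite_primes_le])
    have "prod f (?P - S) = prod g (?P - S)" by (rule prod.cong) (auto simp: assms(4))
    moreover have "prod f S = (\<Prod>p\<in>S. f p / g p) * prod g S"
      unfolding prod.distrib[symmetric] by (rule prod.cong) (auto simp: assms(3))
    ultimately show "prod f ?P = (\<Prod>p\<in>S. f p / g p) * prod g ?P" unfolding split by simp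
  qed
qed

lemma finite_prime_divisors_int: "n \<noteq> 0 \<Longrightarrow> finite {p::nat. prime p \<and> int p dvd n}"
proof (rule finite_subset[of _ "{..nat \<bar>n\<bar>}"])
  assume "n \<noteq> 0"
  then show "{p::nat. prime p \<and> int p dvd n} \<subseteq> {..nat \<bar>n\<bar>}"
    by (auto dest!: dvd_imp_le_int)
qed simp

lemma partial_density_tendsto_even:
  fixes m :: nat and a :: "nat \<Rightarrow> int" and k c b D :: int
  assumes m: "even m" "m \<ge> 2" and a: "\<And>i. i < m \<Longrightarrow> a i \<noteq> 0" and k: "k \<noteq> 0"
    and det: "diag_det m a = c\<^sup>2 * b" and b: "squarefree b"
    and D: "D = quad_disc ((-1) ^ (m div 2) * b)"
  defines "R \<equiv> 1 / L_series (real m / 2) D *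
          ereal (\<Prod>p | prime p \<and> int p dvd 2 * k * diag_det m a.
            local_density_at m a k p /
              (1 - real_of_int (kronecker D p) * real p powr (- (real m / 2))))"
  shows "partial_density m a k \<longlonglongrightarrow> R"
proof -
  define s where "s = real m / 2"
  define u where "u = (-1) ^ (m div 2) * b"
  define S where "S = {p::nat. prime p \<and> int p dvd 2 * k * diag_det m a}"
  have s: "s \<ge> 1" using m by (simp add: s_def)
  have u: "squarefree u" using b by (cases "even (m div 2)") (auto simp: u_def)
  have "diag_det m a \<noteq> 0" using a by (simp add: diag_det_eq_prod)
  then have finS: "finite S" unfolding S_def using k by (intro finite_prime_divisors_int) auto
  let ?g = "\<lambda>p. 1 - real_of_int (kronecker D p) * real p powr (-s)"
  have gpos: "?g p > 0" if "prime p" for p using kronecker_powr_le_half[OF that s, of D] by (simp add: abs_le_iff)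
  have good: "local_density_at m a k p = ?g p" if p: "prime p" "p \<notin> S" for p
  proof -
    have nd: "\<not> int p dvd 2 * k * diag_det m a" using p by (simp add: S_def)
    then have "p \<noteq> 2" by auto
    then have p2: "p > 2" using prime_ge_2_nat[OF p(1)] by simp
    have "\<not> int p dvd k" "\<not> int p dvd diag_det m a" using nd by auto
    then have na: "\<not> int p dvd a i" if "i < m" for i
      using that unfolding diag_det_eq_prod by (meson dvd_prodI dvd_trans finite_lessThan lessThan_iff)
    have nc: "\<not> int p dvd c"
    proof
      assume "int p dvd c"
      then have "int p dvd c\<^sup>2 * b" by (simp add: power2_eq_square)
      then show False using \<open>\<not> int p dvd diag_det m a\<close> det by simp
    qed
    have "local_density_at m a k p = 1 - Legendre ((-1) ^ (m div 2) * (\<Prod>i<m. a i)) p / real p ^ (m div 2)"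
      by (rule local_density_at_odd_prime(1)[OF p(1) p2 _ na \<open>\<not> int p dvd k\<close> m(1)]) (use m in auto)
    also have "(-1) ^ (m div 2) * (\<Prod>i<m. a i) = c\<^sup>2 * u"
      using det by (simp add: u_def diag_det_eq_prod mult_ac)
    also have "Legendre (c\<^sup>2 * u) p = kronecker D p"
      unfolding D u_def[symmetric] by (rule Legendre_square_mult_eq_kronecker[OF p(1) p2 nc])
    also have "real p ^ (m div 2) = real p powr s"
      using p2 m by (simp add: s_def powr_realpow[symmetric] real_of_nat_div)
    finally show ?thesis by (simp add: powr_minus divide_inverse)
  qed
  define K where "K = (\<Prod>p\<in>S. local_density_at m a k p / ?g p)"
  have R: "R = 1 / L_series s D * ereal K" by (simp add: R_def K_def S_def s_def)
  have "eventually (\<lambda>N. (\<Prod>p | prime p \<and> p \<le> N. local_density_at m a k p) = K * euler_factors s D N) sequentially"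
    unfolding K_def by (rule prod_primes_split[OF finS]) (use gpos good in \<open>auto simp: S_def dest: less_imp_neq\<close>)
  then have ev: "eventually (\<lambda>N. ereal (K * euler_factors s D N) = partial_density m a k N) sequentially"
    by eventually_elim (simp add: partial_density_def)
  have Du: "D = quad_disc u" by (simp add: D u_def)
  show ?thesis
  proof (rule L_series_cases[OF u s])
    fix l assume l: "l > 0" "L_series s (quad_disc u) = ereal (1 / l)" "euler_factors s (quad_disc u) \<longlonglongrightarrow> l"
    have "(\<lambda>N. ereal (K * euler_factors s D N)) \<longlonglongrightarrow> ereal (K * l)"
      unfolding Du using l(3) by (intro tendsto_intros)
    moreover have "ereal (K * l) = R" unfolding R Du l(2) using l(1) by (simp add: one_ereal_def mult.commute)
    ultimately have "(\<lambda>N. ereal (K * euler_factors s D N)) \<longlonglongrightarrow> R" by (simp only:)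
    then show ?thesis using ev by (rule Lim_transform_eventually)
  next
    assume l: "L_series s (quad_disc u) = \<infinity>" "euler_factors s (quad_disc u) \<longlonglongrightarrow> 0"
    have "(\<lambda>N. ereal (K * euler_factors s D N)) \<longlonglongrightarrow> ereal (K * 0)"
      unfolding Du using l(2) by (intro tendsto_intros)
    moreover have "ereal (K * 0) = R" unfolding R Du l(1) by (simp add: zero_ereal_def)
    ultimately have "(\<lambda>N. ereal (K * euler_factors s D N)) \<longlonglongrightarrow> R" by (simp only:)
    then show ?thesis using ev by (rule Lim_transform_eventually)
  qed
qed

lemma partial_density_tendsto_odd:
  fixes m :: nat and a :: "nat \<Rightarrow> int" and k c b D :: int
  assumes m: "odd m" "m \<ge> 2" and a: "\<And>i. i < m \<Longrightarrow> a i \<noteq> 0" and k: "k \<noteq> 0"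
    and det: "k * diag_det m a = c\<^sup>2 * b" and b: "squarefree b"
    and D: "D = quad_disc ((-1) ^ ((m - 1) div 2) * b)"
  defines "R \<equiv> L_series ((real m - 1) / 2) D / ereal (zeta_real (real m - 1)) *
          ereal (\<Prod>p | prime p \<and> int p dvd D.
            local_density_at m a k p / (1 - real p powr (- (real m - 1)))) *
          ereal (\<Prod>p | prime p \<and> \<not> int p dvd D \<and> int p dvd 2 * k * diag_det m a.
            local_density_at m a k p /
              (1 + real_of_int (kronecker D p) * real p powr (- ((real m - 1) / 2))))"
  shows "partial_density m a k \<longlonglongrightarrow> R"
proof -
  define s where "s = (real m - 1) / 2"
  define u where "u = (-1) ^ ((m - 1) div 2) * b"
  define S where "S = {p::nat. prime p \<and> int p dvd 2 * k * diag_det m a}"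
  define S1 where "S1 = {p::nat. prime p \<and> int p dvd D}"
  define S2 where "S2 = {p::nat. prime p \<and> \<not> int p dvd D \<and> int p dvd 2 * k * diag_det m a}"
  have m3: "m \<ge> 3" using m by (cases "m = 2") auto
  have s: "s \<ge> 1" "2 * s > 1" "2 * s = real m - 1" using m3 by (auto simp: s_def)
  have u: "squarefree u" using b by (cases "even ((m - 1) div 2)") (auto simp: u_def)
  have Du: "D = quad_disc u" by (simp add: D u_def)
  have "diag_det m a \<noteq> 0" using a by (simp add: diag_det_eq_prod)
  then have finS: "finite S" unfolding S_def using k by (intro finite_prime_divisors_int) auto
  have "S1 \<subseteq> S"
  proof
    fix p assume "p \<in> S1"
    then have p: "prime p" "int p dvd quad_disc u" by (auto simp: S1_def Du)
    have "quad_disc u dvd 4 * u" by (simp add: quad_disc_def)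
    also have "4 * u dvd 4 * b" by (simp add: u_def)
    finally have 4: "int p dvd 2\<^sup>2 * b" using dvd_trans[OF p(2)] by simp
    have "prime (int p)" using p(1) by simp
    then have "int p dvd 2 \<or> int p dvd b"
      using 4 prime_dvd_mult_iff[of "int p" "2\<^sup>2" b] prime_dvd_power[of "int p" 2 2] by blast
    then have "int p dvd 2 * (k * diag_det m a)" unfolding det by auto
    then show "p \<in> S" using p(1) by (simp add: S_def mult.assoc)
  qed
  then have S: "S = S1 \<union> S2" "S1 \<inter> S2 = {}" by (auto simp: S_def S1_def S2_def)
  let ?x = "\<lambda>p. real p powr (-s)" and ?\<phi> = "\<lambda>p. real_of_int (kronecker D p)"
  \<comment> \<open>One comparison factor serves all primes: the Euler factor of zeta over that of
    \<open>L\<close>. It equals \<open>1 - x^2\<close> where the symbol is 0, that is for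
    \<open>p\<close> dividing \<open>D\<close>, and \<open>1 + (D/p) * x\<close> where the symbol is
    1 or -1, since then \<open>1 - x^2\<close> factors. These are the two denominators in the
    claim.\<close>
  define g where "g p = (1 - real p powr (- (2 * s))) / (1 - ?\<phi> p * ?x p)" for p
  have xx: "real p powr (- (2 * s)) = (?x p)\<^sup>2" for p
    using powr_add[of "real p" "-s" "-s"] by (simp add: power2_eq_square)
  have le_half: "\<bar>?\<phi> p * ?x p\<bar> \<le> 1 / 2" if "prime p" for p by (rule kronecker_powr_le_half[OF that s(1)])
  have g0: "g p = 1 - real p powr (- (2 * s))" if "prime p" "int p dvd D" for p
    using kronecker_prime_eq_0_iff[OF that(1), of D] that(2) by (simp add: g_def)
  have g1: "g p = 1 + ?\<phi> p * ?x p" if "prime p" "\<not> int p dvd D" for p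
  proof -
    have "?\<phi> p \<in> {-1, 1}"
      using kronecker_prime_eq_0_iff[OF that(1), of D] that(2) kronecker_values[of D p] by auto
    then have "1 - (?x p)\<^sup>2 = (1 + ?\<phi> p * ?x p) * (1 - ?\<phi> p * ?x p)"
      by (auto simp: power2_eq_square algebra_simps)
    moreover have "1 - ?\<phi> p * ?x p > 0" using le_half[OF that(1)] by (simp add: abs_le_iff)
    ultimately show ?thesis unfolding g_def xx by simp
  qed
  have gpos: "g p > 0" if p: "prime p" for p
  proof -
    have "real p powr (- (2 * s)) < 1 powr (- (2 * s))"
      using prime_gt_1_nat[OF p] s by (intro powr_less_mono2_neg) auto
    then show ?thesis unfolding g_def using le_half[OF p] by (intro divide_pos_pos) (auto simp: abs_le_iff)
  qed
  have good: "local_density_at m a k p = g p" if p: "prime p" "p \<notin> S" for p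
  proof -
    have nd: "\<not> int p dvd 2 * k * diag_det m a" using p by (simp add: S_def)
    then have "p \<noteq> 2" by auto
    then have p2: "p > 2" using prime_ge_2_nat[OF p(1)] by simp
    have nk: "\<not> int p dvd k" "\<not> int p dvd diag_det m a" "\<not> int p dvd k * diag_det m a"
      using nd by (auto simp: mult.assoc)
    then have na: "\<not> int p dvd a i" if "i < m" for i
      using that unfolding diag_det_eq_prod by (meson dvd_prodI dvd_trans finite_lessThan lessThan_iff)
    have nc: "\<not> int p dvd c"
    proof
      assume "int p dvd c"
      then have "int p dvd c\<^sup>2 * b" by (simp add: power2_eq_square)
      then show False using nk(3) det by simp
    qed
    have "local_density_at m a k p = 1 + Legendre ((-1) ^ ((m - 1) div 2) * (k * (\<Prod>i<m. a i))) p / real p ^ ((m - 1) div 2)"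
      by (rule local_density_at_odd_prime(2)[OF p(1) p2 _ na nk(1) m(1)]) (use m in auto)
    also have "(-1) ^ ((m - 1) div 2) * (k * (\<Prod>i<m. a i)) = c\<^sup>2 * u"
      using det by (simp add: u_def diag_det_eq_prod mult_ac)
    also have "Legendre (c\<^sup>2 * u) p = kronecker D p"
      unfolding Du by (rule Legendre_square_mult_eq_kronecker[OF p(1) p2 nc])
    also have "real p ^ ((m - 1) div 2) = real p powr s"
    proof -
      have "s = real ((m - 1) div 2)" using m by (auto elim!: oddE simp: s_def)
      then show ?thesis using p2 by (simp add: powr_realpow)
    qed
    finally have "local_density_at m a k p = 1 + ?\<phi> p * ?x p" by (simp add: powr_minus divide_inverse)
    moreover have "\<not> int p dvd D" using p \<open>S1 \<subseteq> S\<close> unfolding S1_def by blast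
    ultimately show ?thesis using g1[OF p(1)] by simp
  qed
  define K1 where "K1 = (\<Prod>p\<in>S1. local_density_at m a k p / g p)"
  define K2 where "K2 = (\<Prod>p\<in>S2. local_density_at m a k p / g p)"
  have R: "R = L_series s D / ereal (zeta_real (2 * s)) * ereal K1 * ereal K2"
  proof -
    have "K1 = (\<Prod>p | prime p \<and> int p dvd D. local_density_at m a k p / (1 - real p powr (- (real m - 1))))"
      unfolding K1_def S1_def by (rule prod.cong) (auto simp: g0 s(3))
    moreover have "K2 = (\<Prod>p | prime p \<and> \<not> int p dvd D \<and> int p dvd 2 * k * diag_det m a.
            local_density_at m a k p / (1 + ?\<phi> p * real p powr (- ((real m - 1) / 2))))"
      unfolding K2_def S2_def by (rule prod.cong) (auto simp: g1 s_def)
    ultimately show ?thesis unfolding R_def s(3) by (simp only: s_def)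
  qed
  have K: "(\<Prod>p\<in>S. local_density_at m a k p / g p) = K1 * K2"
    unfolding K1_def K2_def S(1) by (rule prod.union_disjoint) (use S finS in auto)
  define Z where "Z N = (\<Prod>p | prime p \<and> p \<le> N. 1 - real p powr (- (2 * s)))" for N
  have Zlim: "Z \<longlonglongrightarrow> 1 / zeta_real (2 * s)" and zpos: "zeta_real (2 * s) > 0"
    unfolding Z_def using zeta_real_euler_product[OF s(2)] by simp_all
  have gprod: "(\<Prod>p | prime p \<and> p \<le> N. g p) = Z N / euler_factors s D N" for N
    unfolding g_def Z_def by (rule prod_dividef)
  have "eventually (\<lambda>N. (\<Prod>p | prime p \<and> p \<le> N. local_density_at m a k p)
      = K1 * K2 * (\<Prod>p | prime p \<and> p \<le> N. g p)) sequentially"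
    unfolding K[symmetric]
  proof (rule prod_primes_split[OF finS])
    fix p assume "p \<in> S"
    then show "prime p" by (simp add: S_def)
    then show "g p \<noteq> 0" using gpos[of p] by simp
  qed (rule good)
  then have ev: "eventually (\<lambda>N. ereal (K1 * K2 * (Z N / euler_factors s D N)) = partial_density m a k N) sequentially"
    unfolding gprod by eventually_elim (simp add: partial_density_def)
  show ?thesis
  proof (rule L_series_cases[OF u s(1)])
    fix l assume l: "l > 0" "L_series s (quad_disc u) = ereal (1 / l)" "euler_factors s (quad_disc u) \<longlonglongrightarrow> l"
    have "(\<lambda>N. ereal (K1 * K2 * (Z N / euler_factors s D N))) \<longlonglongrightarrow> ereal (K1 * K2 * (1 / zeta_real (2 * s) / l))"
      unfolding Du using l(1,3) Zlim by (intro tendsto_intros) auto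
    moreover have "ereal (K1 * K2 * (1 / zeta_real (2 * s) / l)) = R"
      unfolding R Du l(2) using l(1) zpos by (simp add: mult_ac)
    ultimately have "(\<lambda>N. ereal (K1 * K2 * (Z N / euler_factors s D N))) \<longlonglongrightarrow> R" by (simp only:)
    then show ?thesis using ev by (rule Lim_transform_eventually)
  next
    assume l: "s = 1" "quad_disc u = 1" "L_series s (quad_disc u) = \<infinity>" "euler_factors s (quad_disc u) \<longlonglongrightarrow> 0"
    have "S1 = {}" using l(2) by (auto simp: S1_def Du)
    then have K1: "K1 = 1" by (simp add: K1_def)
    \<comment> \<open>The sign matters because the right-hand side becomes
      \<open>\<infinity> * K2\<close>, while the partial products behave like \<open>K2\<close>
      times a quantity tending to infinity.\<close>
    have "K2 \<ge> 0" unfolding K2_def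
      by (intro prod_nonneg divide_nonneg_nonneg) (auto simp: S2_def gpos less_imp_le local_density_at_nonneg k)
    have R': "R = \<infinity> * ereal K2" unfolding R Du l(3) K1 using zpos by simp
    show ?thesis
    proof (cases "K2 = 0")
      case True
      then have "(\<lambda>N. ereal (K1 * K2 * (Z N / euler_factors s D N))) \<longlonglongrightarrow> R" by (simp add: R' flip: zero_ereal_def)
      then show ?thesis using ev by (rule Lim_transform_eventually)
    next
      case False
      then have "K2 > 0" using \<open>K2 \<ge> 0\<close> by simp
      have "filterlim (\<lambda>N. Z N / euler_factors s D N) at_top sequentially"
      proof (rule LIM_at_top_divide[OF Zlim])
        show "euler_factors s D \<longlonglongrightarrow> 0" using l(4) unfolding Du .
        show "eventually (\<lambda>N. 0 < euler_factors s D N) sequentially"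
          by (intro always_eventually allI euler_factors_pos s(1))
      qed (use zpos in simp)
      then have "filterlim (\<lambda>N. K2 * (Z N / euler_factors s D N)) at_top sequentially"
        using \<open>K2 > 0\<close> by (intro filterlim_tendsto_pos_mult_at_top[OF tendsto_const]) auto
      then have "(\<lambda>N. ereal (K1 * K2 * (Z N / euler_factors s D N))) \<longlonglongrightarrow> \<infinity>"
        by (simp add: K1 tendsto_PInfty_eq_at_top)
      moreover have "R = \<infinity>" using R' \<open>K2 > 0\<close> by simp
      ultimately have "(\<lambda>N. ereal (K1 * K2 * (Z N / euler_factors s D N))) \<longlonglongrightarrow> R" by (simp only:)
    then show ?thesis using ev by (rule Lim_transform_eventually)
    qed
  qed
qed

theorem theorem3p2:
  fixes m :: nat and a :: "nat \<Rightarrow> int" and k :: int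
  assumes "m \<ge> 2"
    and "\<And>i. i < m \<Longrightarrow> a i \<noteq> 0"
    and "k \<noteq> 0"
  shows "(\<forall>p. prime p \<longrightarrow> convergent (density_ratio m a k p)) \<and>
    convergent (partial_density m a k) \<and>
    (odd m \<longrightarrow>
      (\<forall>c b D :: int. k * diag_det m a = c\<^sup>2 * b \<and> squarefree b \<and>
          D = quad_disc ((-1) ^ ((m - 1) div 2) * b) \<longrightarrow>
        local_density m a k =
          L_series ((real m - 1) / 2) D / ereal (zeta_real (real m - 1)) *
          ereal (\<Prod>p | prime p \<and> int p dvd D.
            local_density_at m a k p / (1 - real p powr (- (real m - 1)))) *
          ereal (\<Prod>p | prime p \<and> \<not> int p dvd D \<and> int p dvd 2 * k * diag_det m a.
            local_density_at m a k p /
              (1 + real_of_int (kronecker D p) * real p powr (- ((real m - 1) / 2)))))) \<and>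
    (even m \<longrightarrow>
      (\<forall>c b D :: int. diag_det m a = c\<^sup>2 * b \<and> squarefree b \<and>
          D = quad_disc ((-1) ^ (m div 2) * b) \<longrightarrow>
        local_density m a k =
          1 / L_series (real m / 2) D *
          ereal (\<Prod>p | prime p \<and> int p dvd 2 * k * diag_det m a.
            local_density_at m a k p /
              (1 - real_of_int (kronecker D p) * real p powr (- (real m / 2))))))"
proof (intro conjI allI impI)
  fix p :: nat assume "prime p"
  then show "convergent (density_ratio m a k p)" by (rule convergent_density_ratio[OF _ assms(3)])
next
  \<comment> \<open>Convergence is claimed without a given decomposition, so the canonical one into
    square and squarefree part is supplied.\<close>
  have dec: "n = (square_part n)\<^sup>2 * squarefree_part n" for n :: int
    by (metis squarefree_decompose mult.commute)
  show "convergent (partial_density m a k)"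
  proof (cases "even m")
    case True
    from partial_density_tendsto_even[OF True assms dec squarefree_squarefree_part refl]
    show ?thesis by (rule convergentI)
  next
    case False
    from partial_density_tendsto_odd[OF False assms dec squarefree_squarefree_part refl]
    show ?thesis by (rule convergentI)
  qed
next
  fix c b D :: int
  assume "odd m" and *: "k * diag_det m a = c\<^sup>2 * b \<and> squarefree b \<and> D = quad_disc ((-1) ^ ((m - 1) div 2) * b)"
  from * have "k * diag_det m a = c\<^sup>2 * b" "squarefree b" "D = quad_disc ((-1) ^ ((m - 1) div 2) * b)" by blast+
  from partial_density_tendsto_odd[OF \<open>odd m\<close> assms this]
  show "local_density m a k =
          L_series ((real m - 1) / 2) D / ereal (zeta_real (real m - 1)) *
          ereal (\<Prod>p | prime p \<and> int p dvd D.
            local_density_at m a k p / (1 - real p powr (- (real m - 1)))) *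
          ereal (\<Prod>p | prime p \<and> \<not> int p dvd D \<and> int p dvd 2 * k * diag_det m a.
            local_density_at m a k p /
              (1 + real_of_int (kronecker D p) * real p powr (- ((real m - 1) / 2))))"
    unfolding local_density_def by (rule limI)
next
  fix c b D :: int
  assume "even m" and *: "diag_det m a = c\<^sup>2 * b \<and> squarefree b \<and> D = quad_disc ((-1) ^ (m div 2) * b)"
  from * have "diag_det m a = c\<^sup>2 * b" "squarefree b" "D = quad_disc ((-1) ^ (m div 2) * b)" by blast+
  from partial_density_tendsto_even[OF \<open>even m\<close> assms this]
  show "local_density m a k =
          1 / L_series (real m / 2) D *
          ereal (\<Prod>p | prime p \<and> int p dvd 2 * k * diag_det m a.
            local_density_at m a k p /
              (1 - real_of_int (kronecker D p) * real p powr (- (real m / 2))))"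
    unfolding local_density_def by (rule limI)
qed

end
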